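(* Let $N\ge1$ be an integer, $Q=2N+2$, $s\in(0,1)$ and $p=\frac{Q}{Q-2s}$. Let $u_0,f\in L^\infty(\mathbb{H}^N)\cap L^1_{\mathrm{loc}}(\mathbb{H}^N)$ with $u_0\ge0$ and $\int_{\mathbb{H}^N}f>0$, and suppose that, for some $\alpha\in(0,Q)$, $f(\xi)\ge\|\xi\|_{\mathbb{H}^N}^{\alpha-Q}$ for $\|\xi\|_{\mathbb{H}^N}\ge1$. Then the problem $$\partial_t u+(-\Delta_{\mathbb{H}^N})^s u=|u|^p+f \ \text{ in } \mathbb{H}^N\times(0,T),\qquad u(0,\cdot)=u_0 \ \text{ in } \mathbb{H}^N,$$ does not possess a global-in-time weak solution (that is, a weak solution with $T=+\infty$).
   Context: The Heisenberg group $\mathbb{H}^N$ is $\mathbb{R}^{2N+1}$, with points $\xi=(x,y,w)$, $x,y\in\mathbb{R}^N$, $w\in\mathbb{R}$, and group law $\xi\circ\xi'=(x+x',\,y+y',\,w+w'+2\langle y,x'\rangle-2\langle x,y'\rangle)$; the inverse is $\xi^{-1}=-\xi$. Integrals and $L^q$ spaces are with respect to Lebesgue measure (the Haar measure). The homogeneous dimension is $Q=2N+2$. The homogeneous norm is $\|\xi\|_{\mathbb{H}^N}=\big[\sum_{i=1}^N(x_i^2+y_i^2)^2+w^2\big]^{1/4}$. Fractional sub-Laplacian of order $s\in(0,1)$: $$(-\Delta_{\mathbb{H}^N})^s u(\xi)=-\tfrac12 c(N,s)\int_{\mathbb{H}^N}\frac{u(\xi\circ\eta)+u(\xi\circ\eta^{-1})-2u(\xi)}{\|\eta\|_{\mathbb{H}^N}^{Q+2s}}\,d\eta,$$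 for $u$ in the Schwartz class (and, by the same formula, for $u\in C_c^2(\mathbb{H}^N)$), where $c(N,s)>0$ is a constant depending only on $N$ and $s$. Weak solution: for $0<T\le\infty$ and $u_0,f\in L^1_{\mathrm{loc}}(\mathbb{H}^N)$, a function $u\in L^p_{\mathrm{loc}}((0,T),L^p_{\mathrm{loc}}(\mathbb{H}^N))$ is a weak solution of the problem if $$-\int_0^T\!\!\int_{\mathbb{H}^N}u\big(\partial_t\phi-(-\Delta_{\mathbb{H}^N})^s\phi\big)=\int_0^T\!\!\int_{\mathbb{H}^N}|u|^p\phi+\int_{\mathbb{H}^N}u_0\,\phi(0,\cdot)+\int_0^T\!\!\int_{\mathbb{H}^N}f\phi$$ (all integrals being well defined) holds for every non-negative test function $\phi\in C_c^1([0,T),C_c^2(\mathbb{H}^N))$ (so $\phi$ vanishes at $t=T$). Here $\phi(0,\cdot)$ is the value of $\phi$ at time $t=0$, and $(-\Delta_{\mathbb{H}^N})^s$ acts in the space variable. It is called global-in-time if $T=+\infty$. *)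

theory Defs
  imports "HOL-Analysis.Analysis"
begin

section \<open>The Heisenberg group\<close>

text \<open>
  The Heisenberg group of rank N is modelled on the Euclidean space of triples (x, y, w), where the
  finite index type \<open>'n\<close> has N elements (so N is at least 1).
\<close>

type_synonym 'n heis = "(real ^ 'n) \<times> (real ^ 'n) \<times> real"

fun heis_mult :: "'n::finite heis \<Rightarrow> 'n heis \<Rightarrow> 'n heis" where
  "heis_mult (x, y, w) (x', y', w') = (x + x', y + y', w + w' + 2 * (y \<bullet> x') - 2 * (x \<bullet> y'))"

lemma group_heis: "group heis_mult (0 :: 'n::finite heis) uminus"
  by unfold_locales (auto simp: zero_prod_def algebra_simps inner_commute)

definition hom_dim :: "'n::finite itself \<Rightarrow> real" where
  "hom_dim _ = 2 * real CARD('n) + 2"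

fun heis_norm :: "'n::finite heis \<Rightarrow> real" where
  "heis_norm (x, y, w) = root 4 ((\<Sum>i\<in>UNIV. ((x $ i)\<^sup>2 + (y $ i)\<^sup>2)\<^sup>2) + w\<^sup>2)"

text \<open>
  The normalising constant c(N,s) enters as a parameter. The inverse of \<open>\<eta>\<close> is \<open>- \<eta>\<close>. On
  compactly supported functions of class C2 the integral converges absolutely.
\<close>

definition frac_sub_laplacian :: "real \<Rightarrow> real \<Rightarrow> ('n::finite heis \<Rightarrow> real) \<Rightarrow> 'n heis \<Rightarrow> real" where
  "frac_sub_laplacian c s u \<xi> =
     - (1 / 2) * c * (\<integral>\<eta>. (u (heis_mult \<xi> \<eta>) + u (heis_mult \<xi> (- \<eta>)) - 2 * u \<xi>)
                          / heis_norm \<eta> powr (hom_dim TYPE('n) + 2 * s) \<partial>lebesgue)"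

section \<open>Function spaces\<close>

definition L1_loc :: "('a::euclidean_space \<Rightarrow> real) \<Rightarrow> bool" where
  "L1_loc f \<longleftrightarrow> (\<forall>K. compact K \<longrightarrow> set_integrable lebesgue K f)"

definition L_infty :: "('a::euclidean_space \<Rightarrow> real) \<Rightarrow> bool" where
  "L_infty f \<longleftrightarrow> f \<in> borel_measurable lebesgue \<and> (\<exists>C. AE x in lebesgue. \<bar>f x\<bar> \<le> C)"

text \<open>
  Lebesgue integral with values in the extended reals. The Bochner integral of the library is 0 on
  non-integrable functions and thus unsuited to express that a possibly infinite integral is
  positive. If both parts are infinite, the integral is not defined and the value below is
  irrelevant.
\<close>

definition ext_integral :: "('a::euclidean_space \<Rightarrow> real) \<Rightarrow> ereal" where
  "ext_integral f =
     enn2ereal (\<integral>\<^sup>+x. ennreal (f x) \<partial>lebesgue) - enn2ereal (\<integral>\<^sup>+x. ennreal (- f x) \<partial>lebesgue)"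

definition fderiv ::
  "('a::real_normed_vector \<Rightarrow> 'b::real_normed_vector) \<Rightarrow> 'a \<Rightarrow> 'a \<Rightarrow>\<^sub>L 'b" where
  "fderiv g x = Blinfun (frechet_derivative g (at x))"

definition C2 :: "('a::euclidean_space \<Rightarrow> real) \<Rightarrow> bool" where
  "C2 g \<longleftrightarrow> g differentiable_on UNIV \<and> fderiv g differentiable_on UNIV
           \<and> continuous_on UNIV (fderiv (fderiv g))"

definition C2_supported :: "'a::euclidean_space set \<Rightarrow> ('a \<Rightarrow> real) \<Rightarrow> bool" where
  "C2_supported K g \<longleftrightarrow> C2 g \<and> closure {x. g x \<noteq> 0} \<subseteq> K"

definition C2_norm :: "('a::euclidean_space \<Rightarrow> real) \<Rightarrow> real" where
  "C2_norm g = (SUP x. \<bar>g x\<bar>) + (SUP x. norm (fderiv g x)) + (SUP x. norm (fderiv (fderiv g) x))"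

text \<open>
  The space of continuously differentiable curves \<open>\<phi>\<close> from [0,T) to the compactly supported C2
  functions that vanish near T. The target carries its inductive limit topology; as \<open>\<phi>\<close> has
  compact support in time, its values are then supported in one compact set K, and differentiability
  and continuity of the derivative \<open>\<psi>\<close> are with respect to the C2 norm. At time 0 they are
  one-sided. Values of \<open>\<phi>\<close> outside [0,T) are irrelevant.
\<close>

definition test_function :: "ereal \<Rightarrow> (real \<Rightarrow> 'a::euclidean_space \<Rightarrow> real) \<Rightarrow> bool" where
  "test_function T \<phi> \<longleftrightarrow>
     (let I = {t. 0 \<le> t \<and> ereal t < T} in
       (\<exists>b. ereal b < T \<and> (\<forall>t\<in>I. b < t \<longrightarrow> (\<forall>x. \<phi> t x = 0))) \<and>
       (\<exists>K \<psi>. compact K \<and>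
          (\<forall>t\<in>I. C2_supported K (\<phi> t) \<and> C2_supported K (\<psi> t)) \<and>
          (\<forall>t\<in>I. ((\<lambda>\<tau>. C2_norm (\<lambda>x. (\<phi> \<tau> x - \<phi> t x) / (\<tau> - t) - \<psi> t x)) \<longlongrightarrow> 0) (at t within I)) \<and>
          (\<forall>t\<in>I. ((\<lambda>\<tau>. C2_norm (\<lambda>x. \<psi> \<tau> x - \<psi> t x)) \<longlongrightarrow> 0) (at t within I))))"

section \<open>Weak solutions\<close>

definition time_space :: "ereal \<Rightarrow> (real \<times> 'a) set" where
  "time_space T = {t. 0 < t \<and> ereal t < T} \<times> UNIV"

text \<open>
  By Tonelli's theorem, the locally p-integrable functions of time with values in the locally
  p-integrable functions of space are the jointly measurable functions that are p-integrable on
  products of compact sets.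
\<close>

definition Lp_loc_Lp_loc :: "real \<Rightarrow> ereal \<Rightarrow> (real \<Rightarrow> 'a::euclidean_space \<Rightarrow> real) \<Rightarrow> bool" where
  "Lp_loc_Lp_loc p T u \<longleftrightarrow>
     (\<lambda>(t, x). u t x) \<in> borel_measurable (lebesgue_on (time_space T)) \<and>
     (\<forall>J K. compact J \<and> J \<subseteq> {t. 0 < t \<and> ereal t < T} \<and> compact K \<longrightarrow>
        set_integrable lebesgue (J \<times> K) (\<lambda>(t, x). \<bar>u t x\<bar> powr p))"

text \<open>
  All integrals in the weak formulation are required to converge absolutely; the iterated integrals
  over time and space are written as integrals over the product.
\<close>

definition weak_solution ::
  "real \<Rightarrow> real \<Rightarrow> real \<Rightarrow> ereal \<Rightarrow> ('n::finite heis \<Rightarrow> real) \<Rightarrow> ('n heis \<Rightarrow> real) \<Rightarrow>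
   (real \<Rightarrow> 'n heis \<Rightarrow> real) \<Rightarrow> bool" where
  "weak_solution c s p T u0 f u \<longleftrightarrow>
     Lp_loc_Lp_loc p T u \<and>
     (\<forall>\<phi>. test_function T \<phi> \<and> (\<forall>t \<xi>. 0 \<le> t \<and> ereal t < T \<longrightarrow> 0 \<le> \<phi> t \<xi>) \<longrightarrow>
       (let A = (\<lambda>(t, \<xi>). u t \<xi> * (deriv (\<lambda>\<tau>. \<phi> \<tau> \<xi>) t - frac_sub_laplacian c s (\<phi> t) \<xi>));
            B = (\<lambda>(t, \<xi>). \<bar>u t \<xi>\<bar> powr p * \<phi> t \<xi>);
            C = (\<lambda>\<xi>. u0 \<xi> * \<phi> 0 \<xi>);
            D = (\<lambda>(t, \<xi>). f \<xi> * \<phi> t \<xi>)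
        in set_integrable lebesgue (time_space T) A \<and>
           set_integrable lebesgue (time_space T) B \<and>
           integrable lebesgue C \<and>
           set_integrable lebesgue (time_space T) D \<and>
           - (LINT z:time_space T|lebesgue. A z) =
             (LINT z:time_space T|lebesgue. B z) + (\<integral>\<xi>. C \<xi> \<partial>lebesgue)
               + (LINT z:time_space T|lebesgue. D z)))"

definition global_weak_solution ::
  "real \<Rightarrow> real \<Rightarrow> real \<Rightarrow> ('n::finite heis \<Rightarrow> real) \<Rightarrow> ('n heis \<Rightarrow> real) \<Rightarrow>
   (real \<Rightarrow> 'n heis \<Rightarrow> real) \<Rightarrow> bool" where
  "global_weak_solution c s p u0 f u \<longleftrightarrow> weak_solution c s p \<infinity> u0 f u"

end

theory Submission
  imports Defs
begin

text \<open>
  The proof is by the test function method. Write L for the fractional sub-Laplacian, and test a global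
  weak solution u with \<open>\<theta>(t) \<phi>(\<xi>)\<close>, where \<open>\<phi>\<close> lives at scale R and \<open>\<theta>\<close> at the time scale
  \<open>T = R powr (2 * s)\<close>. Both the time derivative and L then cost a factor 1 / T. Young's inequality
  absorbs u into the reaction term and leaves a remainder of size
  \<open>T powr (1 - q) * R powr Q\<close>, where q is the conjugate exponent of p. Since \<open>q = Q / (2 * s)\<close>, this is a
  constant times T, so the source, averaged over the time interval, has a bounded integral against \<open>\<phi>\<close>
  (\<open>source_upper_bound\<close>). But the lower bound on f makes this integral grow at least like
  \<open>R powr \<alpha>\<close> (\<open>source_lower_bound\<close>), a contradiction for large R.

  The obstacle is that L is nonlocal and that u may change sign: \<open>L \<phi>\<close> does not vanish off the support of
  \<open>\<phi>\<close>, and the reaction term gives no control of u there. For this reason \<open>\<phi>\<close> is a truncation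
  of the weight \<open>w(\<xi>) = (1 + \<bar>\<xi>\<bar>^4) powr (- (Q + 2 * s) / 4)\<close>, rescaled by R. The weight decays exactly like
  the kernel of L, which has three consequences. First, \<open>\<bar>L \<phi>\<bar>\<close> is at most a multiple of w, uniformly in
  the truncation (\<open>frac_sub_laplacian_bump_upper\<close>). Second, \<open>\<bar>L \<phi>\<bar>\<close> is at least a multiple of w where \<open>\<phi>\<close>
  vanishes (\<open>frac_sub_laplacian_bump_lower\<close>), so the absolute convergence that is part of the notion
  of weak solution forces \<open>u \<theta> w\<close> to be integrable (\<open>weighted_integrable\<close>). Third, splitting
  \<open>w = \<phi> + (w - \<phi>)\<close>, the part with \<open>\<phi>\<close> is absorbed as above, and the part with \<open>w - \<phi>\<close> tends to 0 by
  dominated convergence when the truncation is removed at fixed R.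
\<close>

section \<open>Functions of class C2 and separable test functions\<close>

text \<open>
  Classes of differentiability are closed under products and compositions most easily when the
  derivative is a witness rather than a chosen value; the predicate below and \<open>C2_iff\<close> give this form.
  The range is a general normed space because the derivative of a C2 function has to be C1 as an
  operator-valued map.
\<close>

definition C1 :: "('a::euclidean_space \<Rightarrow> 'b::real_normed_vector) \<Rightarrow> bool" where
  "C1 f \<longleftrightarrow> (\<exists>f'. (\<forall>x. (f has_derivative blinfun_apply (f' x)) (at x)) \<and> continuous_on UNIV f')"

lemma fderiv_eq:
  assumes "(g has_derivative blinfun_apply g') (at x)"
  shows "fderiv g x = g'"
  unfolding fderiv_def using frechet_derivative_at[OF assms] by (metis blinfun_apply_inverse)

lemma fderiv_works:
  fixes g :: "'a::euclidean_space \<Rightarrow> 'b::real_normed_vector"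
  assumes "g differentiable (at x)"
  shows "(g has_derivative blinfun_apply (fderiv g x)) (at x)"
proof -
  have "(g has_derivative frechet_derivative g (at x)) (at x)"
    using assms frechet_derivative_works by blast
  moreover from this have "bounded_linear (frechet_derivative g (at x))"
    by (rule has_derivative_bounded_linear)
  ultimately show ?thesis
    unfolding fderiv_def by (simp add: bounded_linear_Blinfun_apply)
qed

lemma C1_iff_fderiv:
  "C1 f \<longleftrightarrow> (\<forall>x. f differentiable (at x)) \<and> continuous_on UNIV (fderiv f)"
proof
  assume "C1 f"
  then obtain f' where f': "\<And>x. (f has_derivative blinfun_apply (f' x)) (at x)" "continuous_on UNIV f'"
    unfolding C1_def by blast
  then have "fderiv f = f'" by (auto intro: fderiv_eq)
  with f' show "(\<forall>x. f differentiable (at x)) \<and> continuous_on UNIV (fderiv f)"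
    by (auto simp: differentiable_def)
next
  assume "(\<forall>x. f differentiable (at x)) \<and> continuous_on UNIV (fderiv f)"
  then show "C1 f" unfolding C1_def using fderiv_works by blast
qed

lemma C2_iff:
  "C2 g \<longleftrightarrow> (\<exists>g'. (\<forall>x. (g has_derivative blinfun_apply (g' x)) (at x)) \<and> C1 g')"
proof
  assume "C2 g"
  then have "\<forall>x. g differentiable (at x)" "C1 (fderiv g)"
    unfolding C2_def C1_iff_fderiv by (auto simp: differentiable_on_def)
  then show "\<exists>g'. (\<forall>x. (g has_derivative blinfun_apply (g' x)) (at x)) \<and> C1 g'"
    using fderiv_works by blast
next
  assume "\<exists>g'. (\<forall>x. (g has_derivative blinfun_apply (g' x)) (at x)) \<and> C1 g'"
  then obtain g' where g': "\<And>x. (g has_derivative blinfun_apply (g' x)) (at x)" "C1 g'"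
    by blast
  then have "fderiv g = g'" by (auto intro: fderiv_eq)
  with g' show "C2 g"
    unfolding C2_def C1_iff_fderiv by (auto simp: differentiable_on_def differentiable_def)
qed

lemma C2_imp_C1: "C2 f \<Longrightarrow> C1 f"
  unfolding C2_iff C1_def
  by (meson continuous_at_imp_continuous_on has_derivative_continuous)

lemma C1_continuous: "C1 f \<Longrightarrow> continuous_on UNIV f"
  unfolding C1_def
  by (meson continuous_at_imp_continuous_on has_derivative_continuous)

lemma C1_const: "C1 (\<lambda>x. c)"
  unfolding C1_def by (rule exI[of _ "\<lambda>_. 0"]) (simp add: zero_blinfun.rep_eq)

lemma C1_add:
  assumes "C1 f" "C1 g"
  shows "C1 (\<lambda>x. f x + g x)"
proof -
  from assms obtain f' g' where
    f': "\<And>x. (f has_derivative blinfun_apply (f' x)) (at x)" "continuous_on UNIV f'" and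
    g': "\<And>x. (g has_derivative blinfun_apply (g' x)) (at x)" "continuous_on UNIV g'"
    unfolding C1_def by metis
  show ?thesis unfolding C1_def
    by (rule exI[of _ "\<lambda>x. f' x + g' x"])
       (auto simp: plus_blinfun.rep_eq intro!: has_derivative_add f' g' continuous_intros)
qed

lemma C1_scaleR:
  assumes "C1 f" "C1 g"
  shows "C1 (\<lambda>x. f x *\<^sub>R g x)"
proof -
  from assms obtain f' g' where
    f': "\<And>x. (f has_derivative blinfun_apply (f' x)) (at x)" "continuous_on UNIV f'" and
    g': "\<And>x. (g has_derivative blinfun_apply (g' x)) (at x)" "continuous_on UNIV g'"
    unfolding C1_def by metis
  have "((\<lambda>x. f x *\<^sub>R g x) has_derivative
      blinfun_apply (f x *\<^sub>R g' x + (blinfun_scaleR_left (g x) o\<^sub>L f' x))) (at x)" for x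
    by (rule has_derivative_eq_rhs[OF has_derivative_scaleR[OF f'(1) g'(1)]])
       (auto simp: blinfun.bilinear_simps fun_eq_iff)
  moreover have "continuous_on UNIV (\<lambda>x. f x *\<^sub>R g' x + (blinfun_scaleR_left (g x) o\<^sub>L f' x))"
    using C1_continuous[OF assms(1)] C1_continuous[OF assms(2)] f'(2) g'(2)
    by (intro continuous_intros bounded_linear.continuous_on[OF bounded_linear_blinfun_scaleR_left]
          bounded_bilinear.continuous_on[OF bounded_bilinear_blinfun_compose]) auto
  ultimately show ?thesis unfolding C1_def 
    by (intro exI[of _ "\<lambda>x. f x *\<^sub>R g' x + (blinfun_scaleR_left (g x) o\<^sub>L f' x)"]) blast
qed

lemma has_derivative_compose_real:
  assumes "(f has_derivative blinfun_apply f') (at x)" "(h has_real_derivative h1) (at (f x))"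
  shows "((\<lambda>x. h (f x)) has_derivative blinfun_apply (h1 *\<^sub>R f')) (at x)"
  by (rule has_derivative_eq_rhs[OF has_derivative_compose[OF assms(1)
        assms(2)[unfolded has_field_derivative_def]]])
     (auto simp: blinfun.bilinear_simps fun_eq_iff)

lemma C1_compose_real:
  assumes f: "C1 f" and h: "\<And>x. (h has_real_derivative h1 (f x)) (at (f x))"
    and cont: "continuous_on (range f) h1"
  shows "C1 (\<lambda>x. h (f x))"
proof -
  from f obtain f' where
    f': "\<And>x. (f has_derivative blinfun_apply (f' x)) (at x)" "continuous_on UNIV f'"
    unfolding C1_def by metis
  have "continuous_on UNIV (\<lambda>x. h1 (f x))"
    using continuous_on_compose[OF C1_continuous[OF f] cont] by (simp add: o_def)
  then have "continuous_on UNIV (\<lambda>x. h1 (f x) *\<^sub>R f' x)"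
    using f' by (intro continuous_intros)
  then show ?thesis
    unfolding C1_def using has_derivative_compose_real[OF f'(1) h]
    by (intro exI[of _ "\<lambda>x. h1 (f x) *\<^sub>R f' x"]) simp
qed

lemma C2_const: "C2 (\<lambda>x. c)"
  unfolding C2_iff by (rule exI[of _ "\<lambda>_. 0"]) (simp add: C1_const zero_blinfun.rep_eq)

lemma C2_bounded_linear:
  assumes "bounded_linear f"
  shows "C2 f"
  unfolding C2_iff
  by (rule exI[of _ "\<lambda>_. Blinfun f"])
     (auto simp: bounded_linear_Blinfun_apply[OF assms] C1_const intro: bounded_linear_imp_has_derivative assms)

lemma C2_add:
  assumes "C2 f" "C2 g"
  shows "C2 (\<lambda>x. f x + g x)"
proof -
  from assms obtain f' g' where
    f': "\<And>x. (f has_derivative blinfun_apply (f' x)) (at x)" "C1 f'" and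
    g': "\<And>x. (g has_derivative blinfun_apply (g' x)) (at x)" "C1 g'"
    unfolding C2_iff by metis
  show ?thesis unfolding C2_iff
    by (rule exI[of _ "\<lambda>x. f' x + g' x"])
       (auto simp: plus_blinfun.rep_eq intro!: has_derivative_add f' g' C1_add)
qed

lemma C2_sum:
  assumes "finite I" "\<And>i. i \<in> I \<Longrightarrow> C2 (f i)"
  shows "C2 (\<lambda>x. \<Sum>i\<in>I. f i x)"
  using assms by (induction I rule: finite_induct) (auto intro: C2_add C2_const)

lemma C2_mult:
  assumes "C2 f" "C2 g"
  shows "C2 (\<lambda>x. f x * g x)"
proof -
  from assms obtain f' g' where
    f': "\<And>x. (f has_derivative blinfun_apply (f' x)) (at x)" "C1 f'" and
    g': "\<And>x. (g has_derivative blinfun_apply (g' x)) (at x)" "C1 g'"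
    unfolding C2_iff by metis
  have "((\<lambda>x. f x * g x) has_derivative blinfun_apply (f x *\<^sub>R g' x + g x *\<^sub>R f' x)) (at x)" for x
    by (rule has_derivative_eq_rhs[OF has_derivative_mult[OF f'(1) g'(1)]])
       (auto simp: blinfun.bilinear_simps fun_eq_iff)
  then show ?thesis unfolding C2_iff
    by (intro exI[of _ "\<lambda>x. f x *\<^sub>R g' x + g x *\<^sub>R f' x"])
       (use assms f'(2) g'(2) in \<open>auto intro!: C1_add C1_scaleR C2_imp_C1\<close>)
qed

lemma C2_compose_real:
  assumes f: "C2 f" and h: "\<And>x. (h has_real_derivative h1 (f x)) (at (f x))"
    and h1: "\<And>x. (h1 has_real_derivative h2 (f x)) (at (f x))"
    and cont: "continuous_on (range f) h2"
  shows "C2 (\<lambda>x. h (f x))"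
proof -
  from f obtain f' where
    f': "\<And>x. (f has_derivative blinfun_apply (f' x)) (at x)" "C1 f'"
    unfolding C2_iff by metis
  have "C1 (\<lambda>x. h1 (f x) *\<^sub>R f' x)"
    by (intro C1_scaleR C1_compose_real[OF C2_imp_C1[OF f] h1 cont] f')
  then show ?thesis
    unfolding C2_iff using has_derivative_compose_real[OF f'(1) h]
    by (intro exI[of _ "\<lambda>x. h1 (f x) *\<^sub>R f' x"]) simp
qed

lemma bdd_above_norm_compact_support:
  fixes g :: "'a::euclidean_space \<Rightarrow> 'b::real_normed_vector"
  assumes "continuous_on UNIV g" "compact K" "\<And>x. x \<notin> K \<Longrightarrow> g x = 0"
  shows "bdd_above (range (\<lambda>x. norm (g x)))"
proof -
  have "compact (g ` K)"
    using assms by (intro compact_continuous_image) (auto intro: continuous_on_subset)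
  then obtain B where B: "\<And>y. y \<in> g ` K \<Longrightarrow> norm y \<le> B"
    using compact_imp_bounded bounded_iff by metis
  have "norm (g x) \<le> max B 0" for x
    using B[of "g x"] assms(3)[of x] by (cases "x \<in> K") (auto simp: le_max_iff_disj)
  then show ?thesis by (auto intro!: bdd_aboveI)
qed

lemma fderiv_zero_outside:
  fixes g :: "'a::euclidean_space \<Rightarrow> 'b::real_normed_vector"
  assumes "compact K" "\<And>x. x \<notin> K \<Longrightarrow> g x = 0" "x \<notin> K"
  shows "fderiv g x = 0"
proof (rule fderiv_eq)
  have "((\<lambda>x. 0) has_derivative blinfun_apply (0::'a \<Rightarrow>\<^sub>L 'b)) (at x)"
    by (simp add: zero_blinfun.rep_eq)
  then show "(g has_derivative blinfun_apply 0) (at x)"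
    by (rule has_derivative_transform_within_open[where s = "- K"])
       (use assms in \<open>auto simp: compact_imp_closed open_Compl\<close>)
qed

lemma fderiv_scaleR:
  fixes g :: "'a::euclidean_space \<Rightarrow> 'b::real_normed_vector"
  assumes "\<forall>x. g differentiable (at x)"
  shows "fderiv (\<lambda>x. a *\<^sub>R g x) = (\<lambda>x. a *\<^sub>R fderiv g x)"
proof
  fix x
  show "fderiv (\<lambda>x. a *\<^sub>R g x) x = a *\<^sub>R fderiv g x"
    by (rule fderiv_eq)
       (use has_derivative_scaleR_right[OF fderiv_works, of g x a] assms in
          \<open>auto simp: scaleR_blinfun.rep_eq\<close>)
qed

text \<open>
  A supremum over an unbounded set of reals is an arbitrary value, so homogeneity needs all three
  suprema to be taken over bounded sets. Compactness of the support provides this.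
\<close>

lemma C2_norm_scale:
  assumes g: "C2 g" and K: "compact K" "\<And>x. x \<notin> K \<Longrightarrow> g x = 0"
  shows "C2_norm (\<lambda>x. a * g x) = \<bar>a\<bar> * C2_norm g"
proof -
  have d: "\<forall>x. g differentiable (at x)" "\<forall>x. fderiv g differentiable (at x)"
    and c: "continuous_on UNIV (fderiv (fderiv g))"
    using g unfolding C2_def by (auto simp: differentiable_on_def)
  have 1: "fderiv (\<lambda>x. a * g x) = (\<lambda>x. a *\<^sub>R fderiv g x)"
    using fderiv_scaleR[OF d(1)] by simp
  have 2: "fderiv (\<lambda>x. a *\<^sub>R fderiv g x) = (\<lambda>x. a *\<^sub>R fderiv (fderiv g) x)"
    by (rule fderiv_scaleR[OF d(2)])
  have z1: "fderiv g x = 0" if "x \<notin> K" for x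
    by (rule fderiv_zero_outside) (use K that in auto)
  have z2: "fderiv (fderiv g) x = 0" if "x \<notin> K" for x
    by (rule fderiv_zero_outside[OF K(1)]) (use z1 that in auto)
  have b0: "bdd_above (range (\<lambda>x. norm (g x)))"
    by (rule bdd_above_norm_compact_support[OF C1_continuous[OF C2_imp_C1[OF g]] K])
  have b1: "bdd_above (range (\<lambda>x. norm (fderiv g x)))"
    by (rule bdd_above_norm_compact_support[OF _ K(1) z1])
       (use d in \<open>auto intro: differentiable_imp_continuous_on simp: differentiable_on_def\<close>)
  have b2: "bdd_above (range (\<lambda>x. norm (fderiv (fderiv g) x)))"
    by (rule bdd_above_norm_compact_support[OF c K(1) z2])
  have sup: "(SUP x. \<bar>a\<bar> * norm (h x)) = \<bar>a\<bar> * (SUP x. norm (h x))"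
    if "bdd_above (range (\<lambda>x. norm (h x)))" for h :: "'a \<Rightarrow> 'c::real_normed_vector"
  proof (cases "a = 0")
    case False
    have "continuous (at_left z) (\<lambda>y. \<bar>a\<bar> * y)" for z :: real
      by (intro continuous_intros)
    with False show ?thesis
      using continuous_at_Sup_mono[of "\<lambda>y. \<bar>a\<bar> * y" "range (\<lambda>x. norm (h x))"] that
      by (auto simp: mono_def mult_left_mono image_image intro!: continuous_intros)
  qed simp
  show ?thesis
    unfolding C2_norm_def 1 2
    using sup[OF b0] sup[OF b1] sup[OF b2] by (simp add: abs_mult algebra_simps)
qed

text \<open>
  For a product of a function of time and a function of space, the difference quotients in the C2 norm
  are those of the time factor times a constant.
\<close>

lemma test_function_separable:
  assumes g: "C2 g" and K: "compact K" "closure {x. g x \<noteq> 0} \<subseteq> K"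
    and \<theta>: "\<And>t. (\<theta> has_real_derivative \<theta>' t) (at t)" "continuous_on UNIV \<theta>'"
    and b: "\<And>t. b < t \<Longrightarrow> \<theta> t = 0"
  shows "test_function \<infinity> (\<lambda>t x. \<theta> t * g x)"
proof -
  have z: "g x = 0" if "x \<notin> K" for x
    using K(2) that closure_subset[of "{x. g x \<noteq> 0}"] by auto
  have supp: "C2_supported K (\<lambda>x. a * g x)" for a
    unfolding C2_supported_def
    using C2_mult[OF C2_const[of a] g] K(2) closure_mono[of "{x. a * g x \<noteq> 0}" "{x. g x \<noteq> 0}"] by auto
  have "((\<lambda>\<tau>. C2_norm (\<lambda>x. (\<theta> \<tau> * g x - \<theta> t * g x) / (\<tau> - t) - \<theta>' t * g x)) \<longlongrightarrow> 0) (at t within I)"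
    for t I
  proof -
    have eq: "(\<theta> \<tau> * g x - \<theta> t * g x) / (\<tau> - t) - \<theta>' t * g x
        = ((\<theta> \<tau> - \<theta> t) / (\<tau> - t) - \<theta>' t) * g x" for \<tau> x
      by (simp add: left_diff_distrib diff_divide_distrib)
    have "(\<lambda>\<tau>. C2_norm (\<lambda>x. (\<theta> \<tau> * g x - \<theta> t * g x) / (\<tau> - t) - \<theta>' t * g x)) =
        (\<lambda>\<tau>. \<bar>(\<theta> \<tau> - \<theta> t) / (\<tau> - t) - \<theta>' t\<bar> * C2_norm g)"
      using C2_norm_scale[OF g K(1) z] by (simp add: eq)
    moreover have "((\<lambda>\<tau>. (\<theta> \<tau> - \<theta> t) / (\<tau> - t)) \<longlongrightarrow> \<theta>' t) (at t within I)"
      using has_field_derivative_at_within[OF \<theta>(1)] unfolding has_field_derivative_iff by blast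
    then have "((\<lambda>\<tau>. \<bar>(\<theta> \<tau> - \<theta> t) / (\<tau> - t) - \<theta>' t\<bar> * C2_norm g) \<longlongrightarrow> \<bar>\<theta>' t - \<theta>' t\<bar> * C2_norm g) (at t within I)"
      by (intro tendsto_intros)
    ultimately show ?thesis by simp
  qed
  moreover have "((\<lambda>\<tau>. C2_norm (\<lambda>x. \<theta>' \<tau> * g x - \<theta>' t * g x)) \<longlongrightarrow> 0) (at t within I)" for t I
  proof -
    have "(\<lambda>\<tau>. C2_norm (\<lambda>x. \<theta>' \<tau> * g x - \<theta>' t * g x)) = (\<lambda>\<tau>. \<bar>\<theta>' \<tau> - \<theta>' t\<bar> * C2_norm g)"
      using C2_norm_scale[OF g K(1) z] by (simp add: left_diff_distrib[symmetric])
    moreover have "(\<theta>' \<longlongrightarrow> \<theta>' t) (at t within I)"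
      using \<theta>(2) unfolding continuous_on_def by (meson UNIV_I tendsto_within_subset top_greatest)
    then have "((\<lambda>\<tau>. \<bar>\<theta>' \<tau> - \<theta>' t\<bar> * C2_norm g) \<longlongrightarrow> \<bar>\<theta>' t - \<theta>' t\<bar> * C2_norm g) (at t within I)"
      by (intro tendsto_intros)
    ultimately show ?thesis by simp
  qed
  ultimately show ?thesis
    unfolding test_function_def Let_def using supp b K(1)
    by (auto intro!: exI[of _ b] exI[of _ K] exI[of _ "\<lambda>t x. \<theta>' t * g x"])
qed

section \<open>Gauge and dilations\<close>

text \<open>
  The fourth power of the homogeneous norm is a polynomial, hence smooth also at the origin. Derivatives
  are taken of it, and the norm itself serves for estimates.
\<close>

definition quartic :: "'n::finite heis \<Rightarrow> real" where
  "quartic \<xi> = (\<Sum>i\<in>UNIV. ((fst \<xi> $ i)\<^sup>2 + (fst (snd \<xi>) $ i)\<^sup>2)\<^sup>2) + (snd (snd \<xi>))\<^sup>2"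

text \<open>
  The automorphic dilations of the group: the central coordinate scales quadratically.
\<close>

definition dil :: "real \<Rightarrow> 'n::finite heis \<Rightarrow> 'n heis" where
  "dil r \<xi> = (r *\<^sub>R fst \<xi>, r *\<^sub>R fst (snd \<xi>), r\<^sup>2 * snd (snd \<xi>))"

lemma heis_mult_eq:
  "heis_mult \<xi> \<eta> = (fst \<xi> + fst \<eta>, fst (snd \<xi>) + fst (snd \<eta>),
     snd (snd \<xi>) + snd (snd \<eta>) + 2 * (fst (snd \<xi>) \<bullet> fst \<eta>) - 2 * (fst \<xi> \<bullet> fst (snd \<eta>)))"
  by (cases \<xi>; cases \<eta>) simp

lemma heis_norm_eq: "heis_norm \<xi> = root 4 (quartic \<xi>)"
  by (cases \<xi>) (simp add: quartic_def heis_norm.simps)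

declare heis_norm.simps [simp del]

lemma quartic_nonneg [simp]: "0 \<le> quartic \<xi>"
  unfolding quartic_def by (intro add_nonneg_nonneg sum_nonneg) auto

lemma heis_norm_nonneg [simp]: "0 \<le> heis_norm \<xi>"
  by (simp add: heis_norm_eq)

lemma heis_norm_pow4: "heis_norm \<xi> ^ 4 = quartic \<xi>"
  by (simp add: heis_norm_eq)

lemma heis_norm_less_iff: "0 \<le> a \<Longrightarrow> heis_norm \<xi> < a \<longleftrightarrow> quartic \<xi> < a ^ 4"
  using power_mono_iff[of a "heis_norm \<xi>" 4] by (simp add: heis_norm_pow4 not_le[symmetric])

lemma quartic_uminus [simp]: "quartic (- \<xi>) = quartic \<xi>"
  by (simp add: quartic_def)

lemma quartic_dil: "quartic (dil r \<xi>) = r ^ 4 * quartic \<xi>"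
proof -
  have "((r * a)\<^sup>2 + (r * b)\<^sup>2)\<^sup>2 = r ^ 4 * (a\<^sup>2 + b\<^sup>2)\<^sup>2" for a b
    by algebra
  moreover have "(r\<^sup>2 * a)\<^sup>2 = r ^ 4 * a\<^sup>2" for a
    by algebra
  ultimately show ?thesis
    unfolding quartic_def dil_def by (simp add: sum_distrib_left distrib_left)
qed

lemma heis_norm_dil: "0 \<le> r \<Longrightarrow> heis_norm (dil r \<xi>) = r * heis_norm \<xi>"
  by (simp add: heis_norm_eq quartic_dil real_root_mult real_root_power_cancel)

lemma dil_dil [simp]: "dil r (dil q \<xi>) = dil (r * q) \<xi>"
  by (simp add: dil_def power_mult_distrib)

lemma dil_1 [simp]: "dil 1 \<xi> = \<xi>"
  by (simp add: dil_def)

lemma dil_uminus: "dil r (- \<xi>) = - dil r \<xi>"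
  by (simp add: dil_def)

lemma dil_heis_mult: "dil r (heis_mult \<xi> \<eta>) = heis_mult (dil r \<xi>) (dil r \<eta>)"
  by (simp add: dil_def heis_mult_eq algebra_simps power2_eq_square)

lemma heis_mult_uminus_cancel: "heis_mult (- \<xi>) (heis_mult \<xi> \<eta>) = \<eta>"
  by (cases \<xi>; cases \<eta>) (simp add: algebra_simps inner_commute)

lemma quartic_coord_bounds:
  assumes "quartic \<xi> \<le> a ^ 4" "0 \<le> a"
  shows "\<bar>fst \<xi> $ i\<bar> \<le> a" "\<bar>fst (snd \<xi>) $ i\<bar> \<le> a" "\<bar>snd (snd \<xi>)\<bar> \<le> a\<^sup>2"
proof -
  let ?q = "\<lambda>i. (fst \<xi> $ i)\<^sup>2 + (fst (snd \<xi>) $ i)\<^sup>2"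
  have "(?q i)\<^sup>2 \<le> (\<Sum>i\<in>UNIV. (?q i)\<^sup>2)"
    by (rule member_le_sum) auto
  also have "\<dots> \<le> quartic \<xi>" unfolding quartic_def by simp
  also have "\<dots> \<le> (a\<^sup>2)\<^sup>2" using assms(1) by simp
  finally have "?q i \<le> a\<^sup>2"
    using power2_le_imp_le[of "?q i" "a\<^sup>2"] by simp
  then have "(fst \<xi> $ i)\<^sup>2 \<le> a\<^sup>2" "(fst (snd \<xi>) $ i)\<^sup>2 \<le> a\<^sup>2"
    using zero_le_power2[of "fst \<xi> $ i"] zero_le_power2[of "fst (snd \<xi>) $ i"] by linarith+
  then show "\<bar>fst \<xi> $ i\<bar> \<le> a" "\<bar>fst (snd \<xi>) $ i\<bar> \<le> a"
    using abs_le_square_iff[of _ a] assms(2) by auto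
  have "(snd (snd \<xi>))\<^sup>2 \<le> quartic \<xi>"
    unfolding quartic_def by (simp add: sum_nonneg)
  also have "\<dots> \<le> (a\<^sup>2)\<^sup>2" using assms(1) by simp
  finally show "\<bar>snd (snd \<xi>)\<bar> \<le> a\<^sup>2"
    using abs_le_square_iff[of "snd (snd \<xi>)" "a\<^sup>2"] by simp
qed

lemma inner_coord_bound:
  fixes v v' :: "real ^ 'n"
  assumes "\<And>i. \<bar>v $ i\<bar> \<le> a" "\<And>i. \<bar>v' $ i\<bar> \<le> b"
  shows "\<bar>v \<bullet> v'\<bar> \<le> real CARD('n) * (a * b)"
proof -
  have "\<bar>v \<bullet> v'\<bar> \<le> (\<Sum>i\<in>UNIV. \<bar>v $ i * v' $ i\<bar>)"
    unfolding inner_vec_def by (simp add: sum_abs)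
  also have "\<dots> \<le> (\<Sum>i\<in>(UNIV::'n set). a * b)"
  proof (rule sum_mono)
    fix i
    show "\<bar>v $ i * v' $ i\<bar> \<le> a * b"
      using mult_mono[OF assms(1)[of i] assms(2)[of i]] assms(1)[of i] by (simp add: abs_mult)
  qed
  finally show ?thesis by simp
qed

lemma quartic_coord_upper:
  fixes \<xi> :: "'n::finite heis"
  assumes "\<And>i. \<bar>fst \<xi> $ i\<bar> \<le> A" "\<And>i. \<bar>fst (snd \<xi>) $ i\<bar> \<le> A" "\<bar>snd (snd \<xi>)\<bar> \<le> B"
  shows "quartic \<xi> \<le> real CARD('n) * (2 * A\<^sup>2)\<^sup>2 + B\<^sup>2"
proof -
  have A: "0 \<le> A" using assms(1)[of undefined] by simp
  have sq: "z\<^sup>2 \<le> A\<^sup>2" if "\<bar>z\<bar> \<le> A" for z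
    using power_mono[OF that, of 2] by simp
  have "((fst \<xi> $ i)\<^sup>2 + (fst (snd \<xi>) $ i)\<^sup>2)\<^sup>2 \<le> (2 * A\<^sup>2)\<^sup>2" for i
    using sq[OF assms(1)[of i]] sq[OF assms(2)[of i]] by (intro power_mono) auto
  then have "(\<Sum>i\<in>UNIV. ((fst \<xi> $ i)\<^sup>2 + (fst (snd \<xi>) $ i)\<^sup>2)\<^sup>2) \<le> (\<Sum>i\<in>(UNIV::'n set). (2 * A\<^sup>2)\<^sup>2)"
    by (intro sum_mono) auto
  moreover have "(snd (snd \<xi>))\<^sup>2 \<le> B\<^sup>2"
    using power_mono[OF assms(3), of 2] by simp
  ultimately show ?thesis unfolding quartic_def by simp
qed

text \<open>
  Every term of the coordinates of a product has the degree of homogeneity of the coordinate, so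
  coordinate bounds by the larger of the two norms give the estimate.
\<close>

lemma quartic_quasi_triangle:
  obtains K where "K \<ge> 1"
    "\<And>\<xi> \<eta> :: 'n::finite heis. quartic (heis_mult \<xi> \<eta>) \<le> K * (quartic \<xi> + quartic \<eta>)"
proof
  let ?N = "real CARD('n)"
  let ?K = "?N * 64 + (2 + 4 * ?N)\<^sup>2"
  have N: "?N \<ge> 1" by (simp add: Suc_leI)
  show "?K \<ge> 1" using N zero_le_power2[of "2 + 4 * ?N"] by linarith
  fix \<xi> \<eta> :: "'n heis"
  define a where "a = max (heis_norm \<xi>) (heis_norm \<eta>)"
  have a: "0 \<le> a" "quartic \<xi> \<le> a ^ 4" "quartic \<eta> \<le> a ^ 4"
    unfolding a_def heis_norm_pow4[symmetric] by (auto intro!: power_mono simp: le_max_iff_disj)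
  have a4: "a ^ 4 \<le> quartic \<xi> + quartic \<eta>"
    unfolding a_def by (auto simp: max_def heis_norm_pow4)
  note b1 = quartic_coord_bounds[OF a(2,1)] and b2 = quartic_coord_bounds[OF a(3,1)]
  have i1: "\<bar>fst (snd \<xi>) \<bullet> fst \<eta>\<bar> \<le> ?N * (a * a)" by (rule inner_coord_bound) (use b1 b2 in auto)
  have i2: "\<bar>fst \<xi> \<bullet> fst (snd \<eta>)\<bar> \<le> ?N * (a * a)" by (rule inner_coord_bound) (use b1 b2 in auto)
  have "quartic (heis_mult \<xi> \<eta>) \<le> ?N * (2 * (2 * a)\<^sup>2)\<^sup>2 + ((2 + 4 * ?N) * a\<^sup>2)\<^sup>2"
  proof (rule quartic_coord_upper)
    show "\<bar>fst (heis_mult \<xi> \<eta>) $ i\<bar> \<le> 2 * a" for i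
      using b1(1)[of i] b2(1)[of i] by (simp add: heis_mult_eq)
    show "\<bar>fst (snd (heis_mult \<xi> \<eta>)) $ i\<bar> \<le> 2 * a" for i
      using b1(2)[of i] b2(2)[of i] by (simp add: heis_mult_eq)
    show "\<bar>snd (snd (heis_mult \<xi> \<eta>))\<bar> \<le> (2 + 4 * ?N) * a\<^sup>2"
      using b1(3) b2(3) i1 i2 by (simp add: heis_mult_eq algebra_simps power2_eq_square)
  qed
  also have "\<dots> = ?K * a ^ 4" by algebra
  also have "\<dots> \<le> ?K * (quartic \<xi> + quartic \<eta>)"
    by (rule mult_left_mono[OF a4]) simp
  finally show "quartic (heis_mult \<xi> \<eta>) \<le> ?K * (quartic \<xi> + quartic \<eta>)" .
qed

lemma quartic_along_line:
  fixes h :: real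
  shows "quartic (heis_mult \<xi> (h *\<^sub>R \<eta>)) =
    (\<Sum>i\<in>UNIV. ((fst \<xi> $ i + h * fst \<eta> $ i)\<^sup>2 + (fst (snd \<xi>) $ i + h * fst (snd \<eta>) $ i)\<^sup>2)\<^sup>2)
    + (snd (snd \<xi>) + h * (snd (snd \<eta>) + 2 * (fst (snd \<xi>) \<bullet> fst \<eta>) - 2 * (fst \<xi> \<bullet> fst (snd \<eta>))))\<^sup>2"
  by (simp add: quartic_def heis_mult_eq algebra_simps)

text \<open>
  Left translates of one-parameter subgroups are straight lines, along which \<open>quartic\<close> is a
  polynomial in one variable. The powers of a and b in the bounds are those that homogeneity dictates:
  each derivative trades one factor a, the size of the base point, for the size b of the increment.
\<close>

lemma quartic_along_line_derivatives:
  obtains C where "C \<ge> 1" "\<And>(\<xi>::'n::finite heis) \<eta> a b. \<lbrakk>quartic \<xi> \<le> a ^ 4; quartic \<eta> \<le> b ^ 4; 0 \<le> b; b \<le> a\<rbrakk>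
    \<Longrightarrow> \<exists>P' P''. \<forall>h\<in>{-1..1}. 
      ((\<lambda>h. quartic (heis_mult \<xi> (h *\<^sub>R \<eta>))) has_real_derivative P' h) (at h) \<and>
      (P' has_real_derivative P'' h) (at h) \<and> \<bar>P' h\<bar> \<le> C * (a ^ 3 * b) \<and> \<bar>P'' h\<bar> \<le> C * (a\<^sup>2 * b\<^sup>2)"
proof
  let ?N = "real CARD('n)"
  let ?C = "192 * ?N + 2 * (2 + 4 * ?N)\<^sup>2"
  have N: "?N \<ge> 1" by (simp add: Suc_leI)
  show "?C \<ge> 1" using N zero_le_power2[of "2 + 4 * ?N"] by linarith
  fix \<xi> \<eta> :: "'n heis" and a b :: real
  assume xi: "quartic \<xi> \<le> a ^ 4" and eta: "quartic \<eta> \<le> b ^ 4" and b: "0 \<le> b" "b \<le> a"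
  then have a: "0 \<le> a" by simp
  note b1 = quartic_coord_bounds[OF xi a] and b2 = quartic_coord_bounds[OF eta b(1)]
  define \<omega> where "\<omega> = snd (snd \<eta>) + 2 * (fst (snd \<xi>) \<bullet> fst \<eta>) - 2 * (fst \<xi> \<bullet> fst (snd \<eta>))"
  define X where "X h i = fst \<xi> $ i + h * fst \<eta> $ i" for h i
  define Y where "Y h i = fst (snd \<xi>) $ i + h * fst (snd \<eta>) $ i" for h i
  define r where "r h = snd (snd \<xi>) + h * \<omega>" for h
  define q' where "q' h i = 2 * X h i * fst \<eta> $ i + 2 * Y h i * fst (snd \<eta>) $ i" for h i
  define q'' where "q'' i = 2 * (fst \<eta> $ i)\<^sup>2 + 2 * (fst (snd \<eta>) $ i)\<^sup>2" for i
  define P' where "P' h = (\<Sum>i\<in>UNIV. 2 * ((X h i)\<^sup>2 + (Y h i)\<^sup>2) * q' h i) + 2 * r h * \<omega>" for h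
  define P'' where "P'' h = (\<Sum>i\<in>UNIV. 2 * (q' h i)\<^sup>2 + 2 * ((X h i)\<^sup>2 + (Y h i)\<^sup>2) * q'' i) + 2 * \<omega>\<^sup>2" for h
  have eq: "(\<lambda>h. quartic (heis_mult \<xi> (h *\<^sub>R \<eta>))) = (\<lambda>h. (\<Sum>i\<in>UNIV. ((X h i)\<^sup>2 + (Y h i)\<^sup>2)\<^sup>2) + (r h)\<^sup>2)"
    by (simp add: quartic_along_line X_def Y_def r_def \<omega>_def)
  have d1: "((\<lambda>h. quartic (heis_mult \<xi> (h *\<^sub>R \<eta>))) has_real_derivative P' h) (at h)" for h
    unfolding eq P'_def q'_def X_def Y_def r_def
    by (rule derivative_eq_intros refl | simp add: algebra_simps)+
  have d2: "(P' has_real_derivative P'' h) (at h)" for h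
    unfolding P'_def P''_def q'_def q''_def X_def Y_def r_def
    by (rule derivative_eq_intros refl | simp add: algebra_simps power2_eq_square)+
  have ab: "b * b \<le> a * b" "a * b \<le> a * a" using a b by (auto intro: mult_right_mono mult_left_mono)
  have i1: "\<bar>fst (snd \<xi>) \<bullet> fst \<eta>\<bar> \<le> ?N * (a * b)" by (rule inner_coord_bound) (use b1 b2 in auto)
  have i2: "\<bar>fst \<xi> \<bullet> fst (snd \<eta>)\<bar> \<le> ?N * (a * b)" by (rule inner_coord_bound) (use b1 b2 in auto)
  have \<omega>: "\<bar>\<omega>\<bar> \<le> (1 + 4 * ?N) * (a * b)"
    using b2(3) ab i1 i2 unfolding \<omega>_def by (simp add: algebra_simps power2_eq_square)
  have bounds: "\<bar>P' h\<bar> \<le> ?C * (a ^ 3 * b)" "\<bar>P'' h\<bar> \<le> ?C * (a\<^sup>2 * b\<^sup>2)" if h: "h \<in> {-1..1}" for h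
  proof -
    have hz: "\<bar>h * z\<bar> \<le> \<bar>z\<bar>" for z
      using h mult_right_mono[of "\<bar>h\<bar>" 1 "\<bar>z\<bar>"] by (auto simp: abs_mult)
    have X: "\<bar>X h i\<bar> \<le> 2 * a" for i
      using b1(1)[of i] b2(1)[of i] b hz[of "fst \<eta> $ i"] unfolding X_def by linarith
    have Y: "\<bar>Y h i\<bar> \<le> 2 * a" for i
      using b1(2)[of i] b2(2)[of i] b hz[of "fst (snd \<eta>) $ i"] unfolding Y_def by linarith
    have sq: "z\<^sup>2 \<le> c\<^sup>2" if "\<bar>z\<bar> \<le> c" for z c :: real
      using power_mono[OF that, of 2] by simp
    have q: "(X h i)\<^sup>2 + (Y h i)\<^sup>2 \<le> 8 * a\<^sup>2" for i
      using sq[OF X[of i]] sq[OF Y[of i]] by (simp add: power_mult_distrib)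
    have q': "\<bar>q' h i\<bar> \<le> 8 * (a * b)" for i
    proof -
      have "\<bar>X h i * fst \<eta> $ i\<bar> \<le> (2 * a) * b" "\<bar>Y h i * fst (snd \<eta>) $ i\<bar> \<le> (2 * a) * b"
        unfolding abs_mult using X[of i] Y[of i] b2(1,2)[of i] a by (auto intro!: mult_mono)
      then show ?thesis unfolding q'_def by linarith
    qed
    have q'': "q'' i \<le> 4 * b\<^sup>2" "0 \<le> q'' i" for i
      using sq[OF b2(1)[of i]] sq[OF b2(2)[of i]] unfolding q''_def by auto
    have "(1 + 4 * ?N) * (a * b) \<le> (1 + 4 * ?N) * a\<^sup>2"
      using ab(2) by (intro mult_left_mono) (auto simp: power2_eq_square)
    then have "\<bar>r h\<bar> \<le> a\<^sup>2 + (1 + 4 * ?N) * a\<^sup>2"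
      using b1(3) hz[of \<omega>] \<omega> unfolding r_def by linarith
    then have r: "\<bar>r h\<bar> \<le> (2 + 4 * ?N) * a\<^sup>2" by (simp add: algebra_simps)
    have \<omega>': "\<bar>\<omega>\<bar> \<le> (2 + 4 * ?N) * (a * b)"
    proof -
      have "(1 + 4 * ?N) * (a * b) \<le> (2 + 4 * ?N) * (a * b)"
        using mult_nonneg_nonneg[OF a b(1)] by (intro mult_right_mono) auto
      with \<omega> show ?thesis by linarith
    qed
    have "\<bar>P' h\<bar> \<le> (\<Sum>i\<in>UNIV. \<bar>2 * ((X h i)\<^sup>2 + (Y h i)\<^sup>2) * q' h i\<bar>) + \<bar>2 * r h * \<omega>\<bar>"
      unfolding P'_def by (rule order_trans[OF abs_triangle_ineq add_right_mono[OF sum_abs]])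
    also have "\<dots> \<le> (\<Sum>i\<in>(UNIV::'n set). 2 * (8 * a\<^sup>2) * (8 * (a * b))) + 2 * ((2 + 4 * ?N) * a\<^sup>2) * ((2 + 4 * ?N) * (a * b))"
    proof (intro add_mono sum_mono)
      show "\<bar>2 * ((X h i)\<^sup>2 + (Y h i)\<^sup>2) * q' h i\<bar> \<le> 2 * (8 * a\<^sup>2) * (8 * (a * b))" for i
        unfolding abs_mult using q[of i] q'[of i] a by (intro mult_mono) auto
      show "\<bar>2 * r h * \<omega>\<bar> \<le> 2 * ((2 + 4 * ?N) * a\<^sup>2) * ((2 + 4 * ?N) * (a * b))"
        unfolding abs_mult using r \<omega>' a by (intro mult_mono) auto
    qed
    also have "\<dots> = (128 * ?N + 2 * (2 + 4 * ?N)\<^sup>2) * (a ^ 3 * b)"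
      by (simp add: algebra_simps power2_eq_square power3_eq_cube)
    also have "\<dots> \<le> ?C * (a ^ 3 * b)"
      using a b by (intro mult_right_mono) auto
    finally show "\<bar>P' h\<bar> \<le> ?C * (a ^ 3 * b)" .
    have nn: "0 \<le> P'' h" unfolding P''_def using q''(2) by (auto intro!: add_nonneg_nonneg sum_nonneg)
    have "P'' h \<le> (\<Sum>i\<in>(UNIV::'n set). 2 * (8 * (a * b))\<^sup>2 + 2 * (8 * a\<^sup>2) * (4 * b\<^sup>2)) + 2 * ((2 + 4 * ?N) * (a * b))\<^sup>2"
      unfolding P''_def
    proof (intro add_mono sum_mono)
      show "2 * (q' h i)\<^sup>2 \<le> 2 * (8 * (a * b))\<^sup>2" for i using sq[OF q'[of i]] by simp
      show "2 * ((X h i)\<^sup>2 + (Y h i)\<^sup>2) * q'' i \<le> 2 * (8 * a\<^sup>2) * (4 * b\<^sup>2)" for i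
        using q[of i] q''[of i] by (intro mult_mono) auto
      show "2 * \<omega>\<^sup>2 \<le> 2 * ((2 + 4 * ?N) * (a * b))\<^sup>2" using sq[OF \<omega>'] by simp
    qed
    also have "\<dots> = ?C * (a\<^sup>2 * b\<^sup>2)"
      by (simp add: algebra_simps power2_eq_square)
    finally show "\<bar>P'' h\<bar> \<le> ?C * (a\<^sup>2 * b\<^sup>2)" using nn by simp
  qed
  show "\<exists>P' P''. \<forall>h\<in>{-1..1}. 
      ((\<lambda>h. quartic (heis_mult \<xi> (h *\<^sub>R \<eta>))) has_real_derivative P' h) (at h) \<and>
      (P' has_real_derivative P'' h) (at h) \<and> \<bar>P' h\<bar> \<le> ?C * (a ^ 3 * b) \<and> \<bar>P'' h\<bar> \<le> ?C * (a\<^sup>2 * b\<^sup>2)"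
    using d1 d2 bounds by blast
qed

section \<open>Second differences and powers of the positive part\<close>

lemma second_difference_bound:
  fixes G :: "real \<Rightarrow> real"
  assumes 1: "\<And>h. h \<in> {-1..1} \<Longrightarrow> (G has_real_derivative G' h) (at h)"
    and 2: "\<And>h. h \<in> {-1..1} \<Longrightarrow> (G' has_real_derivative G'' h) (at h)"
    and M: "\<And>h. h \<in> {-1..1} \<Longrightarrow> \<bar>G'' h\<bar> \<le> M"
  shows "\<bar>G 1 + G (-1) - 2 * G 0\<bar> \<le> 2 * M"
proof -
  obtain z1 where z1: "0 < z1" "z1 < 1" "G 1 - G 0 = (1 - 0) * G' z1"
    using MVT2[of 0 1 G G'] 1 by auto
  obtain z2 where z2: "-1 < z2" "z2 < 0" "G 0 - G (-1) = (0 - (-1)) * G' z2"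
    using MVT2[of "-1" 0 G G'] 1 by auto
  obtain z3 where z3: "z2 < z3" "z3 < z1" "G' z1 - G' z2 = (z1 - z2) * G'' z3"
    using MVT2[of z2 z1 G' G''] 2 z1 z2 by auto
  have "G 1 + G (-1) - 2 * G 0 = (z1 - z2) * G'' z3"
    using z1(3) z2(3) z3(3)[symmetric] by simp
  then have "\<bar>G 1 + G (-1) - 2 * G 0\<bar> = \<bar>z1 - z2\<bar> * \<bar>G'' z3\<bar>"
    by (simp only: abs_mult)
  also have "\<dots> \<le> 2 * M"
    using z1 z2 z3 M[of z3] by (intro mult_mono) auto
  finally show ?thesis .
qed

text \<open>
  The only point that is not immediate is the origin, where the difference quotient is at most
  \<open>\<bar>h\<bar> ^ n\<close>.
\<close>

lemma DERIV_pos_part_power: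
  assumes "n \<ge> 1"
  shows "((\<lambda>s::real. (max 0 s) ^ Suc n) has_real_derivative real (Suc n) * (max 0 s) ^ n) (at s)"
proof -
  consider "s > 0" | "s < 0" | "s = 0" by linarith
  then show ?thesis
  proof cases
    case 1
    have "((\<lambda>s::real. s ^ Suc n) has_real_derivative real (Suc n) * (max 0 s) ^ n) (at s)"
      using 1 DERIV_pow[of "Suc n" s] by simp
    then show ?thesis
      by (rule has_field_derivative_transform_within_open[where S = "{0<..}"]) (use 1 in auto)
  next
    case 2
    have "((\<lambda>s::real. 0) has_real_derivative real (Suc n) * (max 0 s) ^ n) (at s)"
      using 2 assms by (auto intro!: derivative_eq_intros)
    then show ?thesis
      by (rule has_field_derivative_transform_within_open[where S = "{..<0}"]) (use 2 in auto)
  next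
    case 3
    have "((\<lambda>h. ((max 0 h) ^ Suc n) / h) \<longlongrightarrow> 0) (at (0::real))"
    proof (rule Lim_null_comparison)
      have "norm ((max 0 h) ^ Suc n / h) \<le> \<bar>h\<bar> ^ n" for h :: real
        by (cases "h > 0") (auto simp: max_def)
      then show "\<forall>\<^sub>F h in at 0. norm ((max 0 h) ^ Suc n / h) \<le> \<bar>h\<bar> ^ n" for h :: real
        by auto
      have "((\<lambda>h::real. \<bar>h\<bar> ^ n) \<longlongrightarrow> \<bar>0\<bar> ^ n) (at 0)" by (intro tendsto_intros)
      moreover have "\<bar>0::real\<bar> ^ n = 0" using assms by simp
      ultimately show "((\<lambda>h::real. \<bar>h\<bar> ^ n) \<longlongrightarrow> 0) (at 0)" by (simp only:)
    qed
    then show ?thesis using 3 assms by (simp add: DERIV_def power_0_left)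
  qed
qed

section \<open>Haar measure and radial integrals\<close>

lemma continuous_on_heis_mult [continuous_intros]:
  assumes "continuous_on S f" "continuous_on S g"
  shows "continuous_on S (\<lambda>x. heis_mult (f x) (g x :: 'n::finite heis))"
  unfolding heis_mult_eq using assms by (intro continuous_intros)

lemma continuous_on_quartic [continuous_intros]:
  assumes "continuous_on S f"
  shows "continuous_on S (\<lambda>x. quartic (f x :: 'n::finite heis))"
  unfolding quartic_def using assms by (intro continuous_intros)

lemma continuous_on_heis_norm [continuous_intros]:
  assumes "continuous_on S f"
  shows "continuous_on S (\<lambda>x. heis_norm (f x :: 'n::finite heis))"
  unfolding heis_norm_eq using assms by (intro continuous_intros)

lemma continuous_on_dil [continuous_intros]:
  assumes "continuous_on S f"
  shows "continuous_on S (\<lambda>x. dil r (f x :: 'n::finite heis))"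
  unfolding dil_def using assms by (intro continuous_intros)

lemma borel_measurable_quartic [measurable]: "quartic \<in> borel_measurable borel"
  by (intro borel_measurable_continuous_onI continuous_intros)

lemma borel_measurable_heis_norm [measurable]: "heis_norm \<in> borel_measurable borel"
  by (intro borel_measurable_continuous_onI continuous_intros)

lemma borel_measurable_dil [measurable]: "dil r \<in> borel \<rightarrow>\<^sub>M borel"
  by (intro borel_measurable_continuous_onI continuous_intros)

lemma borel_measurable_heis_mult [measurable]: "heis_mult \<xi> \<in> borel \<rightarrow>\<^sub>M borel"
  by (intro borel_measurable_continuous_onI continuous_intros)

lemma quartic_powr: "quartic \<xi> powr a = heis_norm \<xi> powr (4 * a)"
proof -
  have "heis_norm \<xi> ^ 4 = heis_norm \<xi> powr 4"
    by simp
  then have "quartic \<xi> = heis_norm \<xi> powr 4"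
    by (simp only: heis_norm_pow4)
  then show ?thesis by (simp only: powr_powr)
qed

lemma hom_dim_pos: "hom_dim TYPE('n::finite) \<ge> 4"
  unfolding hom_dim_def using zero_less_card_finite[where 'a='n] by (simp add: Suc_leI)

lemma nn_integral_lborel_pair:
  fixes f :: "'a::euclidean_space \<times> 'b::euclidean_space \<Rightarrow> ennreal"
  assumes "f \<in> borel_measurable borel"
  shows "(\<integral>\<^sup>+z. f z \<partial>lborel) = (\<integral>\<^sup>+x. \<integral>\<^sup>+y. f (x, y) \<partial>lborel \<partial>lborel)"
proof -
  have "f \<in> borel_measurable (lborel \<Otimes>\<^sub>M lborel)"
    using assms by (simp add: lborel_prod)
  from lborel.nn_integral_fst[OF this] show ?thesis
    by (simp add: lborel_prod)
qed

lemma nn_integral_heis: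
  fixes f :: "'n::finite heis \<Rightarrow> ennreal"
  assumes f [measurable]: "f \<in> borel_measurable borel"
  shows "(\<integral>\<^sup>+\<xi>. f \<xi> \<partial>lborel) = (\<integral>\<^sup>+x. \<integral>\<^sup>+y. \<integral>\<^sup>+w. f (x, y, w) \<partial>lborel \<partial>lborel \<partial>lborel)"
proof -
  have "(\<lambda>z. f (x, z)) \<in> borel_measurable borel" for x
    by measurable
  then show ?thesis
    by (simp add: nn_integral_lborel_pair)
qed

lemma nn_integral_lborel_shift:
  fixes f :: "'a::euclidean_space \<Rightarrow> ennreal"
  assumes [measurable]: "f \<in> borel_measurable borel"
  shows "(\<integral>\<^sup>+x. f (t + x) \<partial>lborel) = (\<integral>\<^sup>+x. f x \<partial>lborel)"
proof -
  have "(\<integral>\<^sup>+x. f x \<partial>lborel) = (\<integral>\<^sup>+x. f x \<partial>distr lborel borel ((+) t))"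
    by (simp only: lborel_distr_plus)
  also have "\<dots> = (\<integral>\<^sup>+x. f (t + x) \<partial>lborel)"
    by (rule nn_integral_distr) auto
  finally show ?thesis by simp
qed

lemma nn_integral_lborel_scale:
  fixes f :: "'a::euclidean_space \<Rightarrow> ennreal"
  assumes [measurable]: "f \<in> borel_measurable borel" and c: "c \<noteq> 0"
  shows "ennreal (\<bar>c\<bar> ^ DIM('a)) * (\<integral>\<^sup>+x. f (c *\<^sub>R x) \<partial>lborel) = (\<integral>\<^sup>+x. f x \<partial>lborel)"
proof -
  have "(\<integral>\<^sup>+x. f x \<partial>lborel) = (\<integral>\<^sup>+x. f x \<partial>density (distr lborel borel (\<lambda>x. 0 + c *\<^sub>R x)) (\<lambda>_. \<bar>c\<bar>^DIM('a)))"
    using c by (subst lborel_affine[of c 0]) auto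
  also have "\<dots> = ennreal (\<bar>c\<bar> ^ DIM('a)) * (\<integral>\<^sup>+x. f (c *\<^sub>R x) \<partial>lborel)"
    using c by (simp add: nn_integral_density nn_integral_distr nn_integral_cmult)
  finally show ?thesis by simp
qed

lemma nn_integral_lborel_uminus:
  fixes f :: "'a::euclidean_space \<Rightarrow> ennreal"
  assumes [measurable]: "f \<in> borel_measurable borel"
  shows "(\<integral>\<^sup>+x. f (- x) \<partial>lborel) = (\<integral>\<^sup>+x. f x \<partial>lborel)"
  using nn_integral_lborel_scale[of f "-1"] by simp

text \<open>
  A left translation shifts the first two coordinates and shears the last one, so invariance follows
  from that of Lebesgue measure on each factor.
\<close>

lemma nn_integral_heis_mult_left:
  fixes f :: "'n::finite heis \<Rightarrow> ennreal"
  assumes f [measurable]: "f \<in> borel_measurable borel"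
  shows "(\<integral>\<^sup>+\<eta>. f (heis_mult \<xi> \<eta>) \<partial>lborel) = (\<integral>\<^sup>+\<eta>. f \<eta> \<partial>lborel)"
proof -
  obtain x0 y0 w0 where xi: "\<xi> = (x0, y0, w0)" by (cases \<xi>)
  have "(\<integral>\<^sup>+\<eta>. f (heis_mult \<xi> \<eta>) \<partial>lborel)
    = (\<integral>\<^sup>+x. \<integral>\<^sup>+y. \<integral>\<^sup>+w. f (x0 + x, y0 + y, (w0 + 2 * (y0 \<bullet> x) - 2 * (x0 \<bullet> y)) + w) \<partial>lborel \<partial>lborel \<partial>lborel)"
    by (subst nn_integral_heis) (auto simp: xi algebra_simps)
  also have "\<dots> = (\<integral>\<^sup>+x. \<integral>\<^sup>+y. \<integral>\<^sup>+w. f (x0 + x, y0 + y, w) \<partial>lborel \<partial>lborel \<partial>lborel)"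
    by (subst nn_integral_lborel_shift) auto
  also have "\<dots> = (\<integral>\<^sup>+x. \<integral>\<^sup>+y. \<integral>\<^sup>+w. f (x0 + x, y, w) \<partial>lborel \<partial>lborel \<partial>lborel)"
    by (subst nn_integral_lborel_shift[where f="\<lambda>y. \<integral>\<^sup>+w. f (_ , y, w) \<partial>lborel"]) auto
  also have "\<dots> = (\<integral>\<^sup>+x. \<integral>\<^sup>+y. \<integral>\<^sup>+w. f (x, y, w) \<partial>lborel \<partial>lborel \<partial>lborel)"
    by (subst nn_integral_lborel_shift[where f="\<lambda>x. \<integral>\<^sup>+y. \<integral>\<^sup>+w. f (x , y, w) \<partial>lborel \<partial>lborel"]) auto
  finally show ?thesis by (simp add: nn_integral_heis)
qed

text \<open>
  The Jacobian of a dilation is a power of the dilation factor; its exponent is the homogeneous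
  dimension.
\<close>

lemma nn_integral_dil:
  fixes f :: "'n::finite heis \<Rightarrow> ennreal"
  assumes f [measurable]: "f \<in> borel_measurable borel" and r: "0 < r"
  shows "ennreal (r powr hom_dim TYPE('n)) * (\<integral>\<^sup>+\<eta>. f (dil r \<eta>) \<partial>lborel) = (\<integral>\<^sup>+\<eta>. f \<eta> \<partial>lborel)"
proof -
  let ?N = "CARD('n)"
  have e: "ennreal (r powr hom_dim TYPE('n)) = ennreal (r ^ ?N) * (ennreal (r ^ ?N) * ennreal (r\<^sup>2))"
  proof -
    have "r powr hom_dim TYPE('n) = r powr real (?N + (?N + 2))"
      unfolding hom_dim_def by (simp add: algebra_simps)
    also have "\<dots> = r ^ ?N * (r ^ ?N * r\<^sup>2)"
      using r by (simp only: powr_realpow power_add)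
    finally show ?thesis using r by (simp add: ennreal_mult)
  qed
  have "(\<integral>\<^sup>+\<eta>. f \<eta> \<partial>lborel) = (\<integral>\<^sup>+x. \<integral>\<^sup>+y. \<integral>\<^sup>+w. f (x, y, w) \<partial>lborel \<partial>lborel \<partial>lborel)"
    by (rule nn_integral_heis) fact
  also have "\<dots> = ennreal (r ^ ?N) * (\<integral>\<^sup>+x. \<integral>\<^sup>+y. \<integral>\<^sup>+w. f (r *\<^sub>R x, y, w) \<partial>lborel \<partial>lborel \<partial>lborel)"
    using nn_integral_lborel_scale[of "\<lambda>x. \<integral>\<^sup>+y. \<integral>\<^sup>+w. f (x, y, w) \<partial>lborel \<partial>lborel" r] r by simp
  also have "\<dots> = ennreal (r ^ ?N) * (\<integral>\<^sup>+x. ennreal (r ^ ?N) * \<integral>\<^sup>+y. \<integral>\<^sup>+w. f (r *\<^sub>R x, r *\<^sub>R y, w) \<partial>lborel \<partial>lborel \<partial>lborel)"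
    using nn_integral_lborel_scale[of "\<lambda>y. \<integral>\<^sup>+w. f (_, y, w) \<partial>lborel" r] r by simp
  also have "\<dots> = ennreal (r ^ ?N) * (\<integral>\<^sup>+x. ennreal (r ^ ?N) * \<integral>\<^sup>+y. ennreal (r\<^sup>2) * \<integral>\<^sup>+w. f (r *\<^sub>R x, r *\<^sub>R y, r\<^sup>2 * w) \<partial>lborel \<partial>lborel \<partial>lborel)"
    using nn_integral_lborel_scale[of "\<lambda>w. f (_, _, w)" "r\<^sup>2"] r by simp
  also have "\<dots> = ennreal (r powr hom_dim TYPE('n)) * (\<integral>\<^sup>+x. \<integral>\<^sup>+y. \<integral>\<^sup>+w. f (r *\<^sub>R x, r *\<^sub>R y, r\<^sup>2 * w) \<partial>lborel \<partial>lborel \<partial>lborel)"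
    unfolding e by (simp add: nn_integral_cmult mult.assoc)
  also have "(\<integral>\<^sup>+x. \<integral>\<^sup>+y. \<integral>\<^sup>+w. f (r *\<^sub>R x, r *\<^sub>R y, r\<^sup>2 * w) \<partial>lborel \<partial>lborel \<partial>lborel) = (\<integral>\<^sup>+\<eta>. f (dil r \<eta>) \<partial>lborel)"
    by (subst nn_integral_heis) (measurable, simp add: dil_def)
  finally show ?thesis by simp
qed

lemma bounded_quartic_sublevel: "bounded {\<xi> :: 'n::finite heis. quartic \<xi> \<le> c}"
proof -
  define a where "a = max 1 c"
  have a: "1 \<le> a" "c \<le> a ^ 4"
    unfolding a_def using self_le_power[of "max 1 c" 4] by auto
  have "norm \<xi> \<le> real CARD('n) * a + (real CARD('n) * a + a\<^sup>2)" if "quartic \<xi> \<le> c" for \<xi> :: "'n heis"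
  proof -
    have "quartic \<xi> \<le> a ^ 4" using that a by linarith
    note b = quartic_coord_bounds[OF this]
    have v: "norm v \<le> real CARD('n) * a" if "\<And>i. \<bar>v $ i\<bar> \<le> a" for v :: "real ^ 'n"
    proof -
      have "norm v \<le> (\<Sum>i\<in>UNIV. \<bar>v $ i\<bar>)" by (rule norm_le_l1_cart)
      also have "\<dots> \<le> (\<Sum>i\<in>(UNIV::'n set). a)" by (rule sum_mono) (use that in auto)
      finally show ?thesis by simp
    qed
    obtain x y w where xi: "\<xi> = (x, y, w)" by (cases \<xi>)
    have "norm \<xi> \<le> norm x + (norm y + norm w)"
      unfolding xi using norm_Pair_le[of x "(y, w)"] norm_Pair_le[of y w] by linarith
    moreover have "norm x \<le> real CARD('n) * a" "norm y \<le> real CARD('n) * a" "norm w \<le> a\<^sup>2"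
      using v[of x] v[of y] b a(1) unfolding xi by auto
    ultimately show ?thesis by linarith
  qed
  then show ?thesis unfolding bounded_iff by blast
qed

lemma compact_quartic_sublevel: "compact {\<xi> :: 'n::finite heis. quartic \<xi> \<le> c}"
  unfolding compact_eq_bounded_closed
  by (auto intro!: bounded_quartic_sublevel closed_Collect_le continuous_intros)

lemma heis_ball_measurable [measurable]: "{\<xi> :: 'n::finite heis. heis_norm \<xi> < r} \<in> sets borel"
  by measurable

lemma heis_ball_finite: "emeasure lborel {\<xi> :: 'n::finite heis. heis_norm \<xi> < r} < \<infinity>"
proof (rule emeasure_bounded_finite)
  show "bounded {\<xi> :: 'n::finite heis. heis_norm \<xi> < r}"
  proof (cases "r \<ge> 0")
    case True
    then have "{\<xi> :: 'n::finite heis. heis_norm \<xi> < r} \<subseteq> {\<xi>. quartic \<xi> \<le> r ^ 4}"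
      by (auto simp: heis_norm_less_iff)
    then show ?thesis using bounded_quartic_sublevel bounded_subset by blast
  next
    case False
    then have "{\<xi> :: 'n::finite heis. heis_norm \<xi> < r} = {}"
      using heis_norm_nonneg by (auto simp: not_less intro: order_trans[of r 0])
    then show ?thesis by (simp only: bounded_empty)
  qed
qed

lemma heis_unit_ball_pos: "emeasure lborel {\<xi> :: 'n::finite heis. heis_norm \<xi> < 1} > 0"
proof -
  have "open {\<xi> :: 'n heis. heis_norm \<xi> < 1}"
    by (intro open_Collect_less continuous_intros)
  moreover have "0 \<in> {\<xi> :: 'n heis. heis_norm \<xi> < 1}"
    by (simp add: heis_norm_eq quartic_def)
  ultimately have "\<not> negligible {\<xi> :: 'n heis. heis_norm \<xi> < 1}"
    using open_not_negligible by blast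
  then have "{\<xi> :: 'n heis. heis_norm \<xi> < 1} \<notin> null_sets lborel"
    using negligible_iff_null_sets null_sets_completionI by blast
  then show ?thesis by (auto simp: null_sets_def zero_less_iff_neq_zero)
qed

lemma emeasure_heis_ball:
  assumes "0 < r"
  shows "emeasure lborel {\<xi> :: 'n::finite heis. heis_norm \<xi> < r} =
    ennreal (r powr hom_dim TYPE('n)) * emeasure lborel {\<xi> :: 'n::finite heis. heis_norm \<xi> < 1}"
proof -
  have "(\<integral>\<^sup>+\<xi>. indicator {\<xi> :: 'n::finite heis. heis_norm \<xi> < r} \<xi> \<partial>lborel)
    = ennreal (r powr hom_dim TYPE('n)) * (\<integral>\<^sup>+\<xi>. indicator {\<xi> :: 'n::finite heis. heis_norm \<xi> < r} (dil r \<xi>) \<partial>lborel)"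
    by (rule nn_integral_dil[symmetric]) (use assms in auto)
  also have "(\<lambda>\<xi>. indicator {\<xi> :: 'n::finite heis. heis_norm \<xi> < r} (dil r \<xi>) :: ennreal) = indicator {\<xi>. heis_norm \<xi> < 1}"
    using assms by (auto simp: heis_norm_dil fun_eq_iff indicator_def)
  finally show ?thesis by simp
qed

lemma nn_integral_radial_scale:
  assumes [measurable]: "S \<in> sets borel" and r: "0 < r"
  shows "(\<integral>\<^sup>+\<eta>. ennreal (heis_norm \<eta> powr - \<kappa> * indicator S (heis_norm (\<eta>::'n::finite heis) / r)) \<partial>lborel)
    = ennreal (r powr (hom_dim TYPE('n) - \<kappa>)) * (\<integral>\<^sup>+\<eta>. ennreal (heis_norm \<eta> powr - \<kappa> * indicator S (heis_norm (\<eta>::'n heis))) \<partial>lborel)"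
proof -
  let ?g = "\<lambda>\<eta>::'n heis. ennreal (heis_norm \<eta> powr - \<kappa> * indicator S (heis_norm \<eta>))"
  have "(\<integral>\<^sup>+\<eta>. ennreal (heis_norm \<eta> powr - \<kappa> * indicator S (heis_norm (\<eta>::'n heis) / r)) \<partial>lborel)
    = ennreal (r powr hom_dim TYPE('n)) * (\<integral>\<^sup>+\<eta>. ennreal (heis_norm (dil r \<eta>) powr - \<kappa> * indicator S (heis_norm (dil r (\<eta>::'n heis)) / r)) \<partial>lborel)"
    by (rule nn_integral_dil[symmetric]) (use r in measurable)
  also have "(\<lambda>\<eta>. ennreal (heis_norm (dil r \<eta>) powr - \<kappa> * indicator S (heis_norm (dil r (\<eta>::'n heis)) / r)))
     = (\<lambda>\<eta>. ennreal (r powr - \<kappa>) * ?g \<eta>)"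
    using r by (simp add: heis_norm_dil powr_mult ennreal_mult[symmetric] mult.assoc)
  also have "(\<integral>\<^sup>+\<eta>. ennreal (r powr - \<kappa>) * ?g \<eta> \<partial>lborel) = ennreal (r powr - \<kappa>) * (\<integral>\<^sup>+\<eta>. ?g \<eta> \<partial>lborel)"
    by (rule nn_integral_cmult) measurable
  finally show ?thesis
    by (simp add: mult.assoc[symmetric] ennreal_mult[symmetric] powr_add[symmetric])
qed

lemma nn_integral_shell_finite:
  "(\<integral>\<^sup>+\<eta>. ennreal (heis_norm \<eta> powr - \<kappa> * indicator {1..<2} (heis_norm (\<eta>::'n::finite heis))) \<partial>lborel) < \<infinity>"
proof -
  have "(\<integral>\<^sup>+\<eta>. ennreal (heis_norm \<eta> powr - \<kappa> * indicator {1..<2} (heis_norm (\<eta>::'n heis))) \<partial>lborel)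
    \<le> (\<integral>\<^sup>+\<eta>. ennreal (2 powr \<bar>\<kappa>\<bar>) * indicator {\<eta>. heis_norm (\<eta>::'n heis) < 2} \<eta> \<partial>lborel)"
  proof (rule nn_integral_mono)
    fix \<eta> :: "'n heis"
    have "n powr - \<kappa> \<le> 2 powr \<bar>\<kappa>\<bar>" if "1 \<le> n" "n < 2" for n :: real
    proof -
      have "n powr - \<kappa> \<le> n powr \<bar>\<kappa>\<bar>" using that by (intro powr_mono) auto
      also have "\<dots> \<le> 2 powr \<bar>\<kappa>\<bar>" using that by (intro powr_mono2) auto
      finally show ?thesis .
    qed
    then show "ennreal (heis_norm \<eta> powr - \<kappa> * indicator {1..<2} (heis_norm \<eta>))
       \<le> ennreal (2 powr \<bar>\<kappa>\<bar>) * indicator {\<eta>. heis_norm (\<eta>::'n heis) < 2} \<eta>"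
      by (auto simp: indicator_def intro!: ennreal_leI)
  qed
  also have "\<dots> = ennreal (2 powr \<bar>\<kappa>\<bar>) * emeasure lborel {\<eta>. heis_norm (\<eta>::'n heis) < 2}"
    by (rule nn_integral_cmult_indicator) simp
  also have "\<dots> < \<infinity>" using heis_ball_finite[of 2, where 'n='n] by (simp add: ennreal_mult_less_top)
  finally show ?thesis .
qed

text \<open>
  All dyadic shells are dilates of one shell, on which the integrand is bounded; their contributions
  are therefore dominated by a geometric series.
\<close>

lemma nn_integral_dyadic:
  assumes q: "0 \<le> q" "q < 1"
    and r: "\<And>j. 0 < r j" "\<And>j. r j powr (hom_dim TYPE('n) - \<kappa>) \<le> q ^ j"
    and S [measurable]: "S \<in> sets borel" and cover: "\<And>x. x \<in> S \<Longrightarrow> 0 < x \<Longrightarrow> \<exists>j::nat. r j \<le> x \<and> x < 2 * r j"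
  shows "(\<integral>\<^sup>+\<eta>. ennreal (heis_norm \<eta> powr - \<kappa> * indicator S (heis_norm (\<eta>::'n::finite heis))) \<partial>lborel) < \<infinity>"
proof -
  let ?G = "\<integral>\<^sup>+\<eta>. ennreal (heis_norm \<eta> powr - \<kappa> * indicator {1..<2} (heis_norm (\<eta>::'n heis))) \<partial>lborel"
  let ?f = "\<lambda>j (\<eta>::'n heis). ennreal (heis_norm \<eta> powr - \<kappa> * indicator {1..<2} (heis_norm \<eta> / r j))"
  have "(\<integral>\<^sup>+\<eta>. ennreal (heis_norm \<eta> powr - \<kappa> * indicator S (heis_norm (\<eta>::'n heis))) \<partial>lborel)
    \<le> (\<integral>\<^sup>+\<eta>. (\<Sum>j. ?f j \<eta>) \<partial>lborel)"
  proof (rule nn_integral_mono)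
    fix \<eta> :: "'n heis"
    show "ennreal (heis_norm \<eta> powr - \<kappa> * indicator S (heis_norm \<eta>)) \<le> (\<Sum>j. ?f j \<eta>)"
    proof (cases "heis_norm \<eta> \<in> S \<and> 0 < heis_norm \<eta>")
      case True
      then obtain j where "r j \<le> heis_norm \<eta>" "heis_norm \<eta> < 2 * r j" using cover by blast
      then have "heis_norm \<eta> / r j \<in> {1..<2}"
        using r(1)[of j] by (simp add: pos_le_divide_eq pos_divide_less_eq)
      then have "ennreal (heis_norm \<eta> powr - \<kappa> * indicator S (heis_norm \<eta>)) = ?f j \<eta>"
        using True by (simp only: indicator_simps)
      also have "\<dots> = sum (\<lambda>j. ?f j \<eta>) {j}"
        by (simp only: sum.insert finite.emptyI empty_iff not_False_eq_True sum.empty add_0_right)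
      also have "\<dots> \<le> (\<Sum>j. ?f j \<eta>)" by (rule sum_le_suminf) auto
      finally show ?thesis .
    next
      case False
      then have "heis_norm \<eta> = 0 \<or> heis_norm \<eta> \<notin> S" using heis_norm_nonneg[of \<eta>] by linarith
      then show ?thesis by auto
    qed
  qed
  also have "\<dots> = (\<Sum>j. \<integral>\<^sup>+\<eta>. ?f j \<eta> \<partial>lborel)"
    by (rule nn_integral_suminf) measurable
  also have "\<dots> = (\<Sum>j. ennreal (r j powr (hom_dim TYPE('n) - \<kappa>)) * ?G)"
    by (simp add: nn_integral_radial_scale r)
  also have "\<dots> = (\<Sum>j. ennreal (r j powr (hom_dim TYPE('n) - \<kappa>))) * ?G"
    by (rule ennreal_suminf_multc)
  also have "\<dots> < \<infinity>"
  proof -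
    have "(\<Sum>j. ennreal (r j powr (hom_dim TYPE('n) - \<kappa>))) \<le> (\<Sum>j. ennreal (q ^ j))"
      by (intro suminf_le ennreal_leI r) auto
    also have "\<dots> < \<infinity>"
    proof -
      have "(\<Sum>j. ennreal (q ^ j)) \<noteq> top"
        by (rule ennreal_suminf_neq_top) (use q in \<open>auto intro: summable_geometric\<close>)
      then show ?thesis by (simp only: less_top infinity_ennreal_def)
    qed
    finally show ?thesis
      using nn_integral_shell_finite[of \<kappa>, where 'n='n] by (simp add: ennreal_mult_less_top)
  qed
  finally show ?thesis .
qed

lemma floor_log2:
  assumes "0 < x"
  shows "2 powr of_int \<lfloor>log 2 x\<rfloor> \<le> x" "x < 2 * 2 powr of_int \<lfloor>log 2 x\<rfloor>"
  using assms floor_log_eq_powr_iff[of x 2 "\<lfloor>log 2 x\<rfloor>"] by (auto simp: powr_add)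

lemma nn_integral_near_origin:
  assumes "\<kappa> < hom_dim TYPE('n::finite)"
  shows "(\<integral>\<^sup>+\<eta>. ennreal (heis_norm \<eta> powr - \<kappa> * indicator {..<1} (heis_norm (\<eta>::'n heis))) \<partial>lborel) < \<infinity>"
proof (rule nn_integral_dyadic)
  let ?d = "hom_dim TYPE('n) - \<kappa>"
  show "0 \<le> 2 powr - ?d" "2 powr - ?d < 1" using assms by (auto simp: powr_less_one)
  show "(2 powr - real (Suc j)) powr ?d \<le> (2 powr - ?d) ^ j" for j
  proof -
    have "(2 powr - real (Suc j)) powr ?d = 2 powr (- ?d * real j) * 2 powr - ?d"
      by (simp add: powr_powr powr_add[symmetric] algebra_simps)
    also have "\<dots> \<le> 2 powr (- ?d * real j) * 1"
      by (rule mult_left_mono) (use assms in \<open>auto simp: powr_less_one less_imp_le\<close>)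
    finally show ?thesis by (simp add: powr_realpow[symmetric] powr_powr)
  qed
  fix x :: real assume x: "x \<in> {..<1}" "0 < x"
  define k where "k = \<lfloor>log 2 x\<rfloor>"
  have "log 2 x < 0" using x by simp
  then have "k < 0" unfolding k_def by simp
  then have "2 powr of_int k = 2 powr - real (Suc (nat (- k - 1)))" by simp
  then show "\<exists>j. 2 powr - real (Suc j) \<le> x \<and> x < 2 * 2 powr - real (Suc j)"
    using floor_log2[OF x(2)] unfolding k_def[symmetric] by metis
qed auto

lemma nn_integral_near_infinity:
  assumes "\<kappa> > hom_dim TYPE('n::finite)"
  shows "(\<integral>\<^sup>+\<eta>. ennreal (heis_norm \<eta> powr - \<kappa> * indicator {1..} (heis_norm (\<eta>::'n heis))) \<partial>lborel) < \<infinity>"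
proof (rule nn_integral_dyadic)
  let ?d = "hom_dim TYPE('n) - \<kappa>"
  show "0 \<le> 2 powr ?d" "2 powr ?d < 1" using assms by (auto simp: powr_less_one)
  show "(2 powr real j) powr ?d \<le> (2 powr ?d) ^ j" for j
    by (simp add: powr_realpow[symmetric] powr_powr mult.commute)
  fix x :: real assume x: "x \<in> {1..}" "0 < x"
  define k where "k = \<lfloor>log 2 x\<rfloor>"
  have "log 2 x \<ge> 0" using x by simp
  then have "k \<ge> 0" unfolding k_def by simp
  then have "2 powr of_int k = 2 powr real (nat k)" by simp
  then show "\<exists>j. 2 powr real j \<le> x \<and> x < 2 * 2 powr real j"
    using floor_log2[OF x(2)] unfolding k_def[symmetric] by metis
qed auto

text \<open>
  The finite mass of the weights is what the large increments of the singular integral see.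
\<close>

lemma nn_integral_decaying:
  assumes "hom_dim TYPE('n::finite) < \<kappa>"
  shows "(\<integral>\<^sup>+\<eta>. ennreal ((1 + quartic (\<eta>::'n heis)) powr (- \<kappa> / 4)) \<partial>lborel) < \<infinity>"
proof -
  have k: "\<kappa> > 0" using assms hom_dim_pos[where 'n='n] by linarith
  have "(\<integral>\<^sup>+\<eta>. ennreal ((1 + quartic (\<eta>::'n heis)) powr (- \<kappa> / 4)) \<partial>lborel)
    \<le> (\<integral>\<^sup>+\<eta>. indicator {\<eta>. heis_norm (\<eta>::'n heis) < 1} \<eta> + 
        ennreal (heis_norm \<eta> powr - \<kappa> * indicator {1..} (heis_norm (\<eta>::'n heis))) \<partial>lborel)"
  proof (rule nn_integral_mono)
    fix \<eta> :: "'n heis"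
    show "ennreal ((1 + quartic \<eta>) powr (- \<kappa> / 4)) \<le> indicator {\<eta>. heis_norm (\<eta>::'n heis) < 1} \<eta> + 
        ennreal (heis_norm \<eta> powr - \<kappa> * indicator {1..} (heis_norm (\<eta>::'n heis)))"
    proof (cases "heis_norm \<eta> < 1")
      case True
      have "(1 + quartic \<eta>) powr (- \<kappa> / 4) \<le> 1"
        using powr_mono[of "- \<kappa> / 4" 0 "1 + quartic \<eta>"] k by (simp add: add_nonneg_eq_0_iff)
      then have "ennreal ((1 + quartic \<eta>) powr (- \<kappa> / 4)) \<le> ennreal 1" by (rule ennreal_leI)
      then show ?thesis using True by (simp add: indicator_def)
    next
      case False
      have "(1 + quartic \<eta>) powr (- \<kappa> / 4) \<le> quartic \<eta> powr (- \<kappa> / 4)"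
        using False k by (intro powr_mono2') (auto simp: heis_norm_less_iff not_less)
      also have "\<dots> = heis_norm \<eta> powr - \<kappa>"
        by (simp add: quartic_powr)
      finally show ?thesis using False by (simp add: indicator_def ennreal_leI)
    qed
  qed
  also have "\<dots> = emeasure lborel {\<eta>. heis_norm (\<eta>::'n heis) < 1} + 
     (\<integral>\<^sup>+\<eta>. ennreal (heis_norm \<eta> powr - \<kappa> * indicator {1..} (heis_norm (\<eta>::'n heis))) \<partial>lborel)"
    by (subst nn_integral_add) auto
  also have "\<dots> < \<infinity>"
    using heis_ball_finite[of 1, where 'n='n] nn_integral_near_infinity[OF assms] by simp
  finally show ?thesis .
qed

section \<open>Truncated powers of the gauge\<close>

text \<open>
  For \<open>\<kappa> = 0\<close> this is the weight \<open>(1 + quartic \<xi>) powr (- 3 * b)\<close>. Positive \<open>\<kappa>\<close> truncate its cube root: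
  the support becomes compact, the third power keeps the function of class C2, and as \<open>\<kappa>\<close> decreases to 0
  the functions increase to the weight, with derivative bounds that do not depend on \<open>\<kappa>\<close>.
\<close>

definition bump :: "real \<Rightarrow> real \<Rightarrow> 'n::finite heis \<Rightarrow> real" where
  "bump b \<kappa> \<xi> = (max 0 ((1 + quartic \<xi>) powr - b - \<kappa>)) ^ 3"

definition profile :: "real \<Rightarrow> real \<Rightarrow> real \<Rightarrow> real" where
  "profile b \<kappa> \<tau> = (max 0 (\<tau> powr - b - \<kappa>)) ^ 3"

definition profile' :: "real \<Rightarrow> real \<Rightarrow> real \<Rightarrow> real" where
  "profile' b \<kappa> \<tau> = 3 * (max 0 (\<tau> powr - b - \<kappa>)) ^ 2 * (- b * \<tau> powr (- b - 1))"

definition profile'' :: "real \<Rightarrow> real \<Rightarrow> real \<Rightarrow> real" where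
  "profile'' b \<kappa> \<tau> = 6 * max 0 (\<tau> powr - b - \<kappa>) * (b * \<tau> powr (- b - 1))\<^sup>2
     + 3 * (max 0 (\<tau> powr - b - \<kappa>)) ^ 2 * (b * (b + 1) * \<tau> powr (- b - 2))"

lemma DERIV_profile:
  assumes "0 < \<tau>"
  shows "(profile b \<kappa> has_real_derivative profile' b \<kappa> \<tau>) (at \<tau>)"
proof -
  have "((\<lambda>\<tau>. \<tau> powr - b - \<kappa>) has_real_derivative (- b * \<tau> powr (- b - 1))) (at \<tau>)"
    using assms by (auto intro!: derivative_eq_intros)
  from DERIV_chain2[OF DERIV_pos_part_power[of 2 "\<tau> powr - b - \<kappa>"] this]
  show ?thesis
    unfolding profile_def[abs_def] profile'_def by (simp add: numeral_3_eq_3 eval_nat_numeral)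
qed

lemma DERIV_profile':
  assumes "0 < \<tau>"
  shows "(profile' b \<kappa> has_real_derivative profile'' b \<kappa> \<tau>) (at \<tau>)"
proof -
  have d: "((\<lambda>\<tau>. \<tau> powr - b - \<kappa>) has_real_derivative (- b * \<tau> powr (- b - 1))) (at \<tau>)"
    using assms by (auto intro!: derivative_eq_intros)
  have 1: "((\<lambda>\<tau>. (max 0 (\<tau> powr - b - \<kappa>)) ^ 2) has_real_derivative
      2 * max 0 (\<tau> powr - b - \<kappa>) * (- b * \<tau> powr (- b - 1))) (at \<tau>)"
    using DERIV_chain2[OF DERIV_pos_part_power[of 1 "\<tau> powr - b - \<kappa>"] d]
    by (simp add: numeral_2_eq_2)
  have 2: "((\<lambda>\<tau>. - b * \<tau> powr (- b - 1)) has_real_derivative b * (b + 1) * \<tau> powr (- b - 2)) (at \<tau>)"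
  proof -
    have e: "- b - 1 - 1 = - b - 2" by simp
    have "((\<lambda>\<tau>. \<tau> powr (- b - 1)) has_real_derivative (- b - 1) * \<tau> powr (- b - 2)) (at \<tau>)"
      using has_real_derivative_powr[OF assms, of "- b - 1"] unfolding e .
    from DERIV_cmult[OF this, of "- b"] show ?thesis by (simp add: algebra_simps)
  qed
  have eq: "profile'' b \<kappa> \<tau> = 3 * ((2 * max 0 (\<tau> powr - b - \<kappa>) * (- b * \<tau> powr (- b - 1))) * (- b * \<tau> powr (- b - 1))
     + b * (b + 1) * \<tau> powr (- b - 2) * (max 0 (\<tau> powr - b - \<kappa>)) ^ 2)"
    unfolding profile''_def by (simp add: algebra_simps power2_eq_square)
  show ?thesis
    unfolding profile'_def[abs_def] eq mult.assoc[of 3]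
    by (rule DERIV_cmult) (rule DERIV_mult'[OF 1 2, THEN DERIV_cong], simp add: algebra_simps)
qed

lemma pos_part_powr_le:
  fixes \<tau> :: real
  assumes "0 \<le> \<kappa>"
  shows "max 0 (\<tau> powr - b - \<kappa>) \<le> \<tau> powr - b"
  using assms powr_ge_zero[of \<tau> "- b"] by auto

text \<open>
  In this bound and in the next one the truncation level does not occur on the right: truncating only
  decreases the positive part.
\<close>

lemma profile'_bound:
  assumes "0 < \<tau>" "0 < b" "0 \<le> \<kappa>"
  shows "\<bar>profile' b \<kappa> \<tau>\<bar> \<le> 3 * b * (\<tau> powr (- 3 * b) / \<tau>)"
proof -
  have "\<bar>profile' b \<kappa> \<tau>\<bar> = 3 * (max 0 (\<tau> powr - b - \<kappa>)) ^ 2 * (b * \<tau> powr (- b - 1))"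
    unfolding profile'_def using assms by (simp add: abs_mult)
  also have "\<dots> \<le> 3 * (\<tau> powr - b) ^ 2 * (b * \<tau> powr (- b - 1))"
    using assms by (intro mult_right_mono mult_left_mono power_mono pos_part_powr_le) auto
  also have "\<dots> = 3 * b * (\<tau> powr - b * \<tau> powr - b * \<tau> powr (- b - 1))"
    by (simp add: power2_eq_square)
  also have "\<tau> powr - b * \<tau> powr - b * \<tau> powr (- b - 1) = \<tau> powr (- 3 * b) / \<tau>"
    using assms by (simp add: powr_add[symmetric] powr_mult_base[symmetric] powr_diff field_simps)
  finally show ?thesis .
qed

lemma profile''_bound:
  assumes "0 < \<tau>" "0 < b" "0 \<le> \<kappa>"
  shows "\<bar>profile'' b \<kappa> \<tau>\<bar> \<le> (9 * b\<^sup>2 + 3 * b) * (\<tau> powr (- 3 * b) / \<tau>\<^sup>2)"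
proof -
  have "\<bar>profile'' b \<kappa> \<tau>\<bar> = profile'' b \<kappa> \<tau>"
    unfolding profile''_def using assms by simp
  also have "\<dots> \<le> 6 * \<tau> powr - b * (b * \<tau> powr (- b - 1))\<^sup>2
     + 3 * (\<tau> powr - b) ^ 2 * (b * (b + 1) * \<tau> powr (- b - 2))"
    unfolding profile''_def
    using assms by (intro add_mono mult_right_mono mult_left_mono power_mono pos_part_powr_le) auto
  also have "\<dots> = 6 * b\<^sup>2 * (\<tau> powr - b * \<tau> powr (- b - 1) * \<tau> powr (- b - 1))
     + 3 * b * (b + 1) * (\<tau> powr - b * \<tau> powr - b * \<tau> powr (- b - 2))"
    by (simp add: power2_eq_square algebra_simps)
  also have "\<tau> powr - b * \<tau> powr (- b - 1) * \<tau> powr (- b - 1) = \<tau> powr (- 3 * b - 2)"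
    unfolding powr_add[symmetric] by (rule arg_cong[where f="\<lambda>z. \<tau> powr z"]) simp
  also have "\<tau> powr - b * \<tau> powr - b * \<tau> powr (- b - 2) = \<tau> powr (- 3 * b - 2)"
    unfolding powr_add[symmetric] by (rule arg_cong[where f="\<lambda>z. \<tau> powr z"]) simp
  also have "\<tau> powr (- 3 * b - 2) = \<tau> powr (- 3 * b) / \<tau>\<^sup>2"
    using assms by (simp add: powr_diff)
  finally show ?thesis by (simp add: algebra_simps power2_eq_square)
qed

lemma bump_eq_profile: "bump b \<kappa> \<xi> = profile b \<kappa> (1 + quartic \<xi>)"
  by (simp add: bump_def profile_def)

lemma one_plus_quartic_pos [simp]: "0 < 1 + quartic \<xi>"
  using quartic_nonneg[of \<xi>] by linarith

lemma one_plus_quartic_nonzero [simp]: "1 + quartic \<xi> \<noteq> 0"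
  using quartic_nonneg[of \<xi>] by linarith

lemma bump_nonneg [simp]: "0 \<le> bump b \<kappa> \<xi>"
  by (simp add: bump_def)

lemma bump_zero_powr: "bump b 0 \<xi> = (1 + quartic \<xi>) powr (- 3 * b)"
proof -
  have "(1 + quartic \<xi>) powr (- 3 * b) = ((1 + quartic \<xi>) powr - b) powr 3"
    by (simp add: powr_powr mult.commute)
  then show ?thesis by (simp add: bump_def)
qed

lemma bump_zero_pos: "0 < bump b 0 \<xi>"
  using one_plus_quartic_pos[of \<xi>] by (simp add: bump_zero_powr)

lemma bump_antimono: "\<kappa> \<le> \<kappa>' \<Longrightarrow> bump b \<kappa>' \<xi> \<le> bump b \<kappa> \<xi>"
  unfolding bump_def by (intro power_mono max.mono) auto

lemma bump_le_1: "0 \<le> b \<Longrightarrow> 0 \<le> \<kappa> \<Longrightarrow> bump b \<kappa> \<xi> \<le> 1"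
  using bump_antimono[of 0 \<kappa> b \<xi>] powr_mono[of "- 3 * b" 0 "1 + quartic \<xi>"]
    one_plus_quartic_pos[of \<xi>] quartic_nonneg[of \<xi>]
  unfolding bump_zero_powr powr_zero_eq_one by (auto simp del: quartic_nonneg)

lemma C2_quartic: "C2 (quartic :: 'n::finite heis \<Rightarrow> real)"
proof -
  have sq: "C2 (\<lambda>x. (f x)\<^sup>2)" if "C2 f" for f :: "'n heis \<Rightarrow> real"
    unfolding power2_eq_square by (rule C2_mult[OF that that])
  have "bounded_linear (\<lambda>\<xi> :: 'n heis. fst \<xi> $ i)" for i
    using bounded_linear_compose[OF bounded_linear_vec_nth bounded_linear_fst] .
  moreover have "bounded_linear (\<lambda>\<xi> :: 'n heis. fst (snd \<xi>) $ i)" for i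
    using bounded_linear_compose[OF bounded_linear_vec_nth
        bounded_linear_compose[OF bounded_linear_fst bounded_linear_snd]] .
  moreover have "bounded_linear (\<lambda>\<xi> :: 'n heis. snd (snd \<xi>))"
    using bounded_linear_compose[OF bounded_linear_snd bounded_linear_snd] .
  ultimately show ?thesis
    unfolding quartic_def[abs_def] by (intro C2_add C2_sum sq C2_bounded_linear finite)
qed

lemma C2_bump: "C2 (\<lambda>\<xi> :: 'n::finite heis. bump b \<kappa> (dil r \<xi>))"
proof -
  have "C2 (\<lambda>\<xi> :: 'n heis. 1 + r ^ 4 * quartic \<xi>)"
    by (intro C2_add C2_mult C2_const C2_quartic)
  moreover have pos: "0 < 1 + r ^ 4 * quartic \<xi>" for \<xi> :: "'n heis"
    using one_plus_quartic_pos[of "dil r \<xi>"] by (simp add: quartic_dil)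
  moreover have "continuous_on (range (\<lambda>\<xi> :: 'n heis. 1 + r ^ 4 * quartic \<xi>)) (profile'' b \<kappa>)"
    unfolding profile''_def[abs_def] using pos
    by (intro continuous_intros) (auto simp: less_imp_neq[symmetric])
  ultimately show ?thesis
    unfolding bump_eq_profile quartic_dil
    by (intro C2_compose_real[where h = "profile b \<kappa>" and ?h1.0 = "profile' b \<kappa>" and ?h2.0 = "profile'' b \<kappa>"]
        DERIV_profile DERIV_profile')
qed

lemma borel_measurable_bump [measurable]: "bump b \<kappa> \<in> borel_measurable (borel :: 'n::finite heis measure)"
proof -
  have "continuous_on UNIV (bump b \<kappa> :: 'n heis \<Rightarrow> real)"
    using C1_continuous[OF C2_imp_C1[OF C2_bump[of b \<kappa> 1]]] by simp
  then show ?thesis by (rule borel_measurable_continuous_onI)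
qed

lemma bump_support:
  assumes "0 < b" "0 < \<kappa>" "bump b \<kappa> \<xi> \<noteq> 0"
  shows "quartic \<xi> \<le> \<kappa> powr (- 1 / b)"
proof -
  have "\<kappa> < (1 + quartic \<xi>) powr - b"
    using assms(3) unfolding bump_def by (auto simp: max_def split: if_splits)
  then have "((1 + quartic \<xi>) powr - b) powr (- 1 / b) \<le> \<kappa> powr (- 1 / b)"
    using assms by (intro powr_mono2') auto
  then show ?thesis
    using assms one_plus_quartic_pos[of \<xi>] by (simp add: powr_powr)
qed

lemma bump_compact_support:
  assumes "0 < b" "0 < \<kappa>" "0 < r"
  obtains K :: "'n::finite heis set" where "compact K" "closure {\<xi>. bump b \<kappa> (dil r \<xi>) \<noteq> 0} \<subseteq> K"
proof
  let ?K = "{\<xi> :: 'n heis. quartic \<xi> \<le> \<kappa> powr (- 1 / b) / r ^ 4}"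
  show K: "compact ?K" by (rule compact_quartic_sublevel)
  show "closure {\<xi> :: 'n heis. bump b \<kappa> (dil r \<xi>) \<noteq> 0} \<subseteq> ?K"
  proof (rule closure_minimal[OF _ compact_imp_closed[OF K]])
    show "{\<xi>. bump b \<kappa> (dil r \<xi>) \<noteq> 0} \<subseteq> ?K"
    proof (intro subsetI CollectI)
      fix \<xi> :: "'n heis" assume "\<xi> \<in> {\<xi>. bump b \<kappa> (dil r \<xi>) \<noteq> 0}"
      then have "quartic (dil r \<xi>) \<le> \<kappa> powr (- 1 / b)"
        using bump_support[OF assms(1,2)] by blast
      then show "quartic \<xi> \<le> \<kappa> powr (- 1 / b) / r ^ 4"
        using assms(3) by (simp add: quartic_dil pos_le_divide_eq mult.commute)
    qed
  qed
qed

definition second_diff :: "('n::finite heis \<Rightarrow> real) \<Rightarrow> 'n heis \<Rightarrow> 'n heis \<Rightarrow> real" where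
  "second_diff u \<xi> \<eta> = u (heis_mult \<xi> \<eta>) + u (heis_mult \<xi> (- \<eta>)) - 2 * u \<xi>"

text \<open>
  Along the straight line through \<open>\<xi>\<close> the value of \<open>1 + quartic\<close> stays comparable to its value
  \<open>a ^ 4\<close> at \<open>\<xi>\<close> as long as the increment is a small multiple of a. Each of the two derivatives of the
  composite then costs a factor 1 / a relative to the weight.
\<close>

lemma second_diff_bump_near:
  assumes b: "0 < b"
  obtains C \<epsilon> where "0 < \<epsilon>" "\<epsilon> \<le> 1" "0 \<le> C"
    "\<And>\<kappa> (\<xi> :: 'n::finite heis) \<eta> a. \<lbrakk>0 \<le> \<kappa>; 0 < a; a ^ 4 = 1 + quartic \<xi>; heis_norm \<eta> \<le> \<epsilon> * a\<rbrakk>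
      \<Longrightarrow> \<bar>second_diff (bump b \<kappa>) \<xi> \<eta>\<bar> \<le> C * bump b 0 \<xi> * ((heis_norm \<eta>)\<^sup>2 / a\<^sup>2)"
proof -
  obtain C0 where C0: "C0 \<ge> 1" and poly: "\<And>(\<xi>::'n::finite heis) \<eta> a b. \<lbrakk>quartic \<xi> \<le> a ^ 4; quartic \<eta> \<le> b ^ 4; 0 \<le> b; b \<le> a\<rbrakk>
    \<Longrightarrow> \<exists>P' P''. \<forall>h\<in>{-1..1}. 
      ((\<lambda>h. quartic (heis_mult \<xi> (h *\<^sub>R \<eta>))) has_real_derivative P' h) (at h) \<and>
      (P' has_real_derivative P'' h) (at h) \<and> \<bar>P' h\<bar> \<le> C0 * (a ^ 3 * b) \<and> \<bar>P'' h\<bar> \<le> C0 * (a\<^sup>2 * b\<^sup>2)"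
    using quartic_along_line_derivatives[where 'n='n] by blast
  \<comment> \<open>With this choice the increment of \<open>1 + quartic\<close> is at most half of its value at the base point.\<close>
  define \<epsilon> where "\<epsilon> = 1 / (2 * C0)"
  define C where "C = 2 powr (3 * b) * ((9 * b\<^sup>2 + 3 * b) * 4 * C0\<^sup>2 + 3 * b * 2 * C0)"
  have eps: "0 < \<epsilon>" "\<epsilon> \<le> 1" using C0 by (auto simp: \<epsilon>_def)
  have C: "0 \<le> C" using C0 b by (simp add: C_def)
  have main: "\<bar>second_diff (bump b \<kappa>) \<xi> \<eta>\<bar> \<le> 2 * C * bump b 0 \<xi> * ((heis_norm \<eta>)\<^sup>2 / a\<^sup>2)"
    if \<kappa>: "0 \<le> \<kappa>" and a: "0 < a" "a ^ 4 = 1 + quartic \<xi>" and \<eta>: "heis_norm \<eta> \<le> \<epsilon> * a"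
    for \<kappa> a and \<xi> \<eta> :: "'n heis"
  proof -
    define \<beta> where "\<beta> = heis_norm \<eta>"
    define W where "W = bump b 0 \<xi>"
    have W: "0 < W" "W = (a ^ 4) powr (- 3 * b)"
      unfolding W_def a(2) by (rule bump_zero_pos, rule bump_zero_powr)
    have \<beta>: "0 \<le> \<beta>" "\<beta> \<le> \<epsilon> * a" "quartic \<eta> \<le> \<beta> ^ 4"
      using \<eta> by (auto simp: \<beta>_def heis_norm_pow4)
    have "\<epsilon> * a \<le> 1 * a" using eps a by (intro mult_right_mono) auto
    then have \<beta>a: "\<beta> \<le> a" using \<beta> by simp
    define P where "P h = 1 + quartic (heis_mult \<xi> (h *\<^sub>R \<eta>))" for h
    obtain P' P'' where P: "\<forall>h\<in>{-1..1}. 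
      ((\<lambda>h. quartic (heis_mult \<xi> (h *\<^sub>R \<eta>))) has_real_derivative P' h) (at h) \<and>
      (P' has_real_derivative P'' h) (at h) \<and> \<bar>P' h\<bar> \<le> C0 * (a ^ 3 * \<beta>) \<and> \<bar>P'' h\<bar> \<le> C0 * (a\<^sup>2 * \<beta>\<^sup>2)"
      using poly[of \<xi> a \<eta> \<beta>] a(2) \<beta> \<beta>a by auto
    have dP: "(P has_real_derivative P' h) (at h)" "(P' has_real_derivative P'' h) (at h)"
      "\<bar>P' h\<bar> \<le> C0 * (a ^ 3 * \<beta>)" "\<bar>P'' h\<bar> \<le> C0 * (a\<^sup>2 * \<beta>\<^sup>2)" if "h \<in> {-1..1}" for h
      using P that unfolding P_def[abs_def] by (auto intro!: derivative_eq_intros)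
    have P0: "P 0 = a ^ 4" 
      unfolding P_def a(2) by (simp add: heis_mult_eq quartic_def)
    have Plow: "a ^ 4 / 2 \<le> P h" if h: "h \<in> {-1..1}" for h
    proof -
      have "norm (P h - P 0) \<le> C0 * (a ^ 3 * \<beta>) * norm (h - 0)"
        by (rule field_differentiable_bound[where S="{-1..1}" and f'=P'])
           (use dP h in \<open>auto intro: has_field_derivative_at_within\<close>)
      also have "\<dots> \<le> C0 * (a ^ 3 * \<beta>) * 1"
        using h C0 a \<beta> by (intro mult_left_mono) auto
      also have "\<dots> \<le> C0 * (a ^ 3 * (\<epsilon> * a))"
        using C0 a \<beta> by (auto intro!: mult_left_mono)
      also have "\<dots> = a ^ 4 / 2"
        using C0 by (simp add: \<epsilon>_def field_simps eval_nat_numeral)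
      finally show ?thesis unfolding P0 real_norm_def by linarith
    qed
    have Ppos: "0 < P h" for h unfolding P_def by (rule one_plus_quartic_pos)
    define M where "M = C * W * (\<beta>\<^sup>2 / a\<^sup>2)"
    have "\<bar>profile b \<kappa> (P 1) + profile b \<kappa> (P (-1)) - 2 * profile b \<kappa> (P 0)\<bar> \<le> 2 * M"
    proof (rule second_difference_bound)
      fix h :: real assume h: "h \<in> {-1..1}"
      note dh = dP[OF h]
      show "((\<lambda>h. profile b \<kappa> (P h)) has_real_derivative profile' b \<kappa> (P h) * P' h) (at h)"
        by (rule DERIV_chain2[OF DERIV_profile[OF Ppos] dh(1)])
      have "((\<lambda>h. profile' b \<kappa> (P h) * P' h) has_real_derivative
        profile' b \<kappa> (P h) * P'' h + profile'' b \<kappa> (P h) * P' h * P' h) (at h)"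
        by (rule DERIV_mult'[OF DERIV_chain2[OF DERIV_profile'[OF Ppos] dh(1)] dh(2)])
      then show "((\<lambda>h. profile' b \<kappa> (P h) * P' h) has_real_derivative
        profile'' b \<kappa> (P h) * (P' h)\<^sup>2 + profile' b \<kappa> (P h) * P'' h) (at h)"
        by (simp add: power2_eq_square algebra_simps)
      let ?V = "2 powr (3 * b) * W"
      have "P h powr (- 3 * b) \<le> (a ^ 4 / 2) powr (- 3 * b)"
        using Plow[OF h] a b by (intro powr_mono2') auto
      also have "\<dots> = ?V"
        using a by (simp add: W powr_divide powr_minus_divide)
      finally have V: "P h powr (- 3 * b) \<le> ?V" .
      have p1: "P h powr (- 3 * b) / P h \<le> ?V * (2 / a ^ 4)"
      proof -
        have "1 / P h \<le> 2 / a ^ 4" using Plow[OF h] Ppos[of h] a by (simp add: field_simps)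
        with V have "P h powr (- 3 * b) * (1 / P h) \<le> ?V * (2 / a ^ 4)"
          by (rule mult_mono) (use W Ppos[of h] in auto)
        then show ?thesis by simp
      qed
      have p2: "P h powr (- 3 * b) / (P h)\<^sup>2 \<le> ?V * (4 / a ^ 8)"
      proof -
        have "(a ^ 4 / 2)\<^sup>2 \<le> (P h)\<^sup>2" using Plow[OF h] a by (intro power_mono) auto
        moreover have "(a ^ 4 / 2)\<^sup>2 = a ^ 8 / 4" by (simp add: power_divide power_mult[symmetric])
        ultimately have "1 / (P h)\<^sup>2 \<le> 4 / a ^ 8" using Ppos[of h] a by (simp add: field_simps)
        with V have "P h powr (- 3 * b) * (1 / (P h)\<^sup>2) \<le> ?V * (4 / a ^ 8)"
          by (rule mult_mono) (use W Ppos[of h] in auto)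
        then show ?thesis by simp
      qed
      have "\<bar>profile'' b \<kappa> (P h) * (P' h)\<^sup>2\<bar> \<le> ((9 * b\<^sup>2 + 3 * b) * (?V * (4 / a ^ 8))) * (C0 * (a ^ 3 * \<beta>))\<^sup>2"
      proof -
        have "\<bar>profile'' b \<kappa> (P h)\<bar> \<le> (9 * b\<^sup>2 + 3 * b) * (?V * (4 / a ^ 8))"
          using b by (intro order_trans[OF profile''_bound[OF Ppos b \<kappa>] mult_left_mono[OF p2]]) auto
        moreover have "(P' h)\<^sup>2 \<le> (C0 * (a ^ 3 * \<beta>))\<^sup>2"
          using power_mono[OF dh(3), of 2] by simp
        ultimately show ?thesis unfolding abs_mult by (intro mult_mono) auto
      qed
      moreover have "\<bar>profile' b \<kappa> (P h) * P'' h\<bar> \<le> (3 * b * (?V * (2 / a ^ 4))) * (C0 * (a\<^sup>2 * \<beta>\<^sup>2))"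
      proof -
        have "\<bar>profile' b \<kappa> (P h)\<bar> \<le> 3 * b * (?V * (2 / a ^ 4))"
          using b by (intro order_trans[OF profile'_bound[OF Ppos b \<kappa>] mult_left_mono[OF p1]]) auto
        then show ?thesis unfolding abs_mult using dh(4) by (intro mult_mono) auto
      qed
      moreover have "((9 * b\<^sup>2 + 3 * b) * (?V * (4 / a ^ 8))) * (C0 * (a ^ 3 * \<beta>))\<^sup>2
        + (3 * b * (?V * (2 / a ^ 4))) * (C0 * (a\<^sup>2 * \<beta>\<^sup>2)) = M"
      proof -
        have "(C0 * (a ^ 3 * \<beta>))\<^sup>2 / a ^ 8 = C0\<^sup>2 * (\<beta>\<^sup>2 / a\<^sup>2)" "a\<^sup>2 * \<beta>\<^sup>2 / a ^ 4 = \<beta>\<^sup>2 / a\<^sup>2"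
          using a(1) by (auto simp: field_simps eval_nat_numeral)
        moreover have "((9 * b\<^sup>2 + 3 * b) * (?V * (4 / a ^ 8))) * (C0 * (a ^ 3 * \<beta>))\<^sup>2
          = (9 * b\<^sup>2 + 3 * b) * ?V * 4 * ((C0 * (a ^ 3 * \<beta>))\<^sup>2 / a ^ 8)"
          "(3 * b * (?V * (2 / a ^ 4))) * (C0 * (a\<^sup>2 * \<beta>\<^sup>2)) = 3 * b * ?V * 2 * C0 * (a\<^sup>2 * \<beta>\<^sup>2 / a ^ 4)"
          by simp_all
        ultimately show ?thesis
          unfolding M_def C_def by (simp only:) (simp only: algebra_simps)
      qed
      ultimately show "\<bar>profile'' b \<kappa> (P h) * (P' h)\<^sup>2 + profile' b \<kappa> (P h) * P'' h\<bar> \<le> M"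
        using abs_triangle_ineq[of "profile'' b \<kappa> (P h) * (P' h)\<^sup>2" "profile' b \<kappa> (P h) * P'' h"] by linarith
    qed
    moreover have "P 0 = 1 + quartic \<xi>" using P0 a by simp
    ultimately show ?thesis
      unfolding second_diff_def bump_eq_profile M_def P_def W_def \<beta>_def by simp
  qed
  show ?thesis
    by (rule that[of \<epsilon> "2 * C"]) (use eps C main in auto)
qed

section \<open>The fractional sub-Laplacian of truncated powers\<close>

text \<open>
  The weight reproduces itself under the singular integral. Increments smaller than a multiple of
  \<open>a = (1 + quartic \<xi>) powr (1 / 4)\<close> are handled by the second-order estimate; the kernel compensated by two
  powers of the increment is integrable at the origin. For larger increments the kernel itself is at most
  a constant multiple of \<open>a powr - (12 * b)\<close>, which is the weight at \<open>\<xi>\<close>; this is why the weight must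
  have the decay exponent of the kernel. It multiplies the finite mass of the weight.
\<close>

lemma nn_integral_second_diff_bump:
  assumes b: "hom_dim TYPE('n::finite) < 12 * b" "12 * b < hom_dim TYPE('n) + 2"
  obtains C where "0 \<le> C" "\<And>\<kappa> (\<xi> :: 'n heis). 0 \<le> \<kappa> \<Longrightarrow>
    (\<integral>\<^sup>+\<eta>. ennreal (\<bar>second_diff (bump b \<kappa>) \<xi> \<eta>\<bar> / heis_norm \<eta> powr (12 * b)) \<partial>lborel) \<le> ennreal (C * bump b 0 \<xi>)"
proof -
  let ?Q = "hom_dim TYPE('n)"
  have b0: "0 < b" using b(1) hom_dim_pos[where 'n='n] by linarith
  define g where "g = 12 * b"
  obtain C0 \<epsilon> where eps: "0 < \<epsilon>" "\<epsilon> \<le> 1" and C0: "0 \<le> C0"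
    and near: "\<And>\<kappa> (\<xi> :: 'n::finite heis) \<eta> a. \<lbrakk>0 \<le> \<kappa>; 0 < a; a ^ 4 = 1 + quartic \<xi>; heis_norm \<eta> \<le> \<epsilon> * a\<rbrakk>
      \<Longrightarrow> \<bar>second_diff (bump b \<kappa>) \<xi> \<eta>\<bar> \<le> C0 * bump b 0 \<xi> * ((heis_norm \<eta>)\<^sup>2 / a\<^sup>2)"
    by (rule second_diff_bump_near[OF b0, where 'n='n]) (rule that; blast)
  let ?I1 = "\<integral>\<^sup>+\<eta>. ennreal (heis_norm \<eta> powr - (g - 2) * indicator {..<1} (heis_norm (\<eta>::'n heis))) \<partial>lborel"
  let ?I2 = "\<integral>\<^sup>+\<eta>. ennreal (heis_norm \<eta> powr - g * indicator {1..} (heis_norm (\<eta>::'n heis))) \<partial>lborel"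
  let ?I3 = "\<integral>\<^sup>+\<eta>. ennreal (bump b 0 (\<eta>::'n heis)) \<partial>lborel"
  have I1: "?I1 < \<infinity>" by (rule nn_integral_near_origin) (use b in \<open>simp add: g_def\<close>)
  have I2: "?I2 < \<infinity>" by (rule nn_integral_near_infinity) (use b in \<open>simp add: g_def\<close>)
  have "?I3 = (\<integral>\<^sup>+\<eta>. ennreal ((1 + quartic (\<eta>::'n heis)) powr (- g / 4)) \<partial>lborel)"
    by (simp add: bump_zero_powr g_def)
  also have "\<dots> < \<infinity>" by (rule nn_integral_decaying) (use b in \<open>simp add: g_def\<close>)
  finally have I3: "?I3 < \<infinity>" .
  obtain i1 where i1: "0 \<le> i1" "?I1 = ennreal i1" using I1 by (cases ?I1) auto
  obtain i2 where i2: "0 \<le> i2" "?I2 = ennreal i2" using I2 by (cases ?I2) auto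
  obtain i3 where i3: "0 \<le> i3" "?I3 = ennreal i3" using I3 by (cases ?I3) auto
  define C where "C = C0 * \<epsilon> powr (?Q - g + 2) * i1 + 2 * \<epsilon> powr - g * i3 + 2 * \<epsilon> powr (?Q - g) * i2"
  have C: "0 \<le> C" unfolding C_def using C0 i1 i2 i3 by simp
  have main: "(\<integral>\<^sup>+\<eta>. ennreal (\<bar>second_diff (bump b \<kappa>) \<xi> \<eta>\<bar> / heis_norm \<eta> powr (12 * b)) \<partial>lborel)
      \<le> ennreal (C * bump b 0 \<xi>)" if \<kappa>: "0 \<le> \<kappa>" for \<kappa> and \<xi> :: "'n heis"
  proof -
    define a where "a = (1 + quartic \<xi>) powr (1 / 4)"
    have a: "0 < a" "a ^ 4 = 1 + quartic \<xi>"
      unfolding a_def by (simp, simp add: powr_power)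
    have a1: "1 \<le> a" unfolding a_def by (rule ge_one_powr_ge_zero) auto
    define W where "W = bump b 0 \<xi>"
    have W: "0 < W" unfolding W_def by (rule bump_zero_pos)
    have Wa: "a powr - g = W" 
      unfolding W_def bump_zero_powr a_def by (simp add: powr_powr g_def)
    define r where "r = \<epsilon> * a"
    have r: "0 < r" using eps a by (simp add: r_def)
    let ?B = "bump b 0 :: 'n heis \<Rightarrow> real"
    let ?f1 = "\<lambda>\<eta>::'n heis. ennreal (C0 * W / a\<^sup>2) * ennreal (heis_norm \<eta> powr - (g - 2) * indicator {..<1} (heis_norm \<eta> / r))"
    let ?f2 = "\<lambda>\<eta>::'n heis. ennreal (r powr - g) * (ennreal (?B (heis_mult \<xi> \<eta>)) + ennreal (?B (heis_mult \<xi> (- \<eta>))))"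
    let ?f3 = "\<lambda>\<eta>::'n heis. ennreal (2 * W) * ennreal (heis_norm \<eta> powr - g * indicator {1..} (heis_norm \<eta> / r))"
    have "(\<integral>\<^sup>+\<eta>. ennreal (\<bar>second_diff (bump b \<kappa>) \<xi> \<eta>\<bar> / heis_norm \<eta> powr (12 * b)) \<partial>lborel)
      \<le> (\<integral>\<^sup>+\<eta>. ?f1 \<eta> + (?f2 \<eta> + ?f3 \<eta>) \<partial>lborel)"
    proof (rule nn_integral_mono)
      fix \<eta> :: "'n heis"
      define n where "n = heis_norm \<eta>"
      define D where "D = \<bar>second_diff (bump b \<kappa>) \<xi> \<eta>\<bar>"
      have n: "0 \<le> n" by (simp add: n_def)
      consider "n = 0" | "0 < n" "n < r" | "r \<le> n" using n by linarith
      then have "ennreal (D / n powr g) \<le> ?f1 \<eta> + (?f2 \<eta> + ?f3 \<eta>)"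
      proof cases
        case 1
        then show ?thesis by simp
      next
        case 2
        have "D / n powr g \<le> (C0 * W * (n\<^sup>2 / a\<^sup>2)) / n powr g"
          unfolding D_def W_def n_def using 2 a
          by (intro divide_right_mono near \<kappa>) (auto simp: n_def r_def)
        also have "\<dots> = (C0 * W / a\<^sup>2) * n powr - (g - 2)"
          using 2 by (simp add: powr_diff powr_minus field_simps)
        also have "n powr - (g - 2) = n powr - (g - 2) * indicator {..<1} (n / r)"
          using 2 r by simp
        finally have "ennreal (D / n powr g) \<le> ennreal (C0 * W / a\<^sup>2 * (n powr - (g - 2) * indicator {..<1} (n / r)))"
          by (rule ennreal_leI)
        also have "\<dots> = ?f1 \<eta>"
          unfolding n_def using C0 W by (intro ennreal_mult) auto
        finally show ?thesis by (rule order_trans) simp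
      next
        case 3
        define s where "s = ?B (heis_mult \<xi> \<eta>) + ?B (heis_mult \<xi> (- \<eta>))"
        have s: "0 \<le> s" unfolding s_def by (intro add_nonneg_nonneg bump_nonneg)
        have "D \<le> s + 2 * W"
          unfolding D_def second_diff_def s_def W_def
          using bump_antimono[OF \<kappa>, of b \<xi>] bump_antimono[OF \<kappa>, of b "heis_mult \<xi> \<eta>"]
            bump_antimono[OF \<kappa>, of b "heis_mult \<xi> (- \<eta>)"] bump_nonneg[of b \<kappa> \<xi>]
            bump_nonneg[of b \<kappa> "heis_mult \<xi> \<eta>"] bump_nonneg[of b \<kappa> "heis_mult \<xi> (- \<eta>)"]
          by linarith
        then have "D / n powr g \<le> (s + 2 * W) * n powr - g"
          by (simp add: powr_minus_divide divide_right_mono)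
        also have "\<dots> = s * n powr - g + 2 * W * n powr - g" by (simp add: algebra_simps)
        also have "s * n powr - g \<le> s * r powr - g"
          using 3 r b0 s by (intro mult_left_mono powr_mono2') (auto simp: g_def)
        finally have "D / n powr g \<le> r powr - g * s + 2 * W * (n powr - g * indicator {1..} (n / r))"
          using 3 r by (simp add: mult.commute)
        then have "ennreal (D / n powr g) \<le> ennreal (r powr - g * s + 2 * W * (n powr - g * indicator {1..} (n / r)))"
          by (rule ennreal_leI)
        also have "\<dots> = ennreal (r powr - g * s) + ennreal (2 * W * (n powr - g * indicator {1..} (n / r)))"
          using s W by (intro ennreal_plus) auto
        also have "ennreal (r powr - g * s) = ?f2 \<eta>"
          unfolding s_def by (simp add: ennreal_mult ennreal_plus)
        also have "ennreal (2 * W * (n powr - g * indicator {1..} (n / r))) = ?f3 \<eta>"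
          unfolding n_def using W by (intro ennreal_mult) auto
        finally show ?thesis by (rule order_trans) simp
      qed
      then show "ennreal (\<bar>second_diff (bump b \<kappa>) \<xi> \<eta>\<bar> / heis_norm \<eta> powr (12 * b)) \<le> ?f1 \<eta> + (?f2 \<eta> + ?f3 \<eta>)"
        unfolding D_def n_def g_def .
    qed
    also have "\<dots> = (\<integral>\<^sup>+\<eta>. ?f1 \<eta> \<partial>lborel) + ((\<integral>\<^sup>+\<eta>. ?f2 \<eta> \<partial>lborel) + (\<integral>\<^sup>+\<eta>. ?f3 \<eta> \<partial>lborel))"
      by (simp add: nn_integral_add)
    also have "(\<integral>\<^sup>+\<eta>. ?f1 \<eta> \<partial>lborel) = ennreal (C0 * W / a\<^sup>2 * (r powr (?Q - (g - 2)) * i1))"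
    proof -
      have "(\<integral>\<^sup>+\<eta>. ennreal (heis_norm \<eta> powr - (g - 2) * indicator {..<1} (heis_norm (\<eta>::'n heis) / r)) \<partial>lborel)
        = ennreal (r powr (?Q - (g - 2)) * i1)"
        using i1(1) by (subst nn_integral_radial_scale[OF _ r]) (simp, simp only: i1(2) ennreal_mult powr_ge_zero)
      then show ?thesis
        using C0 W i1(1) by (subst nn_integral_cmult) (measurable, simp only:, subst ennreal_mult[symmetric], auto)
    qed
    also have "(\<integral>\<^sup>+\<eta>. ?f2 \<eta> \<partial>lborel) = ennreal (r powr - g * (i3 + i3))"
    proof -
      have "(\<integral>\<^sup>+\<eta>. ?f2 \<eta> \<partial>lborel) = ennreal (r powr - g) *
        ((\<integral>\<^sup>+\<eta>. ennreal (?B (heis_mult \<xi> \<eta>)) \<partial>lborel) + (\<integral>\<^sup>+\<eta>. ennreal (?B (heis_mult \<xi> (- \<eta>))) \<partial>lborel))"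
        by (subst nn_integral_cmult) (auto simp: nn_integral_add)
      also have "(\<integral>\<^sup>+\<eta>. ennreal (?B (heis_mult \<xi> (- \<eta>))) \<partial>lborel) = (\<integral>\<^sup>+\<eta>. ennreal (?B (heis_mult \<xi> \<eta>)) \<partial>lborel)"
        by (rule nn_integral_lborel_uminus) measurable
      also have "(\<integral>\<^sup>+\<eta>. ennreal (?B (heis_mult \<xi> \<eta>)) \<partial>lborel) = ennreal i3"
        unfolding i3(2)[symmetric] by (rule nn_integral_heis_mult_left) measurable
      also have "ennreal (r powr - g) * (ennreal i3 + ennreal i3) = ennreal (r powr - g * (i3 + i3))"
        using i3(1) by (simp only: ennreal_mult ennreal_plus powr_ge_zero add_nonneg_nonneg)
      finally show ?thesis .
    qed
    also have "(\<integral>\<^sup>+\<eta>. ?f3 \<eta> \<partial>lborel) = ennreal (2 * W * (r powr (?Q - g) * i2))"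
    proof -
      have "(\<integral>\<^sup>+\<eta>. ennreal (heis_norm \<eta> powr - g * indicator {1..} (heis_norm (\<eta>::'n heis) / r)) \<partial>lborel)
        = ennreal (r powr (?Q - g) * i2)"
        using i2(1) by (subst nn_integral_radial_scale[OF _ r]) (simp, simp only: i2(2) ennreal_mult powr_ge_zero)
      then show ?thesis
        using W i2(1) by (subst nn_integral_cmult) (measurable, simp only:, subst ennreal_mult[symmetric], auto)
    qed
    also have "ennreal (C0 * W / a\<^sup>2 * (r powr (?Q - (g - 2)) * i1)) + (ennreal (r powr - g * (i3 + i3)) + ennreal (2 * W * (r powr (?Q - g) * i2)))
      = ennreal (C0 * W / a\<^sup>2 * (r powr (?Q - (g - 2)) * i1) + (r powr - g * (i3 + i3) + 2 * W * (r powr (?Q - g) * i2)))"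
      using C0 W i1 i2 i3 by (simp add: ennreal_plus)
    also have "\<dots> \<le> ennreal (C * bump b 0 \<xi>)"
    proof (rule ennreal_leI)
      have aQ: "a powr (?Q - g) \<le> 1"
        using powr_mono[of "?Q - g" 0 a] a1 b(1) by (simp add: g_def)
      have e1: "r powr (?Q - (g - 2)) / a\<^sup>2 = \<epsilon> powr (?Q - g + 2) * a powr (?Q - g)"
      proof -
        have "r powr (?Q - (g - 2)) = \<epsilon> powr (?Q - g + 2) * a powr (?Q - g + 2)"
          unfolding r_def using eps a by (simp add: powr_mult algebra_simps)
        also have "a powr (?Q - g + 2) = a powr (?Q - g) * a\<^sup>2"
          using a by (simp add: powr_add)
        finally show ?thesis using a by simp
      qed
      have e2: "r powr - g = \<epsilon> powr - g * W"
        unfolding r_def Wa[symmetric] using eps a by (simp add: powr_mult)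
      have e3: "r powr (?Q - g) = \<epsilon> powr (?Q - g) * a powr (?Q - g)"
        unfolding r_def using eps a by (simp add: powr_mult)
      have "C0 * W / a\<^sup>2 * (r powr (?Q - (g - 2)) * i1) = C0 * W * i1 * (r powr (?Q - (g - 2)) / a\<^sup>2)"
        by simp
      also have "\<dots> = C0 * W * i1 * \<epsilon> powr (?Q - g + 2) * a powr (?Q - g)"
        unfolding e1 by simp
      also have "\<dots> \<le> C0 * W * i1 * \<epsilon> powr (?Q - g + 2) * 1"
        using C0 W i1 aQ by (intro mult_left_mono) auto
      finally have 1: "C0 * W / a\<^sup>2 * (r powr (?Q - (g - 2)) * i1) \<le> C0 * W * i1 * \<epsilon> powr (?Q - g + 2)"
        by simp
      have "2 * W * (r powr (?Q - g) * i2) = 2 * W * i2 * \<epsilon> powr (?Q - g) * a powr (?Q - g)"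
        unfolding e3 by simp
      also have "\<dots> \<le> 2 * W * i2 * \<epsilon> powr (?Q - g) * 1"
        using W i2 aQ by (intro mult_left_mono) auto
      finally have 3: "2 * W * (r powr (?Q - g) * i2) \<le> 2 * W * i2 * \<epsilon> powr (?Q - g)"
        by simp
      show "C0 * W / a\<^sup>2 * (r powr (?Q - (g - 2)) * i1) + (r powr - g * (i3 + i3) + 2 * W * (r powr (?Q - g) * i2)) \<le> C * bump b 0 \<xi>"
        using 1 3 unfolding e2 C_def W_def[symmetric] by (simp add: algebra_simps)
    qed
    finally show ?thesis .
  qed
  show ?thesis by (rule that[OF C main])
qed

lemma borel_measurable_second_diff:
  assumes [measurable]: "u \<in> borel_measurable borel"
  shows "second_diff u \<xi> \<in> borel_measurable (borel :: 'n::finite heis measure)"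
proof -
  have [measurable]: "uminus \<in> borel \<rightarrow>\<^sub>M (borel :: 'n heis measure)"
    by (intro borel_measurable_continuous_onI continuous_intros)
  show ?thesis unfolding second_diff_def[abs_def] by measurable
qed

lemma abs_frac_sub_laplacian_le:
  fixes u :: "'n::finite heis \<Rightarrow> real"
  assumes u: "u \<in> borel_measurable borel" and c: "0 \<le> c" and B: "0 \<le> B"
    and le: "(\<integral>\<^sup>+\<eta>. ennreal (\<bar>second_diff u \<xi> \<eta>\<bar> / heis_norm \<eta> powr (hom_dim TYPE('n) + 2 * s)) \<partial>lborel) \<le> ennreal B"
  shows "\<bar>frac_sub_laplacian c s u \<xi>\<bar> \<le> c / 2 * B"
proof -
  note [measurable] = borel_measurable_second_diff[OF u]
  let ?h = "\<lambda>\<eta>. second_diff u \<xi> \<eta> / heis_norm \<eta> powr (hom_dim TYPE('n) + 2 * s)"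
  have eq: "frac_sub_laplacian c s u \<xi> = - (1 / 2) * c * (\<integral>\<eta>. ?h \<eta> \<partial>lborel)"
    unfolding frac_sub_laplacian_def second_diff_def[symmetric]
    by (subst integral_completion) measurable
  have "\<bar>\<integral>\<eta>. ?h \<eta> \<partial>lborel\<bar> \<le> B"
  proof (cases "integrable lborel ?h")
    case True
    have "ennreal (norm (\<integral>\<eta>. ?h \<eta> \<partial>lborel)) \<le> (\<integral>\<^sup>+\<eta>. norm (?h \<eta>) \<partial>lborel)"
      by (rule integral_norm_bound_ennreal[OF True])
    also have "\<dots> \<le> ennreal B" using le by simp
    finally show ?thesis using B by simp
  qed (use B in \<open>simp add: not_integrable_integral_eq\<close>)
  then have "c * \<bar>\<integral>\<eta>. ?h \<eta> \<partial>lborel\<bar> \<le> c * B" by (rule mult_left_mono) (rule c)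
  then show ?thesis unfolding eq using c by (simp add: abs_mult)
qed

lemma second_diff_dil: "second_diff (\<lambda>\<xi>. u (dil r \<xi>)) \<xi> \<eta> = second_diff u (dil r \<xi>) (dil r \<eta>)"
  by (simp add: second_diff_def dil_heis_mult dil_uminus)

text \<open>
  The case \<open>R = 1\<close> transported by dilations. The gain \<open>R powr (- 2 * s)\<close> is the homogeneity of the
  operator. The constant serves all truncation levels at once, so that the difference between a truncated
  and the full weight can be sent to 0 afterwards.
\<close>

lemma frac_sub_laplacian_bump_upper:
  assumes s: "0 < s" "s < 1" and c: "0 \<le> c" and b: "12 * b = hom_dim TYPE('n::finite) + 2 * s"
  obtains C where "0 \<le> C" "\<And>\<kappa> R (\<xi> :: 'n heis). 0 \<le> \<kappa> \<Longrightarrow> 0 < R \<Longrightarrow>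
    \<bar>frac_sub_laplacian c s (\<lambda>\<xi>. bump b \<kappa> (dil (1 / R) \<xi>)) \<xi>\<bar> \<le> C * R powr (- 2 * s) * bump b 0 (dil (1 / R) \<xi>)"
proof -
  let ?Q = "hom_dim TYPE('n)"
  have b1: "?Q < 12 * b" "12 * b < ?Q + 2" using b s by auto
  obtain C where C: "0 \<le> C" and le: "\<And>\<kappa> (\<xi> :: 'n heis). 0 \<le> \<kappa> \<Longrightarrow>
    (\<integral>\<^sup>+\<eta>. ennreal (\<bar>second_diff (bump b \<kappa>) \<xi> \<eta>\<bar> / heis_norm \<eta> powr (12 * b)) \<partial>lborel) \<le> ennreal (C * bump b 0 \<xi>)"
    by (rule nn_integral_second_diff_bump[OF b1]) (rule that; blast)
  have main: "\<bar>frac_sub_laplacian c s (\<lambda>\<xi>. bump b \<kappa> (dil (1 / R) \<xi>)) \<xi>\<bar> \<le> c / 2 * (R powr (- 2 * s) * (C * bump b 0 (dil (1 / R) \<xi>)))"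
    if \<kappa>: "0 \<le> \<kappa>" and R: "0 < R" for \<kappa> R and \<xi> :: "'n heis"
  proof (rule abs_frac_sub_laplacian_le)
    show "(\<lambda>\<xi>::'n heis. bump b \<kappa> (dil (1 / R) \<xi>)) \<in> borel_measurable borel" by measurable
    show "0 \<le> R powr (- 2 * s) * (C * bump b 0 (dil (1 / R) \<xi>))"
      using C by simp
    note [measurable] = borel_measurable_second_diff[OF borel_measurable_bump]
    let ?h = "\<lambda>\<eta>. ennreal (\<bar>second_diff (\<lambda>\<xi>. bump b \<kappa> (dil (1 / R) \<xi>)) \<xi> \<eta>\<bar> / heis_norm \<eta> powr (?Q + 2 * s))"
    let ?k = "\<lambda>\<eta>. ennreal (\<bar>second_diff (bump b \<kappa>) (dil (1 / R) \<xi>) \<eta>\<bar> / heis_norm \<eta> powr (12 * b))"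
    have "(\<integral>\<^sup>+\<eta>. ?h \<eta> \<partial>lborel) = ennreal (R powr ?Q) * (\<integral>\<^sup>+\<eta>. ?h (dil R \<eta>) \<partial>lborel)"
      by (rule nn_integral_dil[symmetric]) (use R in \<open>auto simp: second_diff_dil\<close>)
    also have "(\<lambda>\<eta>. ?h (dil R \<eta>)) = (\<lambda>\<eta>. ennreal (R powr - (12 * b)) * ?k \<eta>)"
      using R unfolding powr_minus_divide b
      by (simp add: second_diff_dil heis_norm_dil powr_mult ennreal_mult[symmetric] field_simps)
    also have "(\<integral>\<^sup>+\<eta>. ennreal (R powr - (12 * b)) * ?k \<eta> \<partial>lborel) = ennreal (R powr - (12 * b)) * (\<integral>\<^sup>+\<eta>. ?k \<eta> \<partial>lborel)"
      by (rule nn_integral_cmult) measurable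
    also have "ennreal (R powr ?Q) * (ennreal (R powr - (12 * b)) * (\<integral>\<^sup>+\<eta>. ?k \<eta> \<partial>lborel)) = ennreal (R powr (- 2 * s)) * (\<integral>\<^sup>+\<eta>. ?k \<eta> \<partial>lborel)"
      unfolding b by (simp add: mult.assoc[symmetric] ennreal_mult[symmetric] powr_add[symmetric])
    also have "\<dots> \<le> ennreal (R powr (- 2 * s)) * ennreal (C * bump b 0 (dil (1 / R) \<xi>))"
      by (intro mult_left_mono le \<kappa>) auto
    also have "\<dots> = ennreal (R powr (- 2 * s) * (C * bump b 0 (dil (1 / R) \<xi>)))"
      using C by (intro ennreal_mult[symmetric]) auto
    finally show "(\<integral>\<^sup>+\<eta>. ?h \<eta> \<partial>lborel) \<le> \<dots>" .
  qed fact
  show ?thesis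
    by (rule that[of "c / 2 * C"]) (use c C main in \<open>auto simp: mult_ac\<close>)
qed

lemma quartic_eq_0_imp: "quartic \<xi> = 0 \<Longrightarrow> \<xi> = 0"
  using quartic_coord_bounds[of \<xi> 0] by (auto simp: prod_eq_iff vec_eq_iff)

lemma heis_mult_0_right [simp]: "heis_mult \<xi> 0 = \<xi>"
  by (simp add: heis_mult_eq)

text \<open>
  Where a nonnegative function vanishes, its second difference is nonnegative and nothing cancels. The
  integral is then at least the mass of the function times the smallest value of the kernel on the
  increments that lead into the support, which by the quasi-triangle inequality is comparable to the weight.
\<close>

lemma frac_sub_laplacian_bump_lower:
  assumes s: "0 < s" "s < 1" and c: "0 < c" and b: "12 * b = hom_dim TYPE('n::finite) + 2 * s"
    and \<kappa>: "0 < \<kappa>" "\<kappa> < 1"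
  obtains C where "0 < C" "\<And>\<xi> :: 'n heis. bump b \<kappa> \<xi> = 0 \<Longrightarrow>
    C * bump b 0 \<xi> \<le> \<bar>frac_sub_laplacian c s (bump b \<kappa>) \<xi>\<bar>"
proof -
  let ?Q = "hom_dim TYPE('n)"
  let ?\<Phi> = "bump b \<kappa> :: 'n heis \<Rightarrow> real"
  have b0: "0 < b" using b s hom_dim_pos[where 'n='n] by linarith
  have b1: "?Q < 12 * b" "12 * b < ?Q + 2" using b s by auto
  obtain C1 where C1: "0 \<le> C1" and le1: "\<And>\<kappa> (\<xi> :: 'n heis). 0 \<le> \<kappa> \<Longrightarrow>
    (\<integral>\<^sup>+\<eta>. ennreal (\<bar>second_diff (bump b \<kappa>) \<xi> \<eta>\<bar> / heis_norm \<eta> powr (12 * b)) \<partial>lborel) \<le> ennreal (C1 * bump b 0 \<xi>)"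
    by (rule nn_integral_second_diff_bump[OF b1]) (rule that; blast)
  note le = le1[OF less_imp_le[OF \<kappa>(1)]]
  obtain K where K: "K \<ge> 1" "\<And>\<xi> \<eta> :: 'n heis. quartic (heis_mult \<xi> \<eta>) \<le> K * (quartic \<xi> + quartic \<eta>)"
    by (rule quartic_quasi_triangle[where 'n='n]) (rule that; blast)
  define M where "M = max 1 (\<kappa> powr (- 1 / b))"
  define D where "D = (K * M) powr (- 3 * b)"
  have M: "M \<ge> 1" by (simp add: M_def)
  have D: "0 < D" using K M by (simp add: D_def)
  let ?I = "\<integral>\<^sup>+\<eta>. ennreal (?\<Phi> \<eta>) \<partial>lborel"
  have "?I \<le> (\<integral>\<^sup>+\<eta>. ennreal ((1 + quartic (\<eta>::'n heis)) powr (- (12 * b) / 4)) \<partial>lborel)"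
    using bump_antimono[of 0 \<kappa> b] \<kappa> by (intro nn_integral_mono ennreal_leI) (auto simp: bump_zero_powr)
  also have "\<dots> < \<infinity>" by (rule nn_integral_decaying) (use b s in simp)
  finally obtain i where i: "0 \<le> i" "?I = ennreal i" by (cases ?I) auto
  have "?I \<noteq> 0"
  proof
    assume "?I = 0"
    then have "AE \<eta> in lborel. ennreal (?\<Phi> \<eta>) = 0"
      by (subst (asm) nn_integral_0_iff_AE) auto
    then have "AE \<eta> in lborel. \<eta> \<notin> {\<eta>. 0 < ?\<Phi> \<eta>}" by eventually_elim (auto simp: ennreal_eq_0_iff)
    then have "AE \<eta> in lebesgue. \<eta> \<notin> {\<eta>. 0 < ?\<Phi> \<eta>}" by (rule AE_completion)
    then have "negligible {\<eta>. 0 < ?\<Phi> \<eta>}"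
      using AE_iff_null_sets[of "{\<eta>. 0 < ?\<Phi> \<eta>}" lebesgue] by (simp add: negligible_iff_null_sets)
    moreover have "continuous_on UNIV ?\<Phi>"
      using C1_continuous[OF C2_imp_C1[OF C2_bump[of b \<kappa> 1]]] by simp
    then have "open {\<eta>. 0 < ?\<Phi> \<eta>}"
      by (intro open_Collect_less continuous_intros)
    moreover have "0 \<in> {\<eta>. 0 < ?\<Phi> \<eta>}" using \<kappa> by (simp add: bump_def quartic_def)
    ultimately show False using open_not_negligible by blast
  qed
  then have i0: "0 < i" using i by (auto simp: less_le)
  have main: "c / 2 * (D * bump b 0 \<xi> * i) \<le> \<bar>frac_sub_laplacian c s ?\<Phi> \<xi>\<bar>" if z: "?\<Phi> \<xi> = 0" for \<xi> :: "'n heis"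
  proof -
    note [measurable] = borel_measurable_second_diff[OF borel_measurable_bump]
    let ?W = "bump b 0 \<xi>"
    let ?h = "\<lambda>\<eta>. second_diff ?\<Phi> \<xi> \<eta> / heis_norm \<eta> powr (12 * b)"
    have sd: "second_diff ?\<Phi> \<xi> \<eta> = ?\<Phi> (heis_mult \<xi> \<eta>) + ?\<Phi> (heis_mult \<xi> (- \<eta>))" for \<eta>
      using z by (simp add: second_diff_def)
    have h0: "0 \<le> ?h \<eta>" for \<eta> unfolding sd by (simp add: bump_nonneg)
    have eq: "frac_sub_laplacian c s ?\<Phi> \<xi> = - (1 / 2) * c * (\<integral>\<eta>. ?h \<eta> \<partial>lborel)"
      unfolding frac_sub_laplacian_def second_diff_def[symmetric] b
      by (subst integral_completion) measurable
    have "(\<integral>\<^sup>+\<eta>. ennreal (?h \<eta>) \<partial>lborel) = (\<integral>\<^sup>+\<eta>. ennreal (\<bar>second_diff ?\<Phi> \<xi> \<eta>\<bar> / heis_norm \<eta> powr (12 * b)) \<partial>lborel)"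
      by (intro nn_integral_cong) (simp add: sd bump_nonneg)
    also have "\<dots> < \<infinity>" using le[of \<xi>] by (rule order_le_less_trans) simp
    finally have int: "integrable lborel ?h"
      using h0 by (intro integrableI_nonneg) auto
    have pt: "D * ?W * ?\<Phi> (heis_mult \<xi> \<eta>) \<le> ?h \<eta>" for \<eta>
    proof (cases "?\<Phi> (heis_mult \<xi> \<eta>) = 0")
      case True then show ?thesis using h0[of \<eta>] by simp
    next
      case False
      then have "\<eta> \<noteq> 0" using z by auto
      then have q0: "0 < quartic \<eta>" using quartic_eq_0_imp[of \<eta>] quartic_nonneg[of \<eta>] by (auto simp: less_le)
      have "quartic (heis_mult \<xi> \<eta>) \<le> M"
        using bump_support[OF b0 \<kappa>(1) False] by (simp add: M_def)
      moreover have "quartic \<eta> \<le> K * (quartic \<xi> + quartic (heis_mult \<xi> \<eta>))"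
        using K(2)[of "- \<xi>" "heis_mult \<xi> \<eta>"] by (simp add: heis_mult_uminus_cancel)
      moreover have "quartic \<xi> \<le> M * quartic \<xi>" using mult_right_mono[OF M, of "quartic \<xi>"] by simp
      ultimately have "quartic \<eta> \<le> K * (M * (1 + quartic \<xi>))"
        using K(1) mult_left_mono[of "quartic \<xi> + quartic (heis_mult \<xi> \<eta>)" "M * (1 + quartic \<xi>)" K]
        by (simp add: distrib_left)
      then have "(K * (M * (1 + quartic \<xi>))) powr (- 3 * b) \<le> quartic \<eta> powr (- 3 * b)"
        using q0 b0 by (intro powr_mono2') auto
      moreover have "(K * (M * (1 + quartic \<xi>))) powr (- 3 * b) = D * ?W"
        using K M by (simp add: D_def bump_zero_powr powr_mult)
      moreover have "quartic \<eta> powr (- 3 * b) = 1 / heis_norm \<eta> powr (12 * b)"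
        by (simp add: quartic_powr powr_minus_divide)
      ultimately have "D * ?W \<le> 1 / heis_norm \<eta> powr (12 * b)" by simp
      then have "D * ?W * ?\<Phi> (heis_mult \<xi> \<eta>) \<le> 1 / heis_norm \<eta> powr (12 * b) * ?\<Phi> (heis_mult \<xi> \<eta>)"
        by (rule mult_right_mono) (rule bump_nonneg)
      also have "\<dots> \<le> ?h \<eta>"
        unfolding sd using bump_nonneg[of b \<kappa> "heis_mult \<xi> (- \<eta>)"] by (simp add: divide_right_mono)
      finally show ?thesis .
    qed
    have "ennreal (D * ?W * i) = ennreal (D * ?W) * (\<integral>\<^sup>+\<eta>. ennreal (?\<Phi> \<eta>) \<partial>lborel)"
      using D bump_zero_pos[of b \<xi>] i by (simp add: ennreal_mult)
    also have "\<dots> = ennreal (D * ?W) * (\<integral>\<^sup>+\<eta>. ennreal (?\<Phi> (heis_mult \<xi> \<eta>)) \<partial>lborel)"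
      by (subst nn_integral_heis_mult_left) auto
    also have "\<dots> = (\<integral>\<^sup>+\<eta>. ennreal (D * ?W * ?\<Phi> (heis_mult \<xi> \<eta>)) \<partial>lborel)"
      using D bump_zero_pos[of b \<xi>] by (subst nn_integral_cmult[symmetric]) (auto simp: ennreal_mult bump_nonneg)
    also have "\<dots> \<le> (\<integral>\<^sup>+\<eta>. ennreal (?h \<eta>) \<partial>lborel)"
      by (intro nn_integral_mono ennreal_leI pt)
    also have "\<dots> = ennreal (\<integral>\<eta>. ?h \<eta> \<partial>lborel)"
      by (rule nn_integral_eq_integral[OF int]) (use h0 in auto)
    finally have "D * ?W * i \<le> (\<integral>\<eta>. ?h \<eta> \<partial>lborel)"
      using h0 by (simp add: ennreal_le_iff integral_nonneg)
    then have "c / 2 * (D * ?W * i) \<le> c / 2 * (\<integral>\<eta>. ?h \<eta> \<partial>lborel)"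
      using c by (intro mult_left_mono) auto
    also have "\<dots> \<le> \<bar>frac_sub_laplacian c s ?\<Phi> \<xi>\<bar>"
      unfolding eq by simp
    finally show ?thesis .
  qed
  show ?thesis
    by (rule that[of "c / 2 * (D * i)"]) (use c D i0 main in \<open>auto simp: mult_ac\<close>)
qed

section \<open>Integration over space-time\<close>

lemma AE_lebesgue_snd:
  assumes "AE x in lebesgue. P (x :: 'b::euclidean_space)"
  shows "AE z in lebesgue. P (snd (z :: 'a::euclidean_space \<times> 'b))"
proof -
  obtain N where N: "N \<in> null_sets lebesgue" "{x. \<not> P x} \<subseteq> N"
    using assms by (auto simp: eventually_ae_filter)
  then obtain N' where N': "N' \<in> null_sets lborel" "N \<subseteq> N'"
    by (auto simp: null_sets_completion_iff2)
  have [measurable]: "N' \<in> sets borel" using N'(1) by (auto simp: null_sets_def)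
  have [measurable]: "snd \<in> borel \<rightarrow>\<^sub>M (borel :: 'b measure)"
    by (intro borel_measurable_continuous_onI continuous_intros)
  let ?M = "{z :: 'a \<times> 'b. snd z \<in> N'}"
  have M: "?M \<in> sets borel" by measurable
  have "emeasure lborel ?M = (\<integral>\<^sup>+z. indicator ?M z \<partial>lborel)"
    using M by simp
  also have "\<dots> = (\<integral>\<^sup>+x. \<integral>\<^sup>+y. indicator N' y \<partial>lborel \<partial>(lborel :: 'a measure))"
  proof -
    have "indicator ?M (x, y) = (indicator N' y :: ennreal)" for x y
      by (simp add: indicator_def)
    then show ?thesis using M by (subst nn_integral_lborel_pair) simp_all
  qed
  also have "\<dots> = 0" using N'(1) by (simp add: null_sets_def)
  finally have "?M \<in> null_sets lborel" using M by (auto simp: null_sets_def)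
  then have "?M \<in> null_sets lebesgue" by (rule null_sets_completionI)
  then show ?thesis
    by (rule AE_I') (use N(2) N'(2) in auto)
qed

lemma strip_integral:
  fixes g :: "'a::euclidean_space \<Rightarrow> real"
  assumes g: "g \<in> borel_measurable borel" "\<And>x. 0 \<le> g x" and G: "(\<integral>\<^sup>+x. ennreal (g x) \<partial>lborel) = ennreal G" "0 \<le> G"
    and T: "0 < T"
  shows "integrable lebesgue (\<lambda>z :: real \<times> 'a. indicator {0<..<T} (fst z) * g (snd z))"
    and "(\<integral>z. indicator {0<..<T} (fst z) * g (snd (z :: real \<times> 'a)) \<partial>lebesgue) = T * G"
proof -
  let ?h = "\<lambda>z :: real \<times> 'a. indicator {0<..<T} (fst z) * g (snd z)"
  have [measurable]: "snd \<in> borel \<rightarrow>\<^sub>M (borel :: 'a measure)" "fst \<in> (borel :: (real \<times> 'a) measure) \<rightarrow>\<^sub>M borel"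
    by (intro borel_measurable_continuous_onI continuous_intros)+
  note g(1) [measurable]
  have h [measurable]: "?h \<in> borel_measurable borel" by measurable
  have "(\<integral>\<^sup>+z. ennreal (?h z) \<partial>lborel) = (\<integral>\<^sup>+t. \<integral>\<^sup>+x. ennreal (indicator {0<..<T} t) * ennreal (g x) \<partial>lborel \<partial>lborel)"
    using g by (subst nn_integral_lborel_pair) (auto simp: ennreal_mult)
  also have "\<dots> = (\<integral>\<^sup>+t. indicator {0<..<T} t * ennreal G \<partial>lborel)"
    by (subst nn_integral_cmult) (auto simp: G ennreal_indicator)
  also have "\<dots> = ennreal T * ennreal G"
    using T by (subst nn_integral_multc) auto
  also have "\<dots> = ennreal (T * G)" using T G by (simp add: ennreal_mult)
  finally have "has_bochner_integral lborel ?h (T * G)"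
    using T G g by (intro has_bochner_integral_nn_integral) auto
  then have "integrable lborel ?h" "(\<integral>z. ?h z \<partial>lborel) = T * G"
    by (auto simp: has_bochner_integral_iff)
  then show "integrable lebesgue ?h" "(\<integral>z. ?h z \<partial>lebesgue) = T * G"
    by (auto simp: integrable_completion integral_completion)
qed

section \<open>Young's inequality and the cutoff in time\<close>

text \<open>
  Either the first term alone dominates, or \<open>x\<close> is small enough in terms of \<open>g\<close> for the second one to do so.
\<close>

lemma young_powr:
  fixes x g p :: real
  assumes "1 < p" "0 \<le> x" "0 \<le> g"
  shows "x * g \<le> x powr p / 2 + 2 powr (1 / (p - 1)) * g powr (p / (p - 1))"
proof (cases "2 * g \<le> x powr (p - 1)")
  case True
  then have "x * g \<le> x * (x powr (p - 1) / 2)"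
    using assms by (intro mult_left_mono) auto
  also have "\<dots> = x powr p / 2"
    using assms powr_mult_base[of x "p - 1"] by simp
  finally show ?thesis by (simp add: add_increasing2)
next
  case False
  have g: "0 < g" using False powr_ge_zero[of x "p - 1"] by linarith
  have "x = (x powr (p - 1)) powr (1 / (p - 1))"
    using assms by (simp add: powr_powr)
  also have "\<dots> \<le> (2 * g) powr (1 / (p - 1))"
    using False assms by (intro powr_mono2) auto
  finally have "x * g \<le> (2 * g) powr (1 / (p - 1)) * g"
    using assms by (intro mult_right_mono) auto
  also have "\<dots> = 2 powr (1 / (p - 1)) * (g * g powr (1 / (p - 1)))"
    using g by (simp add: powr_mult)
  also have "g * g powr (1 / (p - 1)) = g powr (p / (p - 1))"
  proof -
    have "1 + 1 / (p - 1) = p / (p - 1)" using assms by (simp add: field_simps)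
    then show ?thesis using powr_mult_base[of g "1 / (p - 1)"] g by simp
  qed
  finally show ?thesis by (simp add: add_increasing)
qed

text \<open>
  A time cutoff that reaches 0 at T polynomially. A large power l makes the quotient of the derivative and
  the cutoff harmless in Young's inequality; l at least 2 makes the cutoff continuously differentiable.
\<close>

definition cutoff :: "nat \<Rightarrow> real \<Rightarrow> real \<Rightarrow> real" where
  "cutoff l T t = (max 0 (1 - t / T)) ^ l"

definition cutoff' :: "nat \<Rightarrow> real \<Rightarrow> real \<Rightarrow> real" where
  "cutoff' l T t = - (real l / T) * (max 0 (1 - t / T)) ^ (l - 1)"

lemma cutoff_nonneg [simp]: "0 \<le> cutoff l T t"
  by (simp add: cutoff_def)

lemma cutoff_le_1: "0 < T \<Longrightarrow> 0 \<le> t \<Longrightarrow> cutoff l T t \<le> 1"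
  unfolding cutoff_def by (intro power_le_one) auto

lemma cutoff_eq_0: "0 < T \<Longrightarrow> 1 \<le> l \<Longrightarrow> T \<le> t \<Longrightarrow> cutoff l T t = 0"
  by (simp add: cutoff_def power_0_left)

lemma cutoff'_eq_0: "0 < T \<Longrightarrow> 2 \<le> l \<Longrightarrow> T \<le> t \<Longrightarrow> cutoff' l T t = 0"
  by (simp add: cutoff'_def power_0_left)

lemma DERIV_cutoff:
  assumes "2 \<le> l" "0 < T"
  shows "(cutoff l T has_real_derivative cutoff' l T t) (at t)"
proof -
  obtain n where n: "l = Suc n" "1 \<le> n" using assms(1) by (cases l) auto
  have "((\<lambda>t. 1 - t / T) has_real_derivative - (1 / T)) (at t)"
    using assms by (auto intro!: derivative_eq_intros)
  from DERIV_chain2[OF DERIV_pos_part_power[OF n(2), of "1 - t / T"] this] show ?thesis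
    unfolding cutoff_def[abs_def] cutoff'_def n(1) by (simp add: mult.commute)
qed

lemma continuous_cutoff: "0 < T \<Longrightarrow> continuous_on S (cutoff l T)"
  unfolding cutoff_def[abs_def] by (intro continuous_intros) auto

lemma continuous_cutoff': "0 < T \<Longrightarrow> continuous_on S (cutoff' l T)"
  unfolding cutoff'_def[abs_def] by (intro continuous_intros) auto

text \<open>
  Young's inequality is applied to x and the ratio of the coefficients. The ratio blows up like
  the reciprocal of \<open>1 - t / T\<close>, which the factor \<open>(1 - t / T) ^ l\<close> compensates because l is at least the
  conjugate exponent.
\<close>

lemma cutoff_young:
  fixes x p T t C :: real
  assumes p: "1 < p" and x: "0 \<le> x" and T: "0 < T" and t: "0 < t" and C: "0 \<le> C"
    and l: "2 \<le> l" "p / (p - 1) \<le> real l"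
  shows "x * (\<bar>cutoff' l T t\<bar> + C / T * cutoff l T t)
    \<le> x powr p * cutoff l T t / 2 + 2 powr (1 / (p - 1)) * ((real l + C) / T) powr (p / (p - 1))"
proof -
  define m where "m = max 0 (1 - t / T)"
  define q where "q = p / (p - 1)"
  define G where "G = (real l + C) / T"
  have G: "0 \<le> G" using C T by (simp add: G_def)
  have m: "0 \<le> m" "m \<le> 1" using T t by (auto simp: m_def)
  have c: "cutoff l T t = m ^ l" "\<bar>cutoff' l T t\<bar> = real l / T * m ^ (l - 1)"
    using T m by (auto simp: cutoff_def cutoff'_def m_def abs_mult)
  show ?thesis
  proof (cases "m = 0")
    case True
    then show ?thesis using l(1) C T by (simp add: c power_0_left)
  next
    case False
    then have m0: "0 < m" using m by simp
    have ml: "m ^ l = m * m ^ (l - 1)" using l(1) by (cases l) auto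
    have "m ^ l \<le> m ^ (l - 1)" using m by (intro power_decreasing) auto
    then have "C / T * m ^ l \<le> C / T * m ^ (l - 1)"
      using C T by (intro mult_left_mono) auto
    then have "\<bar>cutoff' l T t\<bar> + C / T * cutoff l T t \<le> G * m ^ (l - 1)"
      unfolding c G_def by (simp add: add_divide_distrib distrib_right)
    then have "x * (\<bar>cutoff' l T t\<bar> + C / T * cutoff l T t) \<le> x * (G * m ^ (l - 1))"
      using x by (rule mult_left_mono)
    also have "\<dots> = m ^ l * (x * (G / m))" unfolding ml using m0 by simp
    also have "\<dots> \<le> m ^ l * (x powr p / 2 + 2 powr (1 / (p - 1)) * (G / m) powr q)"
      unfolding q_def using p x G m0 by (intro mult_left_mono young_powr) auto
    also have "\<dots> = x powr p * m ^ l / 2 + 2 powr (1 / (p - 1)) * G powr q * (m ^ l * m powr - q)"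
      using m0 G by (simp add: powr_divide powr_minus_divide algebra_simps)
    also have "m ^ l * m powr - q = m powr (real l - q)"
      using m0 by (simp add: powr_realpow[symmetric] powr_add[symmetric])
    also have "2 powr (1 / (p - 1)) * G powr q * m powr (real l - q) \<le> 2 powr (1 / (p - 1)) * G powr q * 1"
      using l(2) m m0 by (intro mult_left_mono powr_le1) (auto simp: q_def)
    finally show ?thesis unfolding c q_def G_def by simp
  qed
qed

section \<open>The weak formulation for separable test functions\<close>

lemma frac_sub_laplacian_cmult:
  "frac_sub_laplacian c s (\<lambda>\<xi>. a * u \<xi>) \<xi> = a * frac_sub_laplacian c s u \<xi>"
proof -
  have e: "(a * x + a * y - 2 * (a * z)) / d = a * ((x + y - 2 * z) / d)" for x y z d :: real
    by (simp add: algebra_simps)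
  show ?thesis unfolding frac_sub_laplacian_def e integral_mult_right_zero by simp
qed

text \<open>
  The weak formulation only involves the solution at positive times; extending its absolute value by 0
  gives a function on the whole of space-time.
\<close>

definition abs_on_times :: "(real \<Rightarrow> 'a \<Rightarrow> real) \<Rightarrow> real \<times> 'a \<Rightarrow> real" where
  "abs_on_times u z = indicator (time_space \<infinity>) z * \<bar>u (fst z) (snd z)\<bar>"

lemma time_space_infinity: "time_space \<infinity> = {z. 0 < fst z}"
  by (auto simp: time_space_def)

text \<open>
  The integrands of the weak formulation for the test function \<open>cutoff l T t * g \<xi>\<close>, on the whole of
  space-time.
\<close>

definition tested_diffusion :: "real \<Rightarrow> real \<Rightarrow> (real \<Rightarrow> 'n heis \<Rightarrow> real) \<Rightarrow> nat \<Rightarrow> real \<Rightarrow> ('n::finite heis \<Rightarrow> real) \<Rightarrow> real \<times> 'n heis \<Rightarrow> real" where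
  "tested_diffusion c s u l T g z = indicator (time_space \<infinity>) z * (u (fst z) (snd z) *
     (cutoff' l T (fst z) * g (snd z) - cutoff l T (fst z) * frac_sub_laplacian c s g (snd z)))"

definition tested_reaction where
  "tested_reaction p u l T g z = abs_on_times u z powr p * (cutoff l T (fst z) * g (snd z))"

definition tested_source where
  "tested_source f l T g z = indicator (time_space \<infinity>) z * (f (snd z) * (cutoff l T (fst z) * g (snd z)))"

lemma abs_on_times_nonneg [simp]: "0 \<le> abs_on_times u z"
  by (simp add: abs_on_times_def)

text \<open>
  The term with the initial value is nonnegative and has been dropped, which turns the identity into an
  inequality.
\<close>

lemma weak_solution_tested:
  fixes u :: "real \<Rightarrow> 'n::finite heis \<Rightarrow> real"
  assumes ws: "weak_solution c s p \<infinity> u0 f u"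
    and g: "C2 g" "compact K" "closure {x. g x \<noteq> 0} \<subseteq> K" "\<And>x. 0 \<le> g x"
    and l: "2 \<le> l" and T: "0 < T" and u0: "AE \<xi> in lebesgue. 0 \<le> u0 \<xi>"
  shows "integrable lebesgue (tested_diffusion c s u l T g)"
    "integrable lebesgue (tested_reaction p u l T g)"
    "integrable lebesgue (tested_source f l T g)"
    "(\<integral>z. tested_reaction p u l T g z \<partial>lebesgue) + (\<integral>z. tested_source f l T g z \<partial>lebesgue)
       \<le> - (\<integral>z. tested_diffusion c s u l T g z \<partial>lebesgue)"
proof -
  let ?\<phi> = "\<lambda>t x. cutoff l T t * g x"
  have "test_function \<infinity> ?\<phi>"
    by (rule test_function_separable[where b = T])
       (use g l T in \<open>auto intro: DERIV_cutoff continuous_cutoff' cutoff_eq_0\<close>)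
  moreover have "\<forall>t \<xi>. 0 \<le> t \<and> ereal t < \<infinity> \<longrightarrow> 0 \<le> ?\<phi> t \<xi>" using g(4) by simp
  ultimately have w: "set_integrable lebesgue (time_space \<infinity>) (\<lambda>(t, \<xi>). u t \<xi> * (deriv (\<lambda>\<tau>. ?\<phi> \<tau> \<xi>) t - frac_sub_laplacian c s (?\<phi> t) \<xi>))"
    "set_integrable lebesgue (time_space \<infinity>) (\<lambda>(t, \<xi>). \<bar>u t \<xi>\<bar> powr p * ?\<phi> t \<xi>)"
    "set_integrable lebesgue (time_space \<infinity>) (\<lambda>(t, \<xi>). f \<xi> * ?\<phi> t \<xi>)"
    "- (LINT z:time_space \<infinity>|lebesgue. (\<lambda>(t, \<xi>). u t \<xi> * (deriv (\<lambda>\<tau>. ?\<phi> \<tau> \<xi>) t - frac_sub_laplacian c s (?\<phi> t) \<xi>)) z)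
     = (LINT z:time_space \<infinity>|lebesgue. (\<lambda>(t, \<xi>). \<bar>u t \<xi>\<bar> powr p * ?\<phi> t \<xi>) z) + (\<integral>\<xi>. u0 \<xi> * ?\<phi> 0 \<xi> \<partial>lebesgue)
       + (LINT z:time_space \<infinity>|lebesgue. (\<lambda>(t, \<xi>). f \<xi> * ?\<phi> t \<xi>) z)"
    using ws unfolding weak_solution_def Let_def by blast+
  have d: "deriv (\<lambda>\<tau>. ?\<phi> \<tau> \<xi>) t = cutoff' l T t * g \<xi>" for t \<xi>
    using DERIV_cmult_right[OF DERIV_cutoff[OF l T, of t], of "g \<xi>"] by (rule DERIV_imp_deriv)
  have A: "(\<lambda>z. indicator (time_space \<infinity>) z *\<^sub>R (case z of (t, \<xi>) \<Rightarrow> u t \<xi> * (deriv (\<lambda>\<tau>. ?\<phi> \<tau> \<xi>) t - frac_sub_laplacian c s (?\<phi> t) \<xi>)))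
    = tested_diffusion c s u l T g"
    by (rule ext) (simp add: tested_diffusion_def d frac_sub_laplacian_cmult split: prod.split)
  have B: "(\<lambda>z. indicator (time_space \<infinity>) z *\<^sub>R (case z of (t, \<xi>) \<Rightarrow> \<bar>u t \<xi>\<bar> powr p * ?\<phi> t \<xi>)) = tested_reaction p u l T g"
    by (rule ext) (simp add: tested_reaction_def abs_on_times_def indicator_def split: prod.split)
  have D: "(\<lambda>z. indicator (time_space \<infinity>) z *\<^sub>R (case z of (t, \<xi>) \<Rightarrow> f \<xi> * ?\<phi> t \<xi>)) = tested_source f l T g"
    by (rule ext) (simp add: tested_source_def split: prod.split)
  show "integrable lebesgue (tested_diffusion c s u l T g)"
    "integrable lebesgue (tested_reaction p u l T g)"
    "integrable lebesgue (tested_source f l T g)"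
    using w(1-3) unfolding set_integrable_def A B D .
  have "0 \<le> (\<integral>\<xi>. u0 \<xi> * ?\<phi> 0 \<xi> \<partial>lebesgue)"
    by (rule integral_nonneg_AE) (use u0 g(4) in \<open>auto elim!: eventually_mono\<close>)
  then show "(\<integral>z. tested_reaction p u l T g z \<partial>lebesgue) + (\<integral>z. tested_source f l T g z \<partial>lebesgue)
       \<le> - (\<integral>z. tested_diffusion c s u l T g z \<partial>lebesgue)"
    using w(4) unfolding set_lebesgue_integral_def A B D by linarith
qed

lemma borel_measurable_abs_on_times:
  assumes "Lp_loc_Lp_loc p \<infinity> u"
  shows "abs_on_times u \<in> borel_measurable (lebesgue :: (real \<times> 'n::finite heis) measure)"
proof -
  have "open {z :: real \<times> 'n heis. 0 < fst z}" by (intro open_Collect_less continuous_intros)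
  then have "time_space \<infinity> \<in> sets (lebesgue :: (real \<times> 'n::finite heis) measure)"
    unfolding time_space_infinity by (intro sets_completionI_sets) auto
  then have "(\<lambda>z. indicator (time_space \<infinity>) z *\<^sub>R (case z of (t, x) \<Rightarrow> u t x)) \<in> borel_measurable lebesgue"
    using assms unfolding Lp_loc_Lp_loc_def by (subst borel_measurable_restrict_space_iff[symmetric]) auto
  then have "(\<lambda>z. \<bar>indicator (time_space \<infinity>) z *\<^sub>R (case z of (t, x) \<Rightarrow> u t x)\<bar>) \<in> borel_measurable lebesgue"
    by measurable
  also have "(\<lambda>z. \<bar>indicator (time_space \<infinity>) z *\<^sub>R (case z of (t, x) \<Rightarrow> u t x)\<bar>) = abs_on_times u"
    by (auto simp: abs_on_times_def abs_mult)
  finally show ?thesis .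
qed

lemma borel_measurable_lebesgue_prod:
  fixes h :: "real \<Rightarrow> real" and k :: "'n::finite heis \<Rightarrow> real"
  assumes [measurable]: "h \<in> borel_measurable borel" "k \<in> borel_measurable borel"
  shows "(\<lambda>z. h (fst z) * k (snd z)) \<in> borel_measurable lebesgue"
proof -
  have [measurable]: "snd \<in> borel \<rightarrow>\<^sub>M (borel :: 'n heis measure)" "fst \<in> (borel :: (real \<times> 'n heis) measure) \<rightarrow>\<^sub>M borel"
    by (intro borel_measurable_continuous_onI continuous_intros)+
  have "(\<lambda>z. h (fst z) * k (snd z)) \<in> borel_measurable (borel :: (real \<times> 'n heis) measure)"
    by measurable
  then show ?thesis by (intro measurable_completion) simp
qed

section \<open>Bounds for the solution and for the source\<close>

lemma bump_mass:
  assumes "hom_dim TYPE('n::finite) < 12 * b"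
  obtains W where "0 \<le> W" "\<And>R. 0 < R \<Longrightarrow>
    (\<integral>\<^sup>+\<xi>. ennreal (bump b 0 (dil (1 / R) (\<xi> :: 'n heis))) \<partial>lborel) = ennreal (R powr hom_dim TYPE('n) * W)"
proof -
  let ?I = "\<integral>\<^sup>+\<xi>. ennreal (bump b 0 (\<xi> :: 'n heis)) \<partial>lborel"
  have "?I = (\<integral>\<^sup>+\<eta>. ennreal ((1 + quartic (\<eta>::'n heis)) powr (- (12 * b) / 4)) \<partial>lborel)"
    by (simp add: bump_zero_powr)
  also have "\<dots> < \<infinity>" by (rule nn_integral_decaying[OF assms])
  finally obtain W where W: "0 \<le> W" "?I = ennreal W" by (cases ?I) auto
  have "(\<integral>\<^sup>+\<xi>. ennreal (bump b 0 (dil (1 / R) (\<xi> :: 'n heis))) \<partial>lborel) = ennreal (R powr hom_dim TYPE('n) * W)"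
    if R: "0 < R" for R
  proof -
    have "(\<integral>\<^sup>+\<xi>. ennreal (bump b 0 (dil (1 / R) (\<xi> :: 'n heis))) \<partial>lborel)
      = ennreal (R powr hom_dim TYPE('n)) * (\<integral>\<^sup>+\<xi>. ennreal (bump b 0 (dil (1 / R) (dil R (\<xi> :: 'n heis)))) \<partial>lborel)"
      by (rule nn_integral_dil[symmetric]) (use R in measurable)
    then show ?thesis using R W by (simp add: ennreal_mult)
  qed
  with W(1) show ?thesis by (rule that)
qed

text \<open>
  A weak solution has no prescribed growth, but the weak formulation has to converge absolutely for every
  test function. Off the support of a test function the operator is at least a multiple of the weight, so
  convergence of the diffusion term bounds the solution there. On the support it is bounded by the
  reaction term of a second test function with a larger support.
\<close>

lemma weighted_integrable:
  fixes u :: "real \<Rightarrow> 'n::finite heis \<Rightarrow> real"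
  assumes ws: "weak_solution c s p \<infinity> u0 f u" and u0: "AE \<xi> in lebesgue. 0 \<le> u0 \<xi>"
    and s: "0 < s" "s < 1" and c: "0 < c" and b: "12 * b = hom_dim TYPE('n) + 2 * s"
    and p: "1 < p" and l: "2 \<le> l" and T: "0 < T"
  shows "integrable lebesgue (\<lambda>z. abs_on_times u z * (cutoff l T (fst z) * bump b 0 (snd z)))"
proof -
  have b0: "0 < b" using b s hom_dim_pos[where 'n='n] by linarith
  let ?w = "bump b 0 :: 'n heis \<Rightarrow> real"
  have C2: "C2 (bump b \<kappa> :: 'n heis \<Rightarrow> real)" for \<kappa>
    using C2_bump[of b \<kappa> 1, where 'n='n] by simp
  have supp: "\<exists>K :: 'n heis set. compact K \<and> closure {\<xi>. bump b \<kappa> \<xi> \<noteq> 0} \<subseteq> K" if \<kappa>: "0 < \<kappa>" for \<kappa>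
  proof -
    obtain K :: "'n heis set" where "compact K" "closure {\<xi>. bump b \<kappa> (dil 1 \<xi>) \<noteq> 0} \<subseteq> K"
      by (rule bump_compact_support[OF b0 \<kappa>, of 1]) (simp, (rule that; blast))
    then show ?thesis by (intro exI[of _ K]) simp
  qed
  \<comment> \<open>On the support of the first function the second one is at least \<open>(1 / 4) ^ 3\<close>.\<close>
  define \<Phi> where "\<Phi> = (bump b (1/2) :: 'n heis \<Rightarrow> real)"
  define \<Psi> where "\<Psi> = (bump b (1/4) :: 'n heis \<Rightarrow> real)"
  obtain K1 :: "'n heis set" where K1: "compact K1" "closure {\<xi>. \<Phi> \<xi> \<noteq> 0} \<subseteq> K1"
    using supp[of "1/2"] unfolding \<Phi>_def by auto
  obtain K2 :: "'n heis set" where K2: "compact K2" "closure {\<xi>. \<Psi> \<xi> \<noteq> 0} \<subseteq> K2"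
    using supp[of "1/4"] unfolding \<Psi>_def by auto
  have A: "integrable lebesgue (tested_diffusion c s u l T \<Phi>)"
    by (rule weak_solution_tested(1)[OF ws _ K1 _ l T u0]) (auto simp: \<Phi>_def C2)
  have B: "integrable lebesgue (tested_reaction p u l T \<Psi>)"
    by (rule weak_solution_tested(2)[OF ws _ K2 _ l T u0]) (auto simp: \<Psi>_def C2)
  obtain C where C: "0 < C" and low: "\<And>\<xi> :: 'n heis. bump b (1/2) \<xi> = 0 \<Longrightarrow>
    C * bump b 0 \<xi> \<le> \<bar>frac_sub_laplacian c s (bump b (1/2)) \<xi>\<bar>"
    by (rule frac_sub_laplacian_bump_lower[OF s c b, of "1/2"]) (simp, simp, (rule that; blast))
  obtain W where W: "0 \<le> W" "\<And>R. 0 < R \<Longrightarrow>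
    (\<integral>\<^sup>+\<xi>. ennreal (bump b 0 (dil (1 / R) (\<xi> :: 'n heis))) \<partial>lborel) = ennreal (R powr hom_dim TYPE('n) * W)"
    by (rule bump_mass[where 'n='n and b=b]) (use b s in \<open>simp\<close>, (rule that; blast))
  have S: "integrable lebesgue (\<lambda>z. indicator {0<..<T} (fst z) * ?w (snd z))"
    by (rule strip_integral(1)[where G=W]) (use W(1) W(2)[of 1] T in auto)
  have meas: "(\<lambda>z. abs_on_times u z * (cutoff l T (fst z) * ?w (snd z))) \<in> borel_measurable lebesgue"
  proof (rule borel_measurable_times[OF _ borel_measurable_lebesgue_prod])
    show "abs_on_times u \<in> borel_measurable lebesgue"
      using ws unfolding weak_solution_def by (intro borel_measurable_abs_on_times) blast
    show "cutoff l T \<in> borel_measurable borel"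
      using T by (intro borel_measurable_continuous_onI continuous_cutoff)
  qed measurable
  let ?G = "\<lambda>z. (1 / C) * \<bar>tested_diffusion c s u l T \<Phi> z\<bar> + (indicator {0<..<T} (fst z) * ?w (snd z)
    + 64 * tested_reaction p u l T \<Psi> z)"
  show ?thesis
  proof (rule Bochner_Integration.integrable_bound[OF _ meas])
    show "integrable lebesgue ?G"
      by (intro Bochner_Integration.integrable_add integrable_mult_right integrable_abs A B S)
    have "abs_on_times u z * (cutoff l T (fst z) * ?w (snd z)) \<le> ?G z" for z :: "real \<times> 'n heis"
    proof -
      obtain t \<xi> where z: "z = (t, \<xi>)" by (cases z)
      let ?U = "abs_on_times u z"
      have B0: "0 \<le> tested_reaction p u l T \<Psi> z"
        unfolding tested_reaction_def \<Psi>_def by simp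
      have w: "0 \<le> ?w \<xi>" "?w \<xi> \<le> 1" using bump_le_1[of b 0 \<xi>] b0 by auto
      show ?thesis
      proof (cases "0 < t \<and> t < T")
        case False
        then have "?U * cutoff l T t = 0"
          using T l cutoff_eq_0[of T l t] by (auto simp: abs_on_times_def time_space_infinity z)
        then have "?U * (cutoff l T (fst z) * ?w (snd z)) = 0" by (auto simp: z)
        also have "0 \<le> ?G z" using B0 C by simp
        finally show ?thesis .
      next
        case True
        then have ind: "z \<in> time_space \<infinity>" "t \<in> {0<..<T}" by (auto simp: time_space_infinity z)
        show ?thesis
        proof (cases "\<Phi> \<xi> = 0")
          case True
          have "\<bar>tested_diffusion c s u l T \<Phi> z\<bar> = ?U * cutoff l T t * \<bar>frac_sub_laplacian c s \<Phi> \<xi>\<bar>"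
            using ind True by (simp add: tested_diffusion_def abs_on_times_def z abs_mult)
          also have "\<dots> \<ge> ?U * cutoff l T t * (C * ?w \<xi>)"
            using low[of \<xi>] True by (intro mult_left_mono) (auto simp: \<Phi>_def)
          finally have "?U * (cutoff l T t * ?w \<xi>) \<le> (1 / C) * \<bar>tested_diffusion c s u l T \<Phi> z\<bar>"
            using C by (simp add: field_simps)
          moreover have "0 \<le> indicator {0<..<T} t * ?w \<xi>" using w by simp
          ultimately show ?thesis using B0 unfolding z fst_conv snd_conv by linarith
        next
          case False
          then have "1 / 2 < (1 + quartic \<xi>) powr - b"
            unfolding \<Phi>_def bump_def by (auto simp: max_def split: if_splits)
          then have "(1 / 4) ^ 3 \<le> \<Psi> \<xi>"
            unfolding \<Psi>_def bump_def by (intro power_mono) auto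
          then have \<Psi>: "1 \<le> 64 * \<Psi> \<xi>" by (simp add: eval_nat_numeral)
          \<comment> \<open>Values below 1 are paid for by the finite mass of the weight, the others by the reaction term.\<close>
          have U: "?U \<le> 1 + ?U powr p"
          proof (cases "?U \<le> 1")
            case False
            then have "?U powr 1 \<le> ?U powr p" using p by (intro powr_mono) auto
            then show ?thesis using False by simp
          qed (simp add: add_increasing2)
          have c1: "0 \<le> cutoff l T t" "cutoff l T t \<le> 1" using cutoff_le_1[OF T] True by auto
          have "?U * (cutoff l T t * ?w \<xi>) \<le> (1 + ?U powr p) * (cutoff l T t * ?w \<xi>)"
            using U c1 w by (intro mult_right_mono) auto
          also have "\<dots> = cutoff l T t * ?w \<xi> + ?U powr p * cutoff l T t * ?w \<xi>"
            by (simp add: algebra_simps)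
          also have "cutoff l T t * ?w \<xi> \<le> 1 * ?w \<xi>" using c1 w by (intro mult_right_mono) auto
          also have "?U powr p * cutoff l T t * ?w \<xi> \<le> ?U powr p * cutoff l T t * (64 * \<Psi> \<xi>)"
            using c1 w \<Psi> by (intro mult_left_mono) auto
          also have "\<dots> = 64 * tested_reaction p u l T \<Psi> z"
            by (simp add: tested_reaction_def z)
          finally have "?U * (cutoff l T t * ?w \<xi>) \<le> ?w \<xi> + 64 * tested_reaction p u l T \<Psi> z"
            by simp
          moreover have "0 \<le> (1 / C) * \<bar>tested_diffusion c s u l T \<Phi> z\<bar>" using C by simp
          ultimately show ?thesis using ind by (simp add: z)
        qed
      qed
    qed
    then have "\<bar>abs_on_times u z * (cutoff l T (fst z) * ?w (snd z))\<bar> \<le> \<bar>?G z\<bar>" for z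
      by (subst abs_of_nonneg) (simp, rule order_trans[OF _ abs_ge_self])
    then have "norm (abs_on_times u z * (cutoff l T (fst z) * ?w (snd z))) \<le> norm (?G z)" for z
      unfolding real_norm_def .
    then show "AE z in lebesgue. norm (abs_on_times u z * (cutoff l T (fst z) * ?w (snd z))) \<le> norm (?G z)"
      by (rule AE_I2)
  qed
qed

text \<open>
  Young's inequality absorbs the solution into the reaction term. The constants do not depend on the scale R nor on the truncation level. The
  time scale \<open>R powr (2 * s)\<close> equalises the sizes of the time derivative and of the fractional operator.
  The conjugate exponent of p is \<open>Q / (2 * s)\<close>, so the mass of order \<open>R powr Q\<close> of the weight is exactly
  cancelled by the coefficients from Young's inequality, and only the length of the time interval is left.
\<close>

lemma source_upper_bound:
  fixes u :: "real \<Rightarrow> 'n::finite heis \<Rightarrow> real"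
  assumes ws: "weak_solution c s p \<infinity> u0 f u" and u0: "AE \<xi> in lebesgue. 0 \<le> u0 \<xi>"
    and s: "0 < s" "s < 1" and c: "0 < c" and b: "12 * b = hom_dim TYPE('n) + 2 * s"
    and p: "p = hom_dim TYPE('n) / (hom_dim TYPE('n) - 2 * s)" 
    and l: "2 \<le> l" "hom_dim TYPE('n) / (2 * s) \<le> real l"
  obtains C K where "0 \<le> C" "0 \<le> K"
    "\<And>R \<kappa>. \<lbrakk>1 \<le> R; 0 < \<kappa>\<rbrakk> \<Longrightarrow>
      integrable lebesgue (\<lambda>z. abs_on_times u z * (cutoff l (R powr (2 * s)) (fst z) * bump b 0 (dil (1 / R) (snd z)))) \<and>
      integrable lebesgue (\<lambda>z. abs_on_times u z * (cutoff l (R powr (2 * s)) (fst z) * bump b \<kappa> (dil (1 / R) (snd z)))) \<and>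
      integrable lebesgue (tested_source f l (R powr (2 * s)) (\<lambda>\<xi>. bump b \<kappa> (dil (1 / R) \<xi>))) \<and>
      (\<integral>z. tested_source f l (R powr (2 * s)) (\<lambda>\<xi>. bump b \<kappa> (dil (1 / R) \<xi>)) z \<partial>lebesgue)
      \<le> R powr (2 * s) * K + C / R powr (2 * s) *
        (\<integral>z. abs_on_times u z * (cutoff l (R powr (2 * s)) (fst z) * (bump b 0 (dil (1 / R) (snd z)) - bump b \<kappa> (dil (1 / R) (snd z)))) \<partial>lebesgue)"
proof -
  let ?Q = "hom_dim TYPE('n)"
  have Q: "4 \<le> ?Q" by (rule hom_dim_pos)
  have b0: "0 < b" using b s Q by linarith
  have p1: "1 < p" unfolding p using Q s by simp
  have "p - 1 = 2 * s / (?Q - 2 * s)" unfolding p using Q s by (simp add: field_simps)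
  then have pq: "p / (p - 1) = ?Q / (2 * s)" unfolding p using Q s by simp
  obtain C where C: "0 \<le> C" and up: "\<And>\<kappa> R (\<xi> :: 'n heis). 0 \<le> \<kappa> \<Longrightarrow> 0 < R \<Longrightarrow>
    \<bar>frac_sub_laplacian c s (\<lambda>\<xi>. bump b \<kappa> (dil (1 / R) \<xi>)) \<xi>\<bar> \<le> C * R powr (- 2 * s) * bump b 0 (dil (1 / R) \<xi>)"
    by (rule frac_sub_laplacian_bump_upper[OF s less_imp_le[OF c] b]) (rule that; blast)
  obtain W where W: "0 \<le> W" "\<And>R. 0 < R \<Longrightarrow>
    (\<integral>\<^sup>+\<xi>. ennreal (bump b 0 (dil (1 / R) (\<xi> :: 'n heis))) \<partial>lborel) = ennreal (R powr ?Q * W)"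
    by (rule bump_mass[where 'n='n and b=b]) (use b s in \<open>simp\<close>, (rule that; blast))
  define K1 where "K1 = 2 powr (1 / (p - 1)) * (real l + C) powr (?Q / (2 * s))"
  have K1: "0 \<le> K1" by (simp add: K1_def)
  have main: "integrable lebesgue (\<lambda>z. abs_on_times u z * (cutoff l (R powr (2 * s)) (fst z) * bump b 0 (dil (1 / R) (snd z)))) \<and>
      integrable lebesgue (\<lambda>z. abs_on_times u z * (cutoff l (R powr (2 * s)) (fst z) * bump b \<kappa> (dil (1 / R) (snd z)))) \<and>
      integrable lebesgue (tested_source f l (R powr (2 * s)) (\<lambda>\<xi>. bump b \<kappa> (dil (1 / R) \<xi>))) \<and>
      (\<integral>z. tested_source f l (R powr (2 * s)) (\<lambda>\<xi>. bump b \<kappa> (dil (1 / R) \<xi>)) z \<partial>lebesgue)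
      \<le> R powr (2 * s) * (K1 * W) + C / R powr (2 * s) *
        (\<integral>z. abs_on_times u z * (cutoff l (R powr (2 * s)) (fst z) * (bump b 0 (dil (1 / R) (snd z)) - bump b \<kappa> (dil (1 / R) (snd z)))) \<partial>lebesgue)"
    if R: "1 \<le> R" and \<kappa>: "0 < \<kappa>" for R \<kappa>
  proof -
    define T where "T = R powr (2 * s)"
    have T: "0 < T" using R by (simp add: T_def)
    define w where "w = (\<lambda>\<xi> :: 'n heis. bump b 0 (dil (1 / R) \<xi>))"
    define g where "g = (\<lambda>\<xi> :: 'n heis. bump b \<kappa> (dil (1 / R) \<xi>))"
    have [measurable]: "w \<in> borel_measurable borel" "g \<in> borel_measurable borel"
      unfolding w_def g_def by measurable
    have gw: "0 \<le> g \<xi>" "g \<xi> \<le> w \<xi>" for \<xi>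
      unfolding g_def w_def by (rule bump_nonneg) (rule bump_antimono[OF less_imp_le[OF \<kappa>]])
    obtain Ks :: "'n heis set" where Ks': "compact Ks" "closure {\<xi>. bump b \<kappa> (dil (1 / R) \<xi>) \<noteq> 0} \<subseteq> Ks"
      by (rule bump_compact_support[OF b0 \<kappa>, of "1 / R"]) (use R in \<open>simp\<close>, (rule that; blast))
    have Ks: "compact Ks" "closure {\<xi>. g \<xi> \<noteq> 0} \<subseteq> Ks"
      using Ks' by (simp_all add: g_def)
    have "C2 g" unfolding g_def by (rule C2_bump)
    note tested = weak_solution_tested[OF ws this Ks gw(1) l(1) T u0]
    have Umeas: "abs_on_times u \<in> borel_measurable lebesgue"
      using ws unfolding weak_solution_def by (intro borel_measurable_abs_on_times) blast
    have \<theta>meas: "cutoff l T \<in> borel_measurable borel"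
      using T by (intro borel_measurable_continuous_onI continuous_cutoff)
    have Iw: "integrable lebesgue (\<lambda>z. abs_on_times u z * (cutoff l T (fst z) * w (snd z)))"
    proof (rule Bochner_Integration.integrable_bound)
      show "integrable lebesgue (\<lambda>z. R powr (12 * b) * (abs_on_times u z * (cutoff l T (fst z) * bump b 0 (snd z))))"
        by (intro integrable_mult_right weighted_integrable[OF ws u0 s c b p1 l(1) T])
      show "(\<lambda>z. abs_on_times u z * (cutoff l T (fst z) * w (snd z))) \<in> borel_measurable lebesgue"
        by (intro borel_measurable_times borel_measurable_lebesgue_prod Umeas \<theta>meas) measurable
      have "w \<xi> \<le> R powr (12 * b) * bump b 0 \<xi>" for \<xi>
      proof -
        have R4: "1 \<le> R ^ 4" using R by simp
        have "(1 + quartic \<xi>) / R ^ 4 \<le> 1 + quartic \<xi> / R ^ 4"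
          using R4 R by (simp add: add_divide_distrib divide_le_eq_1_pos)
        then have "(1 + quartic \<xi> / R ^ 4) powr (- 3 * b) \<le> ((1 + quartic \<xi>) / R ^ 4) powr (- 3 * b)"
          using b0 R by (intro powr_mono2') auto
        also have "\<dots> = (R ^ 4) powr (3 * b) * (1 + quartic \<xi>) powr (- 3 * b)"
          using R by (simp add: powr_divide powr_minus_divide)
        also have "(R ^ 4) powr (3 * b) = (R powr 4) powr (3 * b)" using R by simp
        also have "\<dots> = R powr (12 * b)" by (simp only: powr_powr) simp
        finally show ?thesis
          unfolding w_def by (simp add: bump_zero_powr quartic_dil power_divide)
      qed
      then have "abs_on_times u z * (cutoff l T (fst z) * w (snd z))
         \<le> abs_on_times u z * (cutoff l T (fst z) * (R powr (12 * b) * bump b 0 (snd z)))" for z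
        by (intro mult_left_mono) auto
      then show "AE z in lebesgue. norm (abs_on_times u z * (cutoff l T (fst z) * w (snd z)))
         \<le> norm (R powr (12 * b) * (abs_on_times u z * (cutoff l T (fst z) * bump b 0 (snd z))))"
        by (intro AE_I2) (simp add: w_def abs_mult mult.left_commute)
    qed
    have Ig: "integrable lebesgue (\<lambda>z. abs_on_times u z * (cutoff l T (fst z) * g (snd z)))"
    proof (rule Bochner_Integration.integrable_bound[OF Iw])
      show "(\<lambda>z. abs_on_times u z * (cutoff l T (fst z) * g (snd z))) \<in> borel_measurable lebesgue"
        by (intro borel_measurable_times borel_measurable_lebesgue_prod Umeas \<theta>meas) measurable
      have "abs_on_times u z * (cutoff l T (fst z) * g (snd z))
         \<le> abs_on_times u z * (cutoff l T (fst z) * w (snd z))" for z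
        using gw by (intro mult_left_mono) auto
      then show "AE z in lebesgue. norm (abs_on_times u z * (cutoff l T (fst z) * g (snd z)))
         \<le> norm (abs_on_times u z * (cutoff l T (fst z) * w (snd z)))"
        using gw by (intro AE_I2) (simp add: abs_mult w_def)
    qed
    let ?E = "\<lambda>z. abs_on_times u z * (cutoff l T (fst z) * (w (snd z) - g (snd z)))"
    have IE: "integrable lebesgue ?E"
      using Bochner_Integration.integrable_diff[OF Iw Ig] by (simp add: algebra_simps)
    have Sm: "(\<integral>\<^sup>+\<xi>. ennreal (w \<xi>) \<partial>lborel) = ennreal (R powr ?Q * W)" "0 \<le> R powr ?Q * W"
      unfolding w_def using W R by auto
    have w0: "0 \<le> w \<xi>" for \<xi> by (simp add: w_def)
    let ?S = "\<lambda>z :: real \<times> 'n heis. indicator {0<..<T} (fst z) * w (snd z)"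
    have IS: "integrable lebesgue ?S" "(\<integral>z. ?S z \<partial>lebesgue) = T * (R powr ?Q * W)"
      by (rule strip_integral[OF _ w0 Sm T], measurable)+
    let ?A = "tested_diffusion c s u l T g" and ?B = "tested_reaction p u l T g"
    have Tq: "T powr (?Q / (2 * s)) = R powr ?Q"
      unfolding T_def using R s by (simp add: powr_powr)
    define K2 where "K2 = K1 / R powr ?Q"
    have K2: "0 \<le> K2" using K1 by (simp add: K2_def)
    have K2_eq: "K2 = 2 powr (1 / (p - 1)) * ((real l + C) / T) powr (p / (p - 1))"
      unfolding K2_def K1_def pq Tq[symmetric] using C T by (simp add: powr_divide)
    \<comment> \<open>Outside the support of g the reaction term vanishes;
      there the full weight, not g, bounds the operator, and the last term is the price.\<close>
    have pt: "- ?A z \<le> ?B z / 2 + (K2 * ?S z + C / T * ?E z)" for z :: "real \<times> 'n heis"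
    proof -
      obtain t \<xi> where z: "z = (t, \<xi>)" by (cases z)
      let ?U = "abs_on_times u z"
      show ?thesis
      proof (cases "0 < t \<and> t < T")
        case False
        then have "?A z = 0"
          using T l cutoff_eq_0[of T l t] cutoff'_eq_0[of T l t]
          by (auto simp: tested_diffusion_def time_space_infinity z)
        moreover have "0 \<le> ?B z" using gw by (simp add: tested_reaction_def)
        moreover have "0 \<le> K2 * ?S z" using K2 w0 by simp
        moreover have "0 \<le> C / T * ?E z" using C T gw by simp
        ultimately show ?thesis by linarith
      next
        case True
        then have ind: "z \<in> time_space \<infinity>" "t \<in> {0<..<T}" by (auto simp: time_space_infinity z)
        have L: "\<bar>frac_sub_laplacian c s g \<xi>\<bar> \<le> C / T * w \<xi>"
          using up[of \<kappa> R \<xi>] \<kappa> R unfolding g_def w_def T_def by (simp add: powr_minus_divide)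
        have "\<bar>cutoff' l T t * g \<xi> - cutoff l T t * frac_sub_laplacian c s g \<xi>\<bar>
          \<le> \<bar>cutoff' l T t\<bar> * g \<xi> + cutoff l T t * \<bar>frac_sub_laplacian c s g \<xi>\<bar>"
          using abs_triangle_ineq4[of "cutoff' l T t * g \<xi>" "cutoff l T t * frac_sub_laplacian c s g \<xi>"] gw(1)[of \<xi>]
          by (simp add: abs_mult)
        also have "\<dots> \<le> \<bar>cutoff' l T t\<bar> * g \<xi> + cutoff l T t * (C / T * w \<xi>)"
          using L by (intro add_left_mono mult_left_mono) auto
        finally have X: "\<bar>cutoff' l T t * g \<xi> - cutoff l T t * frac_sub_laplacian c s g \<xi>\<bar>
          \<le> \<bar>cutoff' l T t\<bar> * g \<xi> + cutoff l T t * (C / T * w \<xi>)" .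
        have "- ?A z \<le> \<bar>?A z\<bar>" by simp
        also have "\<dots> = ?U * \<bar>cutoff' l T t * g \<xi> - cutoff l T t * frac_sub_laplacian c s g \<xi>\<bar>"
          using ind by (simp add: tested_diffusion_def abs_on_times_def z abs_mult)
        also have "\<dots> \<le> ?U * (\<bar>cutoff' l T t\<bar> * g \<xi> + cutoff l T t * (C / T * w \<xi>))"
          using X by (rule mult_left_mono) simp
        also have "\<dots> = ?U * (\<bar>cutoff' l T t\<bar> + C / T * cutoff l T t) * g \<xi> + C / T * ?E z"
          by (simp add: z algebra_simps)
        also have "?U * (\<bar>cutoff' l T t\<bar> + C / T * cutoff l T t) * g \<xi>
          \<le> (?U powr p * cutoff l T t / 2 + K2) * g \<xi>"
          unfolding K2_eq using True l C T pq gw(1)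
          by (intro mult_right_mono cutoff_young p1) auto
        also have "\<dots> = ?B z / 2 + K2 * g \<xi>"
          by (simp add: tested_reaction_def z algebra_simps)
        also have "K2 * g \<xi> \<le> K2 * ?S z" using K2 gw(2)[of \<xi>] ind by (simp add: z mult_left_mono)
        finally show ?thesis by simp
      qed
    qed
    have "- (\<integral>z. ?A z \<partial>lebesgue) = (\<integral>z. - ?A z \<partial>lebesgue)" by simp
    also have "\<dots> \<le> (\<integral>z. ?B z / 2 + (K2 * ?S z + C / T * ?E z) \<partial>lebesgue)"
      using tested(1,2) IS(1) IE pt by (intro integral_mono) auto
    also have "\<dots> = (\<integral>z. ?B z \<partial>lebesgue) / 2 + (K2 * (\<integral>z. ?S z \<partial>lebesgue) + C / T * (\<integral>z. ?E z \<partial>lebesgue))"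
      using tested(2) IS(1) IE by simp
    also have "K2 * (\<integral>z. ?S z \<partial>lebesgue) = T * (K1 * W)"
      unfolding IS(2) K2_def using R by simp
    finally have "- (\<integral>z. ?A z \<partial>lebesgue) \<le> (\<integral>z. ?B z \<partial>lebesgue) / 2 + (T * (K1 * W) + C / T * (\<integral>z. ?E z \<partial>lebesgue))" .
    moreover have "0 \<le> (\<integral>z. ?B z \<partial>lebesgue)"
      using gw by (intro Bochner_Integration.integral_nonneg) (simp add: tested_reaction_def)
    ultimately have "(\<integral>z. tested_source f l T g z \<partial>lebesgue) \<le> T * (K1 * W) + C / T * (\<integral>z. ?E z \<partial>lebesgue)"
      using tested(4) by linarith
    with Iw Ig tested(3) show ?thesis unfolding T_def w_def g_def by blast
  qed
  show ?thesis
    by (rule that[OF C mult_nonneg_nonneg[OF K1 W(1)] main])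
qed

text \<open>
  On the first half of the time interval and in the shell between 1 and R the source is at least
  \<open>R powr (\<alpha> - Q)\<close> and the test function is bounded below; beyond R the source is still nonnegative, and
  the unit ball contributes a bounded amount per unit of time.
\<close>

lemma source_lower_bound:
  fixes f :: "'n::finite heis \<Rightarrow> real"
  assumes M: "AE \<xi> in lebesgue. \<bar>f \<xi>\<bar> \<le> M" "0 \<le> M"
    and f: "AE \<xi> in lebesgue. heis_norm \<xi> \<ge> 1 \<longrightarrow> f \<xi> \<ge> heis_norm \<xi> powr (\<alpha> - hom_dim TYPE('n))"
    and \<alpha>: "\<alpha> < hom_dim TYPE('n)" and b: "0 < b" and \<kappa>: "0 \<le> \<kappa>" "\<kappa> \<le> 2 powr - b / 2"
    and l: "1 \<le> l" and T: "0 < T" and R: "1 \<le> R"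
    and int: "integrable lebesgue (tested_source f l T (\<lambda>\<xi>. bump b \<kappa> (dil (1 / R) \<xi>)))"
    and V: "emeasure lborel {\<xi> :: 'n heis. heis_norm \<xi> < 1} = ennreal V" "0 \<le> V"
  shows "((1 / 2) ^ l * (2 powr - b / 2) ^ 3 * R powr (\<alpha> - hom_dim TYPE('n))) * (T / 2 * (V * (R powr hom_dim TYPE('n) - 1)))
    - M * (T * V) \<le> (\<integral>z. tested_source f l T (\<lambda>\<xi>. bump b \<kappa> (dil (1 / R) \<xi>)) z \<partial>lebesgue)"
proof -
  let ?Q = "hom_dim TYPE('n)"
  define g where "g = (\<lambda>\<xi> :: 'n heis. bump b \<kappa> (dil (1 / R) \<xi>))"
  have g01: "0 \<le> g \<xi>" "g \<xi> \<le> 1" for \<xi>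
    unfolding g_def using bump_le_1[of b \<kappa> "dil (1 / R) \<xi>"] b \<kappa> by auto
  define c1 where "c1 = (1 / 2) ^ l * (2 powr - b / 2) ^ 3 * R powr (\<alpha> - ?Q)"
  have c1: "0 \<le> c1" by (simp add: c1_def)
  let ?B = "\<lambda>r. {\<xi> :: 'n heis. heis_norm \<xi> < r}"
  have Q: "4 \<le> ?Q" by (rule hom_dim_pos)
  have RQ: "1 \<le> R powr ?Q" using R Q by (intro ge_one_powr_ge_zero) auto
  have "emeasure lborel (?B R - ?B 1) = emeasure lborel (?B R) - emeasure lborel (?B 1)"
    using R V(1) by (intro emeasure_Diff) auto
  also have "\<dots> = ennreal (V * (R powr ?Q - 1))"
    using R RQ V by (subst emeasure_heis_ball) (auto simp: V ennreal_mult[symmetric] ennreal_minus algebra_simps)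
  finally have shell: "emeasure lborel (?B R - ?B 1) = ennreal (V * (R powr ?Q - 1))" .
  let ?S1 = "\<lambda>z :: real \<times> 'n heis. indicator {0<..<T} (fst z) * indicator (?B 1) (snd z) :: real"
  let ?S2 = "\<lambda>z :: real \<times> 'n heis. indicator {0<..<T / 2} (fst z) * indicator (?B R - ?B 1) (snd z) :: real"
  have S1: "integrable lebesgue ?S1" "(\<integral>z. ?S1 z \<partial>lebesgue) = T * V"
    by (rule strip_integral[where G = V and T = T]; use V T in \<open>auto simp: ennreal_indicator\<close>)+
  have S2: "integrable lebesgue ?S2" "(\<integral>z. ?S2 z \<partial>lebesgue) = T / 2 * (V * (R powr ?Q - 1))"
    by (rule strip_integral[where G = "V * (R powr ?Q - 1)" and T = "T / 2"]; use shell V RQ T in \<open>auto simp: ennreal_indicator\<close>)+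
  have "c1 * (T / 2 * (V * (R powr ?Q - 1))) - M * (T * V) = (\<integral>z. c1 * ?S2 z - M * ?S1 z \<partial>lebesgue)"
    using S1 S2 by simp
  also have "\<dots> \<le> (\<integral>z. tested_source f l T g z \<partial>lebesgue)"
  proof (rule integral_mono_AE)
    show "integrable lebesgue (\<lambda>z. c1 * ?S2 z - M * ?S1 z)" using S1 S2 by simp
    show "integrable lebesgue (tested_source f l T g)" using int by (simp add: g_def)
    show "AE z in lebesgue. c1 * ?S2 z - M * ?S1 z \<le> tested_source f l T g z"
      using AE_lebesgue_snd[OF M(1), where 'a=real] AE_lebesgue_snd[OF f, where 'a=real]
    proof eventually_elim
      case (elim z)
      obtain t \<xi> where z: "z = (t, \<xi>)" by (cases z)
      let ?n = "heis_norm \<xi>"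
      have M': "\<bar>f \<xi>\<bar> \<le> M" and f': "1 \<le> ?n \<Longrightarrow> ?n powr (\<alpha> - ?Q) \<le> f \<xi>"
        using elim by (auto simp: z)
      show ?case
      proof (cases "0 < t \<and> t < T")
        case False
        then show ?thesis
          using cutoff_eq_0[OF T l, of t] T by (auto simp: tested_source_def time_space_infinity z)
      next
        case True
        then have D: "tested_source f l T g z = f \<xi> * (cutoff l T t * g \<xi>)"
          by (simp add: tested_source_def time_space_infinity z)
        have t1: "0 \<le> cutoff l T t" "cutoff l T t \<le> 1" using cutoff_le_1[OF T] True by auto
        consider "?n < 1" | "1 \<le> ?n" "?n < R" "t < T / 2" | "1 \<le> ?n" "\<not> (?n < R \<and> t < T / 2)"
          by linarith
        then show ?thesis
        proof cases
          case 1
          have "\<bar>f \<xi> * (cutoff l T t * g \<xi>)\<bar> \<le> M * (1 * 1)"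
            unfolding abs_mult using M' t1 g01[of \<xi>] M(2) by (intro mult_mono) auto
          then show ?thesis using 1 R True unfolding D by (simp add: z indicator_def)
        next
          case 2
          have "1 / 2 \<le> 1 - t / T" using 2 T by (simp add: field_simps)
          then have "1 / 2 \<le> max 0 (1 - t / T)" by linarith
          then have th: "(1 / 2) ^ l \<le> cutoff l T t" unfolding cutoff_def by (rule power_mono) simp
          have "?n / R \<le> 1" using 2 R by simp
          then have "(?n / R) ^ 4 \<le> 1" by (intro power_le_one) (use R in auto)
          then have "quartic (dil (1 / R) \<xi>) \<le> 1"
            by (simp add: quartic_dil heis_norm_pow4 power_divide)
          then have "2 powr - b \<le> (1 + quartic (dil (1 / R) \<xi>)) powr - b"
            using b by (intro powr_mono2') auto
          then have gl: "(2 powr - b / 2) ^ 3 \<le> g \<xi>"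
            unfolding g_def bump_def using \<kappa> by (intro power_mono) auto
          have "R powr (\<alpha> - ?Q) \<le> ?n powr (\<alpha> - ?Q)"
            using 2 \<alpha> by (intro powr_mono2') auto
          then have fl: "R powr (\<alpha> - ?Q) \<le> f \<xi>" using f' 2 by linarith
          have "R powr (\<alpha> - ?Q) * ((1 / 2) ^ l * (2 powr - b / 2) ^ 3) \<le> f \<xi> * (cutoff l T t * g \<xi>)"
            using fl th gl t1 g01[of \<xi>] order_trans[OF powr_ge_zero fl] by (intro mult_mono) auto
          then show ?thesis unfolding D c1_def using 2 True by (simp add: z mult_ac)
        next
          case 3
          have "0 \<le> f \<xi>" using f'[OF 3(1)] powr_ge_zero[of ?n "\<alpha> - ?Q"] by linarith
          then have "0 \<le> tested_source f l T g z" unfolding D using t1 g01[of \<xi>] by simp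
          moreover have "?S2 z = 0" "?S1 z = 0" using 3 by (auto simp: z)
          then have "c1 * ?S2 z - M * ?S1 z = 0" by (simp only: mult_zero_right diff_zero)
          ultimately show ?thesis by (simp only:)
        qed
      qed
    qed
  qed
  finally show ?thesis unfolding c1_def g_def .
qed

lemma no_bound_for_growing_powers:
  fixes A B \<alpha> Q :: real
  assumes "0 < A" "0 < \<alpha>" "\<alpha> < Q"
  obtains R where "1 \<le> R" "B < A * R powr (\<alpha> - Q) * (R powr Q - 1)"
proof -
  \<comment> \<open>This makes \<open>R powr \<alpha>\<close> exceed \<open>\<bar>B\<bar> / A\<close> by more than the lower-order term, which is at most 1.\<close>
  define R where "R = (\<bar>B\<bar> / A + 2) powr (1 / \<alpha>)"
  have base: "1 \<le> \<bar>B\<bar> / A + 2" using assms(1) by simp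
  have R: "1 \<le> R" unfolding R_def using base assms by (intro ge_one_powr_ge_zero) auto
  have "R powr \<alpha> = \<bar>B\<bar> / A + 2" unfolding R_def using assms base by (simp add: powr_powr)
  moreover have "R powr (\<alpha> - Q) \<le> 1" using powr_mono[of "\<alpha> - Q" 0 R] R assms by simp
  moreover have "R powr (\<alpha> - Q) * (R powr Q - 1) = R powr \<alpha> - R powr (\<alpha> - Q)"
    using R by (simp add: algebra_simps powr_add[symmetric])
  ultimately have "\<bar>B\<bar> / A < R powr (\<alpha> - Q) * (R powr Q - 1)" by linarith
  then have "\<bar>B\<bar> < A * (R powr (\<alpha> - Q) * (R powr Q - 1))"
    using assms(1) by (simp add: pos_divide_less_eq mult.commute)
  then have "B < A * R powr (\<alpha> - Q) * (R powr Q - 1)" by (simp add: mult.assoc)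
  with R show ?thesis by (rule that)
qed

section \<open>Nonexistence of global weak solutions\<close>

theorem theorem1p4:
  fixes u0 f :: "'n::finite heis \<Rightarrow> real" and c s p Q \<alpha> :: real
  assumes "c > 0" and "0 < s" and "s < 1"
    and "Q = hom_dim TYPE('n)" and "p = Q / (Q - 2 * s)"
    and "L_infty u0" and "L1_loc u0"
    and "L_infty f" and "L1_loc f"
    and "AE \<xi> in lebesgue. u0 \<xi> \<ge> 0"
    and "ext_integral f > 0"
    and "0 < \<alpha>" and "\<alpha> < Q"
    and "AE \<xi> in lebesgue. heis_norm \<xi> \<ge> 1 \<longrightarrow> f \<xi> \<ge> heis_norm \<xi> powr (\<alpha> - Q)"
  shows "\<not> (\<exists>u. global_weak_solution c s p u0 f u)"
proof
  assume "\<exists>u. global_weak_solution c s p u0 f u"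
  then obtain u where ws: "weak_solution c s p \<infinity> u0 f u"
    unfolding global_weak_solution_def by blast
  have Q: "4 \<le> Q" unfolding assms(4) by (rule hom_dim_pos)
  define b where "b = (Q + 2 * s) / 12"
  have b: "12 * b = hom_dim TYPE('n) + 2 * s" "0 < b"
    using Q assms(2) by (auto simp: b_def assms(4))
  obtain l0 :: nat where "Q / (2 * s) \<le> real l0" using real_arch_simple by blast
  then have l: "2 \<le> max 2 l0" "hom_dim TYPE('n) / (2 * s) \<le> real (max 2 l0)"
    using assms(4) by auto
  define l where "l = max 2 l0"
  note l' = l[folded l_def]
  obtain M0 where "AE \<xi> in lebesgue. \<bar>f \<xi>\<bar> \<le> M0" using assms(8) unfolding L_infty_def by blast
  then have M: "AE \<xi> in lebesgue. \<bar>f \<xi>\<bar> \<le> \<bar>M0\<bar>" by (auto elim: eventually_mono)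
  let ?E = "emeasure lborel {\<xi> :: 'n heis. heis_norm \<xi> < 1}"
  obtain V where V: "0 \<le> V" "?E = ennreal V"
    using heis_ball_finite[of 1, where 'n='n] by (cases ?E) auto
  have V0: "0 < V" using heis_unit_ball_pos[where 'n='n] V by (auto simp: less_le)
  obtain C K where CK: "0 \<le> C" "0 \<le> K" and upper:
    "\<And>R \<kappa>. \<lbrakk>1 \<le> R; 0 < \<kappa>\<rbrakk> \<Longrightarrow>
      integrable lebesgue (\<lambda>z. abs_on_times u z * (cutoff l (R powr (2 * s)) (fst z) * bump b 0 (dil (1 / R) (snd z)))) \<and>
      integrable lebesgue (\<lambda>z. abs_on_times u z * (cutoff l (R powr (2 * s)) (fst z) * bump b \<kappa> (dil (1 / R) (snd z)))) \<and>
      integrable lebesgue (tested_source f l (R powr (2 * s)) (\<lambda>\<xi>. bump b \<kappa> (dil (1 / R) \<xi>))) \<and>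
      (\<integral>z. tested_source f l (R powr (2 * s)) (\<lambda>\<xi>. bump b \<kappa> (dil (1 / R) \<xi>)) z \<partial>lebesgue)
      \<le> R powr (2 * s) * K + C / R powr (2 * s) *
        (\<integral>z. abs_on_times u z * (cutoff l (R powr (2 * s)) (fst z) * (bump b 0 (dil (1 / R) (snd z)) - bump b \<kappa> (dil (1 / R) (snd z)))) \<partial>lebesgue)"
    by (rule source_upper_bound[OF ws assms(10,2,3,1) b(1) assms(5)[unfolded assms(4)] l']) (rule that; blast)
  define A where "A = (1 / 2) ^ l * (2 powr - b / 2) ^ 3 * V / 2"
  have A: "0 < A" using V0 by (simp add: A_def)
  obtain R where R: "1 \<le> R" "\<bar>M0\<bar> * V + K < A * R powr (\<alpha> - Q) * (R powr Q - 1)"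
    using no_bound_for_growing_powers[OF A assms(12,13)] by blast
  define T where "T = R powr (2 * s)"
  have T: "0 < T" using R by (simp add: T_def)
  \<comment> \<open>The bound on the levels keeps the truncated weights away from 0 on the ball of radius R.\<close>
  define \<kappa> where "\<kappa> j = (2 powr - b / 2) / real (Suc j)" for j
  have \<kappa>: "0 < \<kappa> j" "\<kappa> j \<le> 2 powr - b / 2" for j
    unfolding \<kappa>_def by (auto simp: divide_le_eq mult_le_cancel_left1)
  have \<kappa>_lim: "\<kappa> \<longlonglongrightarrow> 0"
    unfolding \<kappa>_def[abs_def] divide_inverse[of _ "real (Suc _)"]
    by (rule tendsto_mult_right_zero[OF LIMSEQ_inverse_real_of_nat])
  let ?E = "\<lambda>\<kappa> z. abs_on_times u z * (cutoff l T (fst z) * (bump b 0 (dil (1 / R) (snd z)) - bump b \<kappa> (dil (1 / R) (snd z))))"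
  \<comment> \<open>With R fixed, the truncation is removed; the limit needs the integrability of the solution against the weight.\<close>
  have lim: "(\<lambda>j. \<integral>z. ?E (\<kappa> j) z \<partial>lebesgue) \<longlonglongrightarrow> (\<integral>z. 0 \<partial>(lebesgue :: (real \<times> 'n heis) measure))"
  proof (rule integral_dominated_convergence)
    let ?w = "\<lambda>z. abs_on_times u z * (cutoff l T (fst z) * bump b 0 (dil (1 / R) (snd z)))"
    show w: "integrable lebesgue ?w" using upper[OF R(1) \<kappa>(1)[of 0]] unfolding T_def by blast
    show "(\<lambda>z. ?E (\<kappa> j) z) \<in> borel_measurable lebesgue" for j
    proof -
      have "integrable lebesgue (\<lambda>z. abs_on_times u z * (cutoff l T (fst z) * bump b (\<kappa> j) (dil (1 / R) (snd z))))"
        using upper[OF R(1) \<kappa>(1)[of j]] unfolding T_def by blast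
      from borel_measurable_integrable[OF Bochner_Integration.integrable_diff[OF w this]]
      show ?thesis by (simp add: algebra_simps)
    qed
    show "AE z in lebesgue. norm (?E (\<kappa> j) z) \<le> ?w z" for j
    proof (rule AE_I2)
      fix z :: "real \<times> 'n heis"
      have "0 \<le> bump b 0 (dil (1 / R) (snd z)) - bump b (\<kappa> j) (dil (1 / R) (snd z))"
        using bump_antimono[of 0 "\<kappa> j" b] \<kappa>(1)[of j] by simp
      moreover have "\<dots> \<le> bump b 0 (dil (1 / R) (snd z))" by simp
      ultimately show "norm (?E (\<kappa> j) z) \<le> ?w z"
        by (auto simp: abs_mult intro!: mult_left_mono)
    qed
    show "AE z in lebesgue. (\<lambda>j. ?E (\<kappa> j) z) \<longlonglongrightarrow> 0"
    proof (rule AE_I2)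
      fix z :: "real \<times> 'n heis"
      let ?\<xi> = "dil (1 / R) (snd z)"
      have "(\<lambda>j. bump b (\<kappa> j) ?\<xi>) \<longlonglongrightarrow> bump b 0 ?\<xi>"
        unfolding bump_def using \<kappa>_lim by (intro tendsto_intros)
      then have "(\<lambda>j. ?E (\<kappa> j) z) \<longlonglongrightarrow> abs_on_times u z * (cutoff l T (fst z) * (bump b 0 ?\<xi> - bump b 0 ?\<xi>))"
        by (intro tendsto_intros)
      then show "(\<lambda>j. ?E (\<kappa> j) z) \<longlonglongrightarrow> 0" by simp
    qed
  qed simp
  define X where "X = T * (A * R powr (\<alpha> - Q) * (R powr Q - 1)) - \<bar>M0\<bar> * (T * V)"
  have le: "X \<le> T * K + C / T * (\<integral>z. ?E (\<kappa> j) z \<partial>lebesgue)" for j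
  proof -
    note up = upper[OF R(1) \<kappa>(1)[of j], folded T_def]
    have "1 \<le> l" using l'(1) by simp
    have "X = ((1 / 2) ^ l * (2 powr - b / 2) ^ 3 * R powr (\<alpha> - Q)) * (T / 2 * (V * (R powr Q - 1))) - \<bar>M0\<bar> * (T * V)"
      unfolding X_def A_def by simp
    also have "\<dots> \<le> (\<integral>z. tested_source f l T (\<lambda>\<xi>. bump b (\<kappa> j) (dil (1 / R) \<xi>)) z \<partial>lebesgue)"
      using source_lower_bound[OF M _ assms(14)[unfolded assms(4)] assms(13)[unfolded assms(4)] b(2)
        less_imp_le[OF \<kappa>(1)] \<kappa>(2) \<open>1 \<le> l\<close> T R(1) _ V(2,1), of j] up
      unfolding assms(4) by simp
    also have "\<dots> \<le> T * K + C / T * (\<integral>z. ?E (\<kappa> j) z \<partial>lebesgue)" using up by blast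
    finally show ?thesis .
  qed
  have "X \<le> T * K + C / T * 0"
  proof (rule LIMSEQ_le_const)
    show "(\<lambda>j. T * K + C / T * (\<integral>z. ?E (\<kappa> j) z \<partial>lebesgue)) \<longlonglongrightarrow> T * K + C / T * 0"
      using lim by (intro tendsto_intros) simp
  qed (use le in auto)
  then have "T * (A * R powr (\<alpha> - Q) * (R powr Q - 1)) \<le> T * (\<bar>M0\<bar> * V + K)"
    unfolding X_def by (simp add: algebra_simps)
  then show False using R(2) T by simp
qed

end
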